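(* Let $\mathcal L$ be the operator in $L_2(\mathbb R^d)$ given by $(\mathcal L u)(x)=\int_{\mathbb R^d}a(x-y)u(y)\,dy+V(x)u(x)$, where $a$ and $V$ satisfy the standing assumptions in the context. Let $x_0$ be a point of the global minimum of $V$, and let $V_{\min}\le a_{\min}$. Let $N\in\mathbb N$ and assume that $a\in C^{2N+1}(Q_r(0))$ for some $r>0$, that $$\lim_{\delta\to0}\frac{h_N(\delta)}{\delta^{2N+d}}=0,\qquad h_N(\delta):=\max_{\substack{n\in\mathbb Z_+^d\\ |n|\le 2N}}\bigg|\int_{Q_1(0)}\big(V(x_0+\delta x)-V(x_0)\big)x^n\,dx\bigg|,$$ and that there exists a subspace $S$ of $\mathbb C^{M(N)}$ on which the quadratic form $$\mathfrak a_N[\zeta]:=\sum_{\substack{n,m\in\mathbb Z_+^d\\ |m|,|n|\le N}}(-1)^{|n|}\,\partial^{n+m}a(0)\,\zeta_m\overline{\zeta_n},\qquad \zeta=(\zeta_n)_{n\in\mathbb Z_+^d,\,|n|\le N},$$ is strictly negative (i.e. $\mathfrak a_N[\zeta]<0$ for all $0\ne\zeta\in S$). Then $\mathcal L$ possesses at least $\dim S$ eigenvalues (counted with multiplicity) in the interval $[a_{\min}+V_{\min},\mu_0)$.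
   Context: Let $d\ge 1$. Standing assumptions: $a\in L_1(\mathbb R^d)$ is complex-valued with $a(-x)=\overline{a(x)}$; $V=\mathcal F[\hat V]$ for some $\hat V\in L_1(\mathbb R^d)$ with $\hat V(-x)=\overline{\hat V(x)}$, where $\mathcal F[u](x):=\int_{\mathbb R^d}u(\xi)e^{-\mathrm i x\cdot\xi}\,d\xi$. Put $\hat a:=\mathcal F[a]$. Then $\hat a$ and $V$ are real-valued, bounded, continuous and tend to zero at infinity. Define $a_{\min}:=\inf_{\mathbb R^d}\hat a$, $V_{\min}:=\inf_{\mathbb R^d}V$ and $\mu_0:=\min\{a_{\min},V_{\min}\}$. The operator $\mathcal L$ is bounded and self-adjoint in $L_2(\mathbb R^d)$. $Q_r(x_0)$ denotes the cube in $\mathbb R^d$ with side $r$ centered at $x_0$. $\mathbb Z_+$ is the set of nonnegative integers; for $n\in\mathbb Z_+^d$, $|n|=n_1+\dots+n_d$, $x^n=x_1^{n_1}\cdots x_d^{n_d}$ and $\partial^n$ is the corresponding partial derivative. $M(N):=\#\{n\in\mathbb Z_+^d:\ |n|\le N\}$, and vectors of $\mathbb C^{M(N)}$ are indexed by $n\in\mathbb Z_+^d$, $|n|\le N$. Here $\delta\to0$ means $\delta\to0^+$. *)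

theory Defs
  imports
    "HOL-Analysis.Analysis"
    "HOL-Library.Function_Algebras"
    "HOL-Library.Extended_Nat"
begin

section \<open>Complex-valued functions as a complex vector space\<close>

global_interpretation cfun: vector_space "\<lambda>(c::complex) (f::'a \<Rightarrow> complex) x. c * f x"
  by unfold_locales (auto simp: fun_eq_iff algebra_simps)


section \<open>Multi-indices, partial derivatives, smoothness\<close>

definition mi_abs :: "('d::finite \<Rightarrow> nat) \<Rightarrow> nat" where
  "mi_abs n = (\<Sum>i\<in>UNIV. n i)"

definition mi_upto :: "nat \<Rightarrow> ('d::finite \<Rightarrow> nat) set" where
  "mi_upto K = {n. mi_abs n \<le> K}"

lemma finite_mi_upto: "finite (mi_upto K :: ('d::finite \<Rightarrow> nat) set)"
proof (rule finite_subset)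
  show "(mi_upto K :: ('d \<Rightarrow> nat) set) \<subseteq> PiE UNIV (\<lambda>_. {..K})"
  proof
    fix n :: "'d \<Rightarrow> nat" assume n: "n \<in> mi_upto K"
    have "n i \<le> K" for i
    proof -
      have "n i \<le> (\<Sum>i\<in>UNIV. n i)" by (rule member_le_sum) auto
      then show ?thesis using n by (simp add: mi_upto_def mi_abs_def)
    qed
    then show "n \<in> PiE UNIV (\<lambda>_. {..K})" by auto
  qed
  show "finite (PiE (UNIV::'d set) (\<lambda>_. {..K}))" by (intro finite_PiE) auto
qed

lemma mi_upto_nonempty: "mi_upto K \<noteq> {}"
proof -
  have "(\<lambda>_. 0) \<in> mi_upto K" by (simp add: mi_upto_def mi_abs_def)
  then show ?thesis by blast
qed

definition mi_power :: "real ^ 'd \<Rightarrow> ('d \<Rightarrow> nat) \<Rightarrow> real" where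
  "mi_power x n = (\<Prod>i\<in>UNIV. (x $ i) ^ n i)"

definition partial :: "'d::finite \<Rightarrow> (real ^ 'd \<Rightarrow> complex) \<Rightarrow> real ^ 'd \<Rightarrow> complex" where
  "partial i f x = vector_derivative (\<lambda>t. f (x + t *\<^sub>R axis i 1)) (at 0)"

definition has_partial_at :: "'d::finite \<Rightarrow> (real ^ 'd \<Rightarrow> complex) \<Rightarrow> real ^ 'd \<Rightarrow> bool" where
  "has_partial_at i f x \<longleftrightarrow> (\<lambda>t. f (x + t *\<^sub>R axis i 1)) differentiable (at 0)"

text \<open>The class \<open>C\<^sup>k(U)\<close>, for open \<open>U\<close>: all partial derivatives of order at most \<open>k\<close>
  (in any order of differentiation) exist and are continuous on \<open>U\<close>.\<close>

fun Ck_on :: "nat \<Rightarrow> (real ^ 'd::finite \<Rightarrow> complex) \<Rightarrow> (real ^ 'd) set \<Rightarrow> bool" where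
  "Ck_on 0 f U \<longleftrightarrow> continuous_on U f"
| "Ck_on (Suc k) f U \<longleftrightarrow>
     continuous_on U f \<and> (\<forall>i. (\<forall>x\<in>U. has_partial_at i f x) \<and> Ck_on k (partial i f) U)"

text \<open>A fixed enumeration of the coordinate directions. It only determines the order in which the
  differentiations in \<open>\<partial>\<^sup>n\<close> are carried out; for functions of class \<open>C\<^sup>k\<close> and \<open>|n| \<le> k\<close> the
  result does not depend on it.\<close>

definition coord_enum :: "'d::finite list" where
  "coord_enum = (SOME l. distinct l \<and> set l = UNIV)"

lemma coord_enum: "distinct (coord_enum :: 'd::finite list)" "set (coord_enum :: 'd list) = UNIV"
proof -
  have "\<exists>l::'d list. distinct l \<and> set l = UNIV"
    using finite_distinct_list[of "UNIV :: 'd set"] by auto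
  from someI_ex[OF this]
  show "distinct (coord_enum :: 'd list)" "set (coord_enum :: 'd list) = UNIV"
    by (auto simp: coord_enum_def)
qed

definition mi_deriv ::
    "('d::finite \<Rightarrow> nat) \<Rightarrow> (real ^ 'd \<Rightarrow> complex) \<Rightarrow> real ^ 'd \<Rightarrow> complex" where
  "mi_deriv n f = foldr (\<lambda>i. partial i ^^ n i) coord_enum f"


section \<open>Cubes and the Fourier transform\<close>

definition cube :: "real \<Rightarrow> real ^ 'd \<Rightarrow> (real ^ 'd) set" where
  "cube r x0 = {x. \<forall>i. \<bar>x $ i - x0 $ i\<bar> < r / 2}"

text \<open>\<open>L\<^sub>1\<close>-functions are given by Borel representatives, i.e. \<open>integrable lborel\<close>; every
  Lebesgue class contains one.\<close>

definition fourier :: "(real ^ 'd \<Rightarrow> complex) \<Rightarrow> real ^ 'd \<Rightarrow> complex" where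
  "fourier u x = (LINT \<xi>|lborel. u \<xi> * exp (- (\<i> * complex_of_real (x \<bullet> \<xi>))))"

definition hermitian_ae :: "(real ^ 'd \<Rightarrow> complex) \<Rightarrow> bool" where
  "hermitian_ae u \<longleftrightarrow> (AE x in lborel. u (- x) = cnj (u x))"

text \<open>Infimum of a real-valued function given with values in \<open>\<complex>\<close>. It is applied only to Fourier
  transforms of Hermitian \<open>L\<^sub>1\<close>-functions, which are real (\<open>fourier_real\<close>) and bounded
  (\<open>norm_fourier_le\<close>).\<close>

definition inf_re :: "('a \<Rightarrow> complex) \<Rightarrow> real" where
  "inf_re f = (INF x. Re (f x))"

lemma norm_fourier_le: "norm (fourier u x) \<le> (LINT \<xi>|lborel. norm (u \<xi>))"
proof -
  have "norm (u \<xi> * exp (- (\<i> * complex_of_real (x \<bullet> \<xi>)))) = norm (u \<xi>)" for \<xi>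
    by (simp add: norm_mult norm_exp_eq_Re)
  then show ?thesis
    unfolding fourier_def
    using integral_norm_bound[of lborel "\<lambda>\<xi>. u \<xi> * exp (- (\<i> * complex_of_real (x \<bullet> \<xi>)))"]
    by simp
qed

lemma fourier_real:
  fixes u :: "real ^ 'd \<Rightarrow> complex"
  assumes "integrable lborel u" "hermitian_ae u"
  shows "fourier u x \<in> \<real>"
proof -
  let ?g = "\<lambda>\<xi>. u \<xi> * exp (- (\<i> * complex_of_real (x \<bullet> \<xi>)))"
  have uminus: "distr lborel borel uminus = (lborel :: (real ^ 'd) measure)"
    using lborel_affine[of "-1" "0 :: real ^ 'd"] by (simp add: density_1)
  have [measurable]: "u \<in> borel_measurable borel"
    using borel_measurable_integrable[OF assms(1)] by simp
  have [measurable]: "(\<lambda>\<xi>. exp (- (\<i> * complex_of_real (x \<bullet> \<xi>)))) \<in> borel_measurable borel"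
    by (intro borel_measurable_continuous_onI continuous_intros)
  have [measurable]: "cnj \<in> borel_measurable borel"
    by (intro borel_measurable_continuous_onI continuous_intros)
  have "fourier u x = (LINT \<xi>|distr lborel borel uminus. ?g \<xi>)"
    by (simp add: fourier_def uminus)
  also have "\<dots> = (LINT \<xi>|lborel. ?g (- \<xi>))"
    by (rule integral_distr) measurable
  also have "\<dots> = (LINT \<xi>|lborel. cnj (?g \<xi>))"
  proof (rule integral_cong_AE)
    show "AE \<xi> in lborel. ?g (- \<xi>) = cnj (?g \<xi>)"
      using assms(2) unfolding hermitian_ae_def by eventually_elim (simp add: exp_cnj)
  qed measurable
  also have "\<dots> = cnj (fourier u x)"
    unfolding fourier_def by (rule Bochner_Integration.integral_cnj)
  finally show ?thesis by (simp add: Reals_cnj_iff)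
qed


section \<open>Operators in \<open>L\<^sub>2\<close> and their eigenvalues\<close>

text \<open>An element of \<open>L\<^sub>2(\<real>\<^sup>d)\<close> is represented by Borel measurable square-integrable functions,
  with equality understood almost everywhere. An operator in \<open>L\<^sub>2\<close> is given by its action on
  representatives.\<close>

definition L2 :: "('a::euclidean_space \<Rightarrow> complex) set" where
  "L2 = {u. u \<in> borel_measurable lborel \<and> integrable lborel (\<lambda>x. (cmod (u x))\<^sup>2)}"

definition conv_mult_op ::
    "(real ^ 'd \<Rightarrow> complex) \<Rightarrow> (real ^ 'd \<Rightarrow> complex) \<Rightarrow> (real ^ 'd \<Rightarrow> complex) \<Rightarrow> real ^ 'd \<Rightarrow> complex"
  where
  "conv_mult_op a V u x = (LINT y|lborel. a (x - y) * u y) + V x * u x"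

definition eigenspace ::
    "(('a::euclidean_space \<Rightarrow> complex) \<Rightarrow> 'a \<Rightarrow> complex) \<Rightarrow> complex \<Rightarrow> ('a \<Rightarrow> complex) set" where
  "eigenspace T z = {u \<in> L2. AE x in lborel. T u x = z * u x}"

text \<open>Linear independence of the \<open>L\<^sub>2\<close>-classes of \<open>u 0, \<dots>, u (k - 1)\<close>.\<close>

definition ae_independent :: "nat \<Rightarrow> (nat \<Rightarrow> 'a::euclidean_space \<Rightarrow> complex) \<Rightarrow> bool" where
  "ae_independent k u \<longleftrightarrow>
     (\<forall>c. (AE x in lborel. (\<Sum>j<k. c j * u j x) = 0) \<longrightarrow> (\<forall>j<k. c j = 0))"

text \<open>The dimension, in \<open>L\<^sub>2\<close>, of the eigenspace (possibly infinite); it is positive iff \<open>z\<close> is an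
  eigenvalue.\<close>

definition eig_mult ::
    "(('a::euclidean_space \<Rightarrow> complex) \<Rightarrow> 'a \<Rightarrow> complex) \<Rightarrow> complex \<Rightarrow> enat" where
  "eig_mult T z =
     (SUP k \<in> {k. \<exists>u. (\<forall>j<k. u j \<in> eigenspace T z) \<and> ae_independent k u}. enat k)"

text \<open>The number of eigenvalues in a set \<open>I\<close> of reals, counted with multiplicity: the possibly
  infinite sum of the multiplicities over \<open>I\<close>.\<close>

definition eig_count ::
    "(('a::euclidean_space \<Rightarrow> complex) \<Rightarrow> 'a \<Rightarrow> complex) \<Rightarrow> real set \<Rightarrow> enat" where
  "eig_count T I =
     (SUP F \<in> {F. finite F \<and> F \<subseteq> I}. \<Sum>t\<in>F. eig_mult T (complex_of_real t))"


section \<open>The quadratic form and the flatness modulus of the potential\<close>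

text \<open>\<open>\<complex>\<^bsup>M(N)\<^esup>\<close>: families indexed by the multi-indices with \<open>|n| \<le> N\<close>, extended by zero.\<close>

definition coeff_space :: "nat \<Rightarrow> (('d::finite \<Rightarrow> nat) \<Rightarrow> complex) set" where
  "coeff_space N = {\<zeta>. \<forall>n. n \<notin> mi_upto N \<longrightarrow> \<zeta> n = 0}"

text \<open>The sum is real if \<open>a\<close> is Hermitian and of class \<open>C\<^bsup>2N\<^esup>\<close> near the origin.\<close>

definition form_a ::
    "(real ^ 'd::finite \<Rightarrow> complex) \<Rightarrow> nat \<Rightarrow> (('d \<Rightarrow> nat) \<Rightarrow> complex) \<Rightarrow> complex" where
  "form_a a N \<zeta> =
     (\<Sum>n\<in>mi_upto N. \<Sum>m\<in>mi_upto N.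
        (-1) ^ mi_abs n * mi_deriv (n + m) a 0 * \<zeta> m * cnj (\<zeta> n))"

definition h_V :: "(real ^ 'd::finite \<Rightarrow> complex) \<Rightarrow> real ^ 'd \<Rightarrow> nat \<Rightarrow> real \<Rightarrow> real" where
  "h_V V x0 N \<delta> =
     Max ((\<lambda>n. cmod (LINT x:cube 1 0|lborel.
                 (V (x0 + \<delta> *\<^sub>R x) - V x0) * complex_of_real (mi_power x n))) ` mi_upto (2 * N))"

end

theory Submission
  imports
    Defs
    "HOL-Library.Diagonal_Subsequence"
    "HOL-Complex_Analysis.Great_Picard"
    "HOL-Probability.Characteristic_Functions"
begin

text \<open>
  Write \<open>A\<close> for convolution with \<open>a\<close> and \<open>\<mu>\<close> for the minimum of \<open>V\<close>. If \<open>\<mu> < 0\<close>, put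
  \<open>w = sqrt (1 + V / \<bar>\<mu>\<bar>)\<close>. Then \<open>A + V - \<mu> = w (A - \<mu>) w + K\<close>, where the first summand is
  nonnegative, because \<open>\<mu>\<close> is a lower bound of \<open>A\<close>, and \<open>K\<close> is compact, because \<open>1 - w\<close> tends
  to zero at infinity (if \<open>\<mu> \<ge> 0\<close>, take \<open>K = 0\<close>). Hence every subspace of dimension \<open>k\<close> on which
  the form of \<open>A + V - \<mu>\<close> is negative yields \<open>k\<close> orthonormal eigenvectors with negative
  eigenvalues, found by successive minimization.

  Such a subspace is spanned by polynomials on the cube of side \<open>\<delta>\<close> around \<open>x\<^sub>0\<close>: orthogonality
  makes all terms of the Taylor expansion of \<open>a(x - y)\<close> vanish except those that produce the form
  \<open>form_a\<close> and terms of higher order in \<open>\<delta>\<close>, while the flatness of \<open>V\<close> at \<open>x\<^sub>0\<close> makes the contribution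
  of \<open>V - \<mu>\<close> negligible.
\<close>

section \<open>Hermitian forms and eigenvectors below the essential spectrum\<close>

text \<open>Neither \<open>A\<close> nor multiplication by \<open>V\<close> is compact; compact is
  only \<open>A\<close> composed with multiplication by a function vanishing at infinity. The choice
  of \<open>w\<close> isolates such products: it is made so that
  \<open>V - \<mu> = \<bar>\<mu>\<bar> w^2\<close>, which leaves \<open>K = A - w A w\<close>. The
  hypothesis \<open>V_min \<le> a_min\<close> is what bounds \<open>A\<close> below by
  \<open>\<mu>\<close>. That bound is derived without Plancherel's theorem, from the fact that a
  function with nonnegative Fourier transform is nonnegative at the origin. No spectral theorem
  enters either: the form is coercive modulo \<open>K\<close> below zero, so infima of the Rayleigh
  quotient there are attained.

  The trial functions are polynomials cut off sharply to the cube because flatness controls only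
  moments of \<open>V - \<mu>\<close> over cubes, not its size. A product of two polynomials of
  degree at most \<open>N\<close> meets precisely the moments of order at most \<open>2 N\<close>.

  The left end of the interval is obtained afterwards, by evaluating the form at each unit
  eigenvector.\<close>

text \<open>Operators on \<open>L\<^sub>2\<close> act on representatives, so the inner product is only positive
  semidefinite and operators are linear only modulo null vectors.\<close>

locale hermitian_form = vector_space scale
  for scale :: "complex \<Rightarrow> 'a::ab_group_add \<Rightarrow> 'a" (infixr \<open>\<odot>\<close> 75) +
  fixes H :: "'a set" and ip :: "'a \<Rightarrow> 'a \<Rightarrow> complex"
  assumes H: "subspace H"
    and ip_add: "\<And>u v w. u \<in> H \<Longrightarrow> v \<in> H \<Longrightarrow> w \<in> H \<Longrightarrow> ip (u + v) w = ip u w + ip v w"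
    and ip_scale: "\<And>c u w. u \<in> H \<Longrightarrow> w \<in> H \<Longrightarrow> ip (c \<odot> u) w = c * ip u w"
    and ip_sym: "\<And>u v. u \<in> H \<Longrightarrow> v \<in> H \<Longrightarrow> ip v u = cnj (ip u v)"
begin

lemma add_H [intro, simp]: "u \<in> H \<Longrightarrow> v \<in> H \<Longrightarrow> u + v \<in> H"
  using H by (rule subspace_add)

lemma scale_H [intro, simp]: "u \<in> H \<Longrightarrow> c \<odot> u \<in> H"
  using H by (rule subspace_scale)

lemma diff_H [intro, simp]: "u \<in> H \<Longrightarrow> v \<in> H \<Longrightarrow> u - v \<in> H"
  using H by (rule subspace_diff)

lemma zero_H [intro, simp]: "0 \<in> H"
  using H by (rule subspace_0)

lemma sum_H [intro]: "(\<And>i. i \<in> I \<Longrightarrow> f i \<in> H) \<Longrightarrow> sum f I \<in> H"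
  using H by (rule subspace_sum)

lemma ip_zero_left [simp]: "w \<in> H \<Longrightarrow> ip 0 w = 0"
  using ip_scale[of 0 w 0] by simp

lemma ip_zero_right [simp]: "w \<in> H \<Longrightarrow> ip w 0 = 0"
  using ip_sym[of 0 w] by simp

lemma ip_diff: "u \<in> H \<Longrightarrow> v \<in> H \<Longrightarrow> w \<in> H \<Longrightarrow> ip (u - v) w = ip u w - ip v w"
  using ip_add[of "u - v" v w] by simp

lemma ip_add_right: "u \<in> H \<Longrightarrow> v \<in> H \<Longrightarrow> w \<in> H \<Longrightarrow> ip w (u + v) = ip w u + ip w v"
  by (simp add: ip_sym[of _ w] ip_add)

lemma ip_diff_right: "u \<in> H \<Longrightarrow> v \<in> H \<Longrightarrow> w \<in> H \<Longrightarrow> ip w (u - v) = ip w u - ip w v"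
  by (simp add: ip_sym[of _ w] ip_diff)

lemma ip_scale_right: "u \<in> H \<Longrightarrow> w \<in> H \<Longrightarrow> ip w (c \<odot> u) = cnj c * ip w u"
  by (simp add: ip_sym[of _ w] ip_scale)

lemma ip_sum: "(\<And>i. i \<in> I \<Longrightarrow> f i \<in> H) \<Longrightarrow> w \<in> H \<Longrightarrow> ip (sum f I) w = (\<Sum>i\<in>I. ip (f i) w)"
  by (induction I rule: infinite_finite_induct) (auto simp: ip_add sum_H)

lemma ip_sum_right: "(\<And>i. i \<in> I \<Longrightarrow> f i \<in> H) \<Longrightarrow> w \<in> H \<Longrightarrow> ip w (sum f I) = (\<Sum>i\<in>I. ip w (f i))"
  by (induction I rule: infinite_finite_induct) (auto simp: ip_add_right sum_H)

lemma Im_ip_self [simp]: "u \<in> H \<Longrightarrow> Im (ip u u) = 0"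
  using ip_sym[of u u] by (metis complex_cnj_cancel_iff Im_complex_of_real Reals_cnj_iff of_real_Re)

lemma ip_self: "u \<in> H \<Longrightarrow> ip u u = of_real (Re (ip u u))"
  by (simp add: complex_eq_iff)

text \<open>The source of the Cauchy-Schwarz inequality. The parameter \<open>s\<close> stays free
  because, for a semidefinite form, the right choice depends on whether \<open>ip v v\<close>
  vanishes.\<close>

lemma ip_self_diff_scale:
  assumes "u \<in> H" "v \<in> H"
  shows "Re (ip (u - s \<odot> v) (u - s \<odot> v))
    = Re (ip u u) - 2 * Re (s * cnj (ip u v)) + (cmod s)\<^sup>2 * Re (ip v v)"
  using assms ip_sym[of u v]
  by (simp add: ip_diff ip_diff_right ip_scale ip_scale_right complex_norm_square[symmetric]
      cmod_power2) (simp add: algebra_simps power2_eq_square)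

end

text \<open>Carrier and form are parameters because three different forms are treated: the inner
  product of \<open>L2\<close>, the form of a shifted operator on an orthogonal complement, and the
  negative of \<open>form_a\<close> on the given subspace.\<close>

locale semi_inner = hermitian_form +
  assumes ip_nonneg: "\<And>u. u \<in> H \<Longrightarrow> 0 \<le> Re (ip u u)"
begin

definition nrm :: "'a \<Rightarrow> real" where "nrm u = sqrt (Re (ip u u))"

lemma nrm_nonneg: "u \<in> H \<Longrightarrow> 0 \<le> nrm u"
  by (simp add: nrm_def ip_nonneg)

lemma nrm_square: "u \<in> H \<Longrightarrow> (nrm u)\<^sup>2 = Re (ip u u)"
  by (simp add: nrm_def ip_nonneg)

lemma Cauchy_Schwarz_form:
  assumes u: "u \<in> H" and v: "v \<in> H"
  shows "(cmod (ip u v))\<^sup>2 \<le> Re (ip u u) * Re (ip v v)"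
proof -
  define c where "c = ip u v"
  have ineq: "0 \<le> Re (ip u u) - 2 * Re (s * cnj c) + (cmod s)\<^sup>2 * Re (ip v v)" for s
    using ip_nonneg[of "u - s \<odot> v"] ip_self_diff_scale[OF u v, of s] u v unfolding c_def by simp
  show ?thesis
  proof (cases "Re (ip v v) = 0")
    case True
    have "cmod c = 0"
    proof (rule ccontr)
      assume "cmod c \<noteq> 0"
      then have "c \<noteq> 0" by simp
      \<comment> \<open>For a null vector \<open>v\<close> the expression in \<open>s\<close> is
        affine; this \<open>t\<close> makes its value at \<open>of_real t * c\<close> equal to
        -1.\<close>
      define t where "t = (Re (ip u u) + 1) / (2 * (cmod c)\<^sup>2)"
      have "Re (of_real t * c * cnj c) = t * (cmod c)\<^sup>2"
        unfolding cmod_power2 by (simp add: algebra_simps power2_eq_square)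
      then have "0 \<le> Re (ip u u) - 2 * (t * (cmod c)\<^sup>2)"
        using ineq[of "of_real t * c"] True by simp
      also have "2 * (t * (cmod c)\<^sup>2) = Re (ip u u) + 1"
        using \<open>c \<noteq> 0\<close> by (simp add: t_def)
      finally show False by simp
    qed
    then show ?thesis using True by (simp add: c_def)
  next
    case False
    define b where "b = Re (ip v v)"
    have b: "b > 0" using False ip_nonneg[OF v] unfolding b_def by linarith
    \<comment> \<open>The choice \<open>s = c / b\<close> minimizes the quadratic
      expression.\<close>
    have e: "Re (c / of_real b * cnj c) = (cmod c)\<^sup>2 / b"
      unfolding cmod_power2 using b by (simp add: power2_eq_square add_divide_distrib)
    have "0 \<le> Re (ip u u) - 2 * ((cmod c)\<^sup>2 / b) + (cmod (c / of_real b))\<^sup>2 * b"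
      using ineq[of "c / of_real b"] unfolding e b_def[symmetric] .
    also have "(cmod (c / of_real b))\<^sup>2 * b = (cmod c)\<^sup>2 / b"
      using b by (simp add: norm_divide power2_eq_square)
    finally have "(cmod c)\<^sup>2 / b \<le> Re (ip u u)" by simp
    then have "(cmod c)\<^sup>2 \<le> Re (ip u u) * b"
      using b by (simp add: field_simps)
    then show ?thesis by (simp add: c_def b_def)
  qed
qed

lemma Cauchy_Schwarz:
  assumes "u \<in> H" "v \<in> H"
  shows "cmod (ip u v) \<le> nrm u * nrm v"
proof (rule power2_le_imp_le)
  show "(cmod (ip u v))\<^sup>2 \<le> (nrm u * nrm v)\<^sup>2"
    using Cauchy_Schwarz_form[OF assms] assms by (simp add: power_mult_distrib nrm_square)
qed (use assms in \<open>simp add: nrm_nonneg\<close>)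

lemma nrm_scale: "u \<in> H \<Longrightarrow> nrm (c \<odot> u) = cmod c * nrm u"
proof -
  assume u: "u \<in> H"
  have "ip (c \<odot> u) (c \<odot> u) = of_real ((cmod c)\<^sup>2) * ip u u"
    unfolding complex_norm_square using u by (simp add: ip_scale ip_scale_right)
  then show ?thesis by (simp add: nrm_def real_sqrt_mult)
qed

lemma nrm_add: 
  assumes "u \<in> H" "v \<in> H"
  shows "nrm (u + v) \<le> nrm u + nrm v"
proof (rule power2_le_imp_le)
  have "Re (ip u v) \<le> nrm u * nrm v"
    using Cauchy_Schwarz[OF assms] complex_Re_le_cmod order_trans by blast
  moreover have "(nrm (u + v))\<^sup>2 = (nrm u)\<^sup>2 + 2 * Re (ip u v) + (nrm v)\<^sup>2"
    using assms ip_sym[of u v] by (simp add: nrm_square ip_add ip_add_right)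
  ultimately show "(nrm (u + v))\<^sup>2 \<le> (nrm u + nrm v)\<^sup>2"
    by (simp add: power2_sum)
qed (use assms in \<open>simp add: nrm_nonneg\<close>)

lemma nrm_minus_commute: "u \<in> H \<Longrightarrow> v \<in> H \<Longrightarrow> nrm (u - v) = nrm (v - u)"
  by (simp add: nrm_def ip_diff ip_diff_right)

lemma nrm_diff:
  assumes "u \<in> H" "v \<in> H"
  shows "nrm (u - v) \<le> nrm u + nrm v"
proof -
  have "u - v = u + (-1) \<odot> v" by simp
  then show ?thesis
    using nrm_add[of u "(-1) \<odot> v"] nrm_scale[of v "-1"] scale_H[of v "-1"] assms
    by (simp del: scale_H)
qed

lemma nrm_triangle:
  assumes "u \<in> H" "v \<in> H" "w \<in> H"
  shows "nrm (u - w) \<le> nrm (u - v) + nrm (v - w)"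
  using nrm_add[of "u - v" "v - w"] assms by simp

lemma nrm_diff_ge:
  assumes "u \<in> H" "v \<in> H"
  shows "\<bar>nrm u - nrm v\<bar> \<le> nrm (u - v)"
  using nrm_add[of "u - v" v] nrm_add[of "v - u" u] nrm_minus_commute[of u v] assms by simp

text \<open>By Cauchy-Schwarz null vectors are orthogonal to everything. This is what makes
  representatives that agree almost everywhere interchangeable.\<close>

lemma nrm_zero_ip:
  assumes "u \<in> H" "v \<in> H" "w \<in> H" "nrm (u - v) = 0"
  shows "ip u w = ip v w"
  using Cauchy_Schwarz[of "u - v" w] assms by (simp add: ip_diff)

lemma ip_eq_nrm_zero:
  assumes "u \<in> H" "v \<in> H" "\<And>w. w \<in> H \<Longrightarrow> ip u w = ip v w"
  shows "nrm (u - v) = 0"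
  using assms by (simp add: nrm_def ip_diff)

text \<open>Testing against all \<open>w\<close> expresses linearity up to null vectors. Exact
  linearity fails for convolution on representatives, at points where an integral diverges.\<close>

definition bounded_op :: "('a \<Rightarrow> 'a) \<Rightarrow> bool" where
  "bounded_op B \<longleftrightarrow> (\<forall>u\<in>H. B u \<in> H)
    \<and> (\<forall>u\<in>H. \<forall>v\<in>H. \<forall>w\<in>H. ip (B (u + v)) w = ip (B u) w + ip (B v) w)
    \<and> (\<forall>c. \<forall>u\<in>H. \<forall>w\<in>H. ip (B (c \<odot> u)) w = c * ip (B u) w)
    \<and> (\<exists>C. \<forall>u\<in>H. nrm (B u) \<le> C * nrm u)"

lemma bounded_opD:
  assumes "bounded_op B"
  shows "u \<in> H \<Longrightarrow> B u \<in> H"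
    and "u \<in> H \<Longrightarrow> v \<in> H \<Longrightarrow> w \<in> H \<Longrightarrow> ip (B (u + v)) w = ip (B u) w + ip (B v) w"
    and "u \<in> H \<Longrightarrow> w \<in> H \<Longrightarrow> ip (B (c \<odot> u)) w = c * ip (B u) w"
  using assms by (auto simp: bounded_op_def)

lemma bounded_op_bound:
  assumes "bounded_op B"
  obtains C where "C > 0" "\<And>u. u \<in> H \<Longrightarrow> nrm (B u) \<le> C * nrm u"
proof -
  obtain C where C: "\<forall>u\<in>H. nrm (B u) \<le> C * nrm u"
    using assms by (auto simp: bounded_op_def)
  have "nrm (B u) \<le> max C 1 * nrm u" if "u \<in> H" for u
    using C that mult_right_mono[OF max.cobounded1[of C 1] nrm_nonneg[OF that]] by force
  then show thesis using that[of "max C 1"] by auto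
qed

lemma bounded_op_diff:
  assumes "bounded_op B" "u \<in> H" "v \<in> H"
  shows "nrm (B (u - v) - (B u - B v)) = 0"
proof (rule ip_eq_nrm_zero)
  fix w assume w: "w \<in> H"
  show "ip (B (u - v)) w = ip (B u - B v) w"
    using bounded_opD(2)[OF assms(1), of "u - v" v w] assms w
    by (simp add: ip_diff bounded_opD)
qed (use assms in \<open>auto simp: bounded_opD\<close>)

lemma nrm_bounded_op_diff:
  assumes "bounded_op B" "u \<in> H" "v \<in> H"
  shows "nrm (B u - B v) = nrm (B (u - v))"
  using nrm_diff_ge[of "B (u - v)" "B u - B v"] bounded_op_diff[OF assms] assms
  by (simp add: bounded_opD)

text \<open>Fewer than \<open>card B\<close> vectors cannot span \<open>B\<close>, so some vector of
  \<open>B\<close> has a nonzero residual, and strict positivity allows it to be normalized.\<close>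

lemma Gram_Schmidt_exists:
  assumes pos: "\<And>v. v \<in> H \<Longrightarrow> v \<noteq> 0 \<Longrightarrow> 0 < Re (ip v v)"
    and B: "finite B" "independent B" "B \<subseteq> H" and "k \<le> card B"
  shows "\<exists>f. (\<forall>i<k. f i \<in> H) \<and> (\<forall>i<k. \<forall>j<k. ip (f i) (f j) = (if i = j then 1 else 0))"
  using \<open>k \<le> card B\<close>
proof (induction k)
  case (Suc k)
  then obtain f where fH: "\<And>i. i < k \<Longrightarrow> f i \<in> H"
    and f: "\<And>i j. i < k \<Longrightarrow> j < k \<Longrightarrow> ip (f i) (f j) = (if i = j then 1 else 0)" by auto
  have "\<not> B \<subseteq> span (f ` {..<k})"
  proof
    assume "B \<subseteq> span (f ` {..<k})"
    then have "card B \<le> card (f ` {..<k})"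
      using independent_span_bound[of "f ` {..<k}" B] B by auto
    then show False using card_image_le[of "{..<k}" f] Suc.prems by simp
  qed
  then obtain v where v: "v \<in> B" "v \<notin> span (f ` {..<k})" by auto
  define p where "p = (\<Sum>i<k. ip v (f i) \<odot> f i)"
  have vH: "v \<in> H" using v B by auto
  have pH: "p \<in> H" unfolding p_def by (intro sum_H scale_H fH) simp
  have "p \<in> span (f ` {..<k})"
    unfolding p_def by (intro span_sum span_scale span_base) auto
  then have ne: "v - p \<noteq> 0" using v by auto
  define q where "q = v - p"
  have qH: "q \<in> H" using vH pH by (simp add: q_def)
  have orth: "ip q (f j) = 0" if "j < k" for j
  proof -
    have "ip p (f j) = (\<Sum>i<k. ip (ip v (f i) \<odot> f i) (f j))"
      unfolding p_def by (rule ip_sum) (auto simp: fH that)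
    also have "\<dots> = (\<Sum>i<k. if i = j then ip v (f j) else 0)"
      by (intro sum.cong) (auto simp: ip_scale fH f that)
    finally show ?thesis using that vH pH fH[OF that] by (simp add: q_def ip_diff)
  qed
  define s where "s = Re (ip q q)"
  have s: "s > 0" using pos[OF qH] ne by (simp add: s_def q_def)
  define g where "g = of_real (1 / sqrt s) \<odot> q"
  have gH: "g \<in> H" using qH by (simp add: g_def)
  have "ip q q = of_real s" using ip_self[OF qH] by (simp add: s_def)
  then have "ip g g = of_real (1 / sqrt s * (1 / sqrt s) * s)"
    using qH s by (simp add: g_def ip_scale ip_scale_right flip: of_real_mult)
  also have "\<dots> = 1" using s by simp
  finally have gg: "ip g g = 1" .
  have gf: "ip g (f j) = 0" if "j < k" for j
    using orth[OF that] qH fH[OF that] by (simp add: g_def ip_scale)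
  have fg: "ip (f j) g = 0" if "j < k" for j
    using gf[OF that] ip_sym[of g "f j"] gH fH[OF that] by simp
  show ?case
    by (rule exI[of _ "f(k := g)"]) (auto simp: less_Suc_eq fH gH f gg gf fg)
qed simp

text \<open>Image subsequences are required to be Cauchy instead of convergent, so that the notion
  does not presuppose completeness.\<close>

definition compact_op :: "('a \<Rightarrow> 'a) \<Rightarrow> bool" where
  "compact_op K \<longleftrightarrow> (\<forall>z C. (\<forall>n::nat. z n \<in> H \<and> nrm (z n) \<le> C) \<longrightarrow>
     (\<exists>s::nat \<Rightarrow> nat. strict_mono s \<and> (\<forall>\<epsilon>>0. \<exists>n0. \<forall>m\<ge>n0. \<forall>n\<ge>n0. nrm (K (z (s m)) - K (z (s n))) \<le> \<epsilon>)))"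

text \<open>Diagonal argument: refining successively with tolerance \<open>1 / (j + 1)\<close> and
  passing to the diagonal gives a Cauchy sequence of images. It remains to work with one fixed
  \<open>\<epsilon>\<close>, where operators may be replaced by approximations.\<close>

lemma compact_opI:
  assumes "\<And>z C \<epsilon>. (\<And>n::nat. z n \<in> H) \<Longrightarrow> (\<And>n. nrm (z n) \<le> C) \<Longrightarrow> \<epsilon> > 0 \<Longrightarrow>
    \<exists>s::nat \<Rightarrow> nat. strict_mono s \<and> (\<forall>m n. nrm (K (z (s m)) - K (z (s n))) \<le> \<epsilon>)"
  shows "compact_op K"
  unfolding compact_op_def
proof (intro allI impI)
  fix z :: "nat \<Rightarrow> 'a" and C
  assume z: "\<forall>n. z n \<in> H \<and> nrm (z n) \<le> C"
  define P where "P = (\<lambda>(j::nat) (s::nat \<Rightarrow> nat).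
    \<forall>m n. nrm (K (z (s m)) - K (z (s n))) \<le> 1 / real (Suc j))"
  interpret subseqs P
  proof
    fix j and s :: "nat \<Rightarrow> nat"
    have "\<exists>r::nat \<Rightarrow> nat. strict_mono r \<and> (\<forall>m n. nrm (K ((z \<circ> s) (r m)) - K ((z \<circ> s) (r n))) \<le> 1 / real (Suc j))"
      by (rule assms[where C = C and z = "z \<circ> s"]) (use z in auto)
    then show "\<exists>r'. strict_mono r' \<and> P j (s \<circ> r')" by (auto simp: P_def)
  qed
  have diag: "P j (diagseq \<circ> (+) (Suc j))" for j
    by (rule diagseq_holds) (simp add: P_def)
  show "\<exists>s::nat \<Rightarrow> nat. strict_mono s \<and> (\<forall>\<epsilon>>0. \<exists>n0. \<forall>m\<ge>n0. \<forall>n\<ge>n0. nrm (K (z (s m)) - K (z (s n))) \<le> \<epsilon>)"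
  proof (intro exI[of _ diagseq] conjI subseq_diagseq allI impI)
    fix \<epsilon> :: real assume "\<epsilon> > 0"
    then obtain j where j: "1 / real (Suc j) < \<epsilon>" by (rule nat_approx_posE)
    have "nrm (K (z (diagseq m)) - K (z (diagseq n))) \<le> \<epsilon>" if "m \<ge> Suc j" "n \<ge> Suc j" for m n
    proof -
      have "nrm (K (z (diagseq (Suc j + (m - Suc j)))) - K (z (diagseq (Suc j + (n - Suc j)))))
          \<le> 1 / real (Suc j)"
        using diag[of j] unfolding P_def o_def by blast
      then show ?thesis using that j by simp
    qed
    then show "\<exists>n0. \<forall>m\<ge>n0. \<forall>n\<ge>n0. nrm (K (z (diagseq m)) - K (z (diagseq n))) \<le> \<epsilon>" by blast
  qed
qed

text \<open>\<open>GA = (AG)\<^sup>*\<close> is compact together with \<open>AG\<close> because \<open>\<parallel>GAz\<parallel>\<^sup>2 = (AGGAz, z)\<close>.\<close>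

lemma compact_op_commutator_perturbation:
  assumes A: "bounded_op A" "\<And>u v. u \<in> H \<Longrightarrow> v \<in> H \<Longrightarrow> ip (A u) v = ip u (A v)"
    and G: "bounded_op G" "\<And>u v. u \<in> H \<Longrightarrow> v \<in> H \<Longrightarrow> ip (G u) v = ip u (G v)"
    and AG: "compact_op (\<lambda>u. A (G u))"
  shows "compact_op (\<lambda>u. G (A u) + A (G u) - G (A (G u)))"
  unfolding compact_op_def
proof (intro allI impI)
  fix z :: "nat \<Rightarrow> 'a" and C
  assume "\<forall>n. z n \<in> H \<and> nrm (z n) \<le> C"
  then have z: "z n \<in> H" and zC: "nrm (z n) \<le> C" for n by auto
  obtain CA where CA: "CA > 0" "\<And>u. u \<in> H \<Longrightarrow> nrm (A u) \<le> CA * nrm u"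
    using bounded_op_bound[OF A(1)] by blast
  obtain CG where CG: "CG > 0" "\<And>u. u \<in> H \<Longrightarrow> nrm (G u) \<le> CG * nrm u"
    using bounded_op_bound[OF G(1)] by blast
  have [simp]: "u \<in> H \<Longrightarrow> A u \<in> H" "u \<in> H \<Longrightarrow> G u \<in> H" for u
    using A G by (auto simp: bounded_opD)
  have C: "C \<ge> 0" using zC[of 0] nrm_nonneg[OF z[of 0]] by linarith
  have GAC: "nrm (G (A u)) \<le> CG * (CA * nrm u)" if "u \<in> H" for u
    by (rule order.trans[OF CG(2)[of "A u"] mult_left_mono[OF CA(2)[OF that]]])
      (use CG(1) that in simp_all)
  have GAzC: "nrm (G (A (z n))) \<le> CG * (CA * C)" for n
    by (rule order.trans[OF GAC[OF z]]) (use zC CA(1) CG(1) in simp)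
  have "\<exists>s::nat \<Rightarrow> nat. strict_mono s \<and> (\<forall>\<epsilon>>0. \<exists>n0. \<forall>m\<ge>n0. \<forall>n\<ge>n0.
      nrm (A (G (z (s m))) - A (G (z (s n)))) \<le> \<epsilon>)"
    by (rule AG[unfolded compact_op_def, rule_format, where C = C]) (use z zC in auto)
  then obtain s1 :: "nat \<Rightarrow> nat" where s1: "strict_mono s1"
    and K1: "\<forall>\<epsilon>>0. \<exists>n0. \<forall>m\<ge>n0. \<forall>n\<ge>n0. nrm (A (G (z (s1 m))) - A (G (z (s1 n)))) \<le> \<epsilon>"
    by (elim exE conjE)
  \<comment> \<open>Second extraction, along \<open>s1\<close>: compactness of \<open>A G\<close> on
    the bounded sequence \<open>G A z\<close> controls \<open>A G G A z\<close>, the operator that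
    occurs in the identity for \<open>G A\<close>.\<close>
  have "\<exists>s::nat \<Rightarrow> nat. strict_mono s \<and> (\<forall>\<epsilon>>0. \<exists>n0. \<forall>m\<ge>n0. \<forall>n\<ge>n0.
      nrm (A (G (G (A (z (s1 (s m)))))) - A (G (G (A (z (s1 (s n))))))) \<le> \<epsilon>)"
    by (rule AG[unfolded compact_op_def, rule_format, where C = "CG * (CA * C)" and z = "\<lambda>n. G (A (z (s1 n)))"])
      (use z GAzC in auto)
  then obtain s2 :: "nat \<Rightarrow> nat" where s2: "strict_mono s2"
    and K2: "\<forall>\<epsilon>>0. \<exists>n0. \<forall>m\<ge>n0. \<forall>n\<ge>n0.
      nrm (A (G (G (A (z (s1 (s2 m)))))) - A (G (G (A (z (s1 (s2 n))))))) \<le> \<epsilon>"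
    by (elim exE conjE)
  define s where "s = s1 \<circ> s2"
  have s: "strict_mono s" using s1 s2 by (simp add: s_def strict_mono_o)
  \<comment> \<open>Both operators are linear only modulo null vectors, so the difference is moved
    inside one operator at a time.\<close>
  have GAeq: "nrm (G (A u) - G (A v)) = nrm (G (A (u - v)))" if uv: "u \<in> H" "v \<in> H" for u v
  proof -
    have "nrm (G (A (u - v)) - G (A u - A v)) = nrm (G (A (u - v) - (A u - A v)))"
      using uv by (simp add: nrm_bounded_op_diff[OF G(1)])
    also have "\<dots> = 0"
      using CG(2)[of "A (u - v) - (A u - A v)"] bounded_op_diff[OF A(1) uv] uv nrm_nonneg
      by (simp add: dual_order.antisym)
    finally have "nrm (G (A (u - v))) = nrm (G (A u - A v))"
      using nrm_diff_ge[of "G (A (u - v))" "G (A u - A v)"] uv by simp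
    then show ?thesis using uv by (simp add: nrm_bounded_op_diff[OF G(1)])
  qed
  have GA2: "(nrm (G (A (u - v))))\<^sup>2 \<le> nrm (A (G (G (A u))) - A (G (G (A v)))) * nrm (u - v)"
    if uv: "u \<in> H" "v \<in> H" for u v
  proof -
    define d where "d = u - v"
    have d: "d \<in> H" using uv by (simp add: d_def)
    have "ip (G (A d)) (G (A d)) = ip (A (G (G (A d)))) d"
      using d by (simp add: A(2) G(2))
    also have "\<dots> = ip (A (G (G (A u))) - A (G (G (A v)))) d"
    proof -
      have "ip (A (G (G (A d)))) w = ip (A (G (G (A u)))) w - ip (A (G (G (A v)))) w" if w: "w \<in> H" for w
      proof -
        have "ip (A (G (G (A x)))) w = ip x (A (G (G (A w))))" if "x \<in> H" for x
          using that w by (simp add: A(2) G(2))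
        then show ?thesis using uv w by (simp add: d_def ip_diff)
      qed
      then show ?thesis using d uv by (simp add: ip_diff)
    qed
    also have "cmod \<dots> \<le> nrm (A (G (G (A u))) - A (G (G (A v)))) * nrm d"
      using uv d by (intro Cauchy_Schwarz) auto
    finally show ?thesis
      using d complex_Re_le_cmod[of "ip (G (A d)) (G (A d))"]
      by (simp add: nrm_square d_def[symmetric])
  qed
  let ?K = "\<lambda>u. G (A u) + A (G u) - G (A (G u))"
  have K: "nrm (?K u - ?K v) \<le> nrm (G (A (u - v))) + (1 + CG) * nrm (A (G u) - A (G v))"
    if uv: "u \<in> H" "v \<in> H" for u v
  proof -
    have "?K u - ?K v = (G (A u) - G (A v)) + (A (G u) - A (G v)) - (G (A (G u)) - G (A (G v)))"
      by simp
    also have "nrm \<dots> \<le> nrm (G (A u) - G (A v)) + nrm (A (G u) - A (G v))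
        + nrm (G (A (G u)) - G (A (G v)))"
      using uv by (intro order.trans[OF nrm_diff] add_right_mono nrm_add) auto
    also have "nrm (G (A (G u)) - G (A (G v))) \<le> CG * nrm (A (G u) - A (G v))"
      using uv CG(2)[of "A (G u) - A (G v)"] by (simp add: nrm_bounded_op_diff[OF G(1)])
    finally show ?thesis using uv by (simp add: GAeq algebra_simps)
  qed
  show "\<exists>s::nat \<Rightarrow> nat. strict_mono s \<and> (\<forall>\<epsilon>>0. \<exists>n0. \<forall>m\<ge>n0. \<forall>n\<ge>n0. nrm (?K (z (s m)) - ?K (z (s n))) \<le> \<epsilon>)"
  proof (intro exI[of _ s] conjI s allI impI)
    fix \<epsilon> :: real assume \<epsilon>: "\<epsilon> > 0"
    have "\<epsilon> / (2 * (1 + CG)) > 0" using \<epsilon> CG by simp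
    with K1 obtain n1 where n1: "\<And>m n. m \<ge> n1 \<Longrightarrow> n \<ge> n1 \<Longrightarrow>
        nrm (A (G (z (s1 m))) - A (G (z (s1 n)))) \<le> \<epsilon> / (2 * (1 + CG))"
      by blast
    \<comment> \<open>Two terms of \<open>z\<close> are at distance at most \<open>2 * C\<close>;
      the additional 1 keeps the quotient meaningful for \<open>C = 0\<close>.\<close>
    have "(\<epsilon> / 2)\<^sup>2 / (2 * C + 1) > 0" using \<epsilon> C by simp
    with K2 obtain n2 where n2: "\<And>m n. m \<ge> n2 \<Longrightarrow> n \<ge> n2 \<Longrightarrow>
        nrm (A (G (G (A (z (s m))))) - A (G (G (A (z (s n)))))) \<le> (\<epsilon> / 2)\<^sup>2 / (2 * C + 1)"
      unfolding s_def o_def by blast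
    have "nrm (?K (z (s m)) - ?K (z (s n))) \<le> \<epsilon>" if mn: "m \<ge> max n1 n2" "n \<ge> max n1 n2" for m n
    proof -
      have "(nrm (G (A (z (s m) - z (s n)))))\<^sup>2
          \<le> nrm (A (G (G (A (z (s m))))) - A (G (G (A (z (s n)))))) * nrm (z (s m) - z (s n))"
        by (rule GA2) (auto simp: z)
      also have "\<dots> \<le> (\<epsilon> / 2)\<^sup>2 / (2 * C + 1) * (2 * C + 1)"
        using mn n2[of m n] C nrm_diff[OF z z, of "s m" "s n"] zC[of "s m"] zC[of "s n"]
        by (intro mult_mono) (auto intro!: nrm_nonneg diff_H z)
      also have "\<dots> = (\<epsilon> / 2)\<^sup>2" using C by simp
      finally have a: "nrm (G (A (z (s m) - z (s n)))) \<le> \<epsilon> / 2"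
        by (rule power2_le_imp_le) (use \<epsilon> in simp)
      \<comment> \<open>The index \<open>n1\<close> belongs to \<open>s1\<close>; it serves for
        \<open>s1\<close> composed with \<open>s2\<close> as well because \<open>s2\<close> does not
        decrease indices.\<close>
      have "m \<le> s2 m" "n \<le> s2 n" using s2 by (simp_all add: seq_suble)
      then have "nrm (A (G (z (s m))) - A (G (z (s n)))) \<le> \<epsilon> / (2 * (1 + CG))"
        using n1[of "s2 m" "s2 n"] mn by (simp add: s_def)
      then have "(1 + CG) * nrm (A (G (z (s m))) - A (G (z (s n)))) \<le> \<epsilon> / 2"
        using CG(1) by (simp add: field_simps)
      then show ?thesis using a K[OF z z, of "s m" "s n"] by linarith
    qed
    then show "\<exists>n0. \<forall>m\<ge>n0. \<forall>n\<ge>n0. nrm (?K (z (s m)) - ?K (z (s n))) \<le> \<epsilon>" by blast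
  qed
qed

end

text \<open>Induction yields two independent solutions of the first \<open>j\<close> equations, one
  nonzero at \<open>i0\<close> and one vanishing there; a combination satisfies the last equation
  too. It supplies the trial vectors orthogonal to earlier eigenvectors and also the orthogonal
  polynomials.\<close>

lemma underdetermined_system:
  fixes M :: "nat \<Rightarrow> nat \<Rightarrow> complex"
  assumes "j < k"
  shows "\<exists>c. (\<exists>i<k. c i \<noteq> 0) \<and> (\<forall>i\<ge>k. c i = 0) \<and> (\<forall>l<j. (\<Sum>i<k. c i * M l i) = 0)"
  using assms
proof (induction j arbitrary: k M)
  case 0
  then show ?case by (intro exI[of _ "\<lambda>i. if i = 0 then 1 else 0"]) auto
next
  case (Suc j)
  obtain k' where k: "k = Suc k'" and jk: "j < k'" using Suc.prems by (cases k) auto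
  obtain a where a: "\<exists>i<k'. a i \<noteq> 0" "\<forall>i\<ge>k'. a i = 0" "\<forall>l<j. (\<Sum>i<k'. a i * M l i) = 0"
    using Suc.IH[OF jk] by blast
  obtain i0 where i0: "i0 < k'" "a i0 \<noteq> 0" using a by auto
  \<comment> \<open>Enumerates the unknowns other than \<open>i0\<close>, so that the induction
    hypothesis applies to the system with unknown \<open>i0\<close> removed.\<close>
  define \<sigma> where "\<sigma> = (\<lambda>i. if i < i0 then i else Suc i)"
  have reindex: "(\<Sum>i<k'. f (\<sigma> i)) = (\<Sum>i\<in>{..<k} - {i0}. f i)" for f :: "nat \<Rightarrow> complex"
  proof (rule sum.reindex_bij_betw)
    show "bij_betw \<sigma> {..<k'} ({..<k} - {i0})"
      unfolding bij_betw_def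
    proof
      show "inj_on \<sigma> {..<k'}" by (auto simp: inj_on_def \<sigma>_def split: if_splits)
      have "\<sigma> ` {..<k'} \<subseteq> {..<k} - {i0}"
        using i0 k by (auto simp: \<sigma>_def)
      moreover have "i \<in> \<sigma> ` {..<k'}" if "i < k" "i \<noteq> i0" for i
        using that i0 k by (intro image_eqI[of _ _ "if i < i0 then i else i - 1"]) (auto simp: \<sigma>_def)
      ultimately show "\<sigma> ` {..<k'} = {..<k} - {i0}" by blast
    qed
  qed
  obtain b where b: "\<exists>i<k'. b i \<noteq> 0" "\<forall>i\<ge>k'. b i = 0"
    "\<forall>l<j. (\<Sum>i<k'. b i * M l (\<sigma> i)) = 0"
    using Suc.IH[OF jk, of "\<lambda>l i. M l (\<sigma> i)"] by blast
  define b' where "b' = (\<lambda>i. if i = i0 then 0 else if i < i0 then b i else b (i - 1))"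
  have b'\<sigma>: "b' (\<sigma> i) = b i" for i by (auto simp: b'_def \<sigma>_def)
  have suma: "(\<Sum>i<k. a i * f i) = (\<Sum>i<k'. a i * f i)" for f
    using a(2) by (simp add: k)
  have sumb: "(\<Sum>i<k. b' i * f i) = (\<Sum>i<k'. b i * f (\<sigma> i))" for f
  proof -
    have "(\<Sum>i<k. b' i * f i) = (\<Sum>i\<in>{..<k} - {i0}. b' i * f i)"
      by (rule sum.mono_neutral_right) (auto simp: b'_def)
    also have "\<dots> = (\<Sum>i<k'. b' (\<sigma> i) * f (\<sigma> i))" by (rule reindex[symmetric])
    finally show ?thesis by (simp add: b'\<sigma>)
  qed
  define s t where "s = (\<Sum>i<k. a i * M j i)" and "t = (\<Sum>i<k. b' i * M j i)"
  \<comment> \<open>\<open>s\<close> and \<open>t\<close> are the values of the last equation at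
    \<open>a\<close> and \<open>b'\<close>, so they cancel in the combination. It is nonzero: its
    entry at \<open>i0\<close> is \<open>t * a i0\<close>, and for \<open>t = 0\<close> it is a
    nonzero multiple of \<open>b'\<close>.\<close>
  define c where "c = (\<lambda>i. if s = 0 then a i else t * a i - s * b' i)"
  have sumc: "(\<Sum>i<k. c i * f i) =
      (if s = 0 then (\<Sum>i<k. a i * f i) else t * (\<Sum>i<k. a i * f i) - s * (\<Sum>i<k. b' i * f i))" for f
    by (simp add: c_def sum_distrib_left algebra_simps sum_subtractf)
  show ?case
  proof (intro exI[of _ c] conjI allI impI)
    show "\<exists>i<k. c i \<noteq> 0"
    proof (cases "s = 0")
      case True
      then show ?thesis using i0 k by (auto simp: c_def intro!: exI[of _ i0])
    next
      case False
      obtain i1 where i1: "i1 < k'" "b i1 \<noteq> 0" using b by auto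
      show ?thesis
      proof (cases "t = 0")
        case True
        have "\<sigma> i1 < k" using i1 k by (auto simp: \<sigma>_def)
        moreover have "c (\<sigma> i1) \<noteq> 0" using True False i1 by (simp add: c_def b'\<sigma>)
        ultimately show ?thesis by blast
      next
        case t: False
        have "c i0 \<noteq> 0" using t False i0 by (simp add: c_def b'_def)
        then show ?thesis using i0 k by (intro exI[of _ i0]) simp
      qed
    qed
    show "c i = 0" if "i \<ge> k" for i
      using a(2) b(2) that i0 k by (auto simp: c_def b'_def)
    fix l assume "l < Suc j"
    then consider "l < j" | "l = j" by linarith
    then show "(\<Sum>i<k. c i * M l i) = 0"
    proof cases
      case 1
      then show ?thesis unfolding sumc using a(3) b(3) by (simp add: suma sumb)
    next
      case 2
      then show ?thesis unfolding sumc by (simp add: s_def[symmetric] t_def[symmetric])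
    qed
  qed
qed

section \<open>Eigenvectors by successive minimization\<close>

context semi_inner
begin

text \<open>A minimizing sequence on the unit sphere of the complement of \<open>e\<^sub>0, \<dots>, e\<^sub>j\<^sub>-\<^sub>1\<close> satisfies
  \<open>(B - L) z\<^sub>n \<rightarrow> 0\<close> by the Cauchy--Schwarz inequality for the form of \<open>B - L\<close>, and
  compactness of \<open>K\<close> together with coercivity of \<open>B - K - L\<close> makes a subsequence converge.\<close>

lemma next_eigenvector:
  assumes complete: "\<And>z. (\<And>n. z n \<in> H) \<Longrightarrow>
      (\<And>\<epsilon>. \<epsilon> > 0 \<Longrightarrow> \<exists>n0. \<forall>m\<ge>n0. \<forall>n\<ge>n0. nrm (z m - z n) \<le> \<epsilon>) \<Longrightarrow>
      \<exists>x\<in>H. (\<lambda>n::nat. nrm (z n - x)) \<longlonglongrightarrow> 0"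
    and B: "bounded_op B" and B_sym: "\<And>u v. u \<in> H \<Longrightarrow> v \<in> H \<Longrightarrow> ip (B u) v = ip u (B v)"
    and K: "bounded_op K" "compact_op K"
    and BK: "\<And>u. u \<in> H \<Longrightarrow> Re (ip (K u) u) \<le> Re (ip (B u) u)"
    and e: "\<And>i. i < j \<Longrightarrow> e i \<in> H" "\<And>i. i < j \<Longrightarrow> nrm (B (e i) - of_real (l i) \<odot> e i) = 0"
    and v: "v \<in> H" "\<And>i. i < j \<Longrightarrow> ip v (e i) = 0" "Re (ip (B v) v) < 0"
  shows "\<exists>x L. x \<in> H \<and> nrm x = 1 \<and> (\<forall>i<j. ip x (e i) = 0) \<and> L < 0 \<and>
    nrm (B x - of_real L \<odot> x) = 0"
proof -
  define M where "M = {u \<in> H. \<forall>i<j. ip u (e i) = 0}"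
  have MH: "u \<in> H" if "u \<in> M" for u using that by (simp add: M_def)
  have M: "subspace M"
    unfolding M_def by (rule subspaceI) (auto simp: ip_add ip_scale e)
  have BH [simp]: "u \<in> H \<Longrightarrow> B u \<in> H" for u using B by (rule bounded_opD)
  \<comment> \<open>Symmetry of \<open>B\<close> makes the complement of eigenvectors invariant.
    This is needed to insert the residual itself into the form of the shifted operator on
    \<open>M\<close>.\<close>
  have BM: "B u \<in> M" if u: "u \<in> M" for u
  proof -
    have "ip (B u) (e i) = 0" if i: "i < j" for i
    proof -
      have "ip (B u) (e i) = cnj (ip (B (e i)) u)"
        using u i e ip_sym[of "B (e i)" u] by (simp add: B_sym MH)
      also have "ip (B (e i)) u = ip (of_real (l i) \<odot> e i) u"
        using u i e by (intro nrm_zero_ip) (auto simp: MH)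
      also have "cnj \<dots> = of_real (l i) * ip u (e i)"
        using u i e ip_sym[of "e i" u] by (simp add: ip_scale MH)
      finally show ?thesis using u i by (simp add: M_def)
    qed
    then show ?thesis using u by (simp add: M_def)
  qed
  obtain C where C: "C > 0" "\<And>u. u \<in> H \<Longrightarrow> nrm (B u) \<le> C * nrm u"
    using bounded_op_bound[OF B] by blast
  have q_bound: "\<bar>Re (ip (B u) u)\<bar> \<le> C * (nrm u)\<^sup>2" if u: "u \<in> H" for u
  proof -
    have "\<bar>Re (ip (B u) u)\<bar> \<le> nrm (B u) * nrm u"
      using Cauchy_Schwarz[of "B u" u] abs_Re_le_cmod[of "ip (B u) u"] u by simp
    also have "\<dots> \<le> C * nrm u * nrm u"
      using C(2)[OF u] nrm_nonneg[OF u] by (rule mult_right_mono)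
    finally show ?thesis by (simp add: power2_eq_square mult.assoc)
  qed
  define Q where "Q = {Re (ip (B z) z) | z. z \<in> M \<and> nrm z = 1}"
  define L where "L = Inf Q"
  have Q_below: "bdd_below Q"
  proof (rule bdd_belowI)
    fix x assume "x \<in> Q"
    then show "- C \<le> x" using q_bound MH unfolding Q_def by force
  qed
  have q_scale: "Re (ip (B (of_real s \<odot> u)) (of_real s \<odot> u)) = s\<^sup>2 * Re (ip (B u) u)"
    if u: "u \<in> H" for s u
    using u bounded_opD(3)[OF B] by (simp add: ip_scale_right power2_eq_square)
  have L_le: "L * (nrm u)\<^sup>2 \<le> Re (ip (B u) u)" if u: "u \<in> M" for u
  proof (cases "nrm u = 0")
    case True
    then show ?thesis using q_bound[OF MH[OF u]] by simp
  next
    case False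
    then have pos: "nrm u > 0" using nrm_nonneg[OF MH[OF u]] by simp
    define w where "w = of_real (1 / nrm u) \<odot> u"
    have w: "w \<in> M" "nrm w = 1"
      using M u pos MH[OF u] by (auto simp: w_def subspace_scale nrm_scale norm_divide)
    have "L \<le> Re (ip (B w) w)"
      unfolding L_def by (rule cInf_lower[OF _ Q_below]) (use w in \<open>auto simp: Q_def\<close>)
    also have "\<dots> = (1 / nrm u)\<^sup>2 * Re (ip (B u) u)"
      unfolding w_def using MH[OF u] by (rule q_scale)
    finally show ?thesis using pos by (simp add: field_simps)
  qed
  have vM: "v \<in> M" using v by (simp add: M_def)
  have L0: "L < 0"
  proof (rule ccontr)
    assume "\<not> L < 0"
    then have "0 \<le> L * (nrm v)\<^sup>2" by simp
    also have "\<dots> \<le> Re (ip (B v) v)" by (rule L_le[OF vM])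
    finally show False using v by simp
  qed
  have "Q \<noteq> {}"
  proof -
    have "nrm v \<noteq> 0" using q_bound[OF v(1)] v(3) by auto
    then have "nrm v > 0" using nrm_nonneg[OF v(1)] by simp
    then have "of_real (1 / nrm v) \<odot> v \<in> M" "nrm (of_real (1 / nrm v) \<odot> v) = 1"
      using M vM v(1) by (auto simp: subspace_scale nrm_scale norm_divide)
    then show ?thesis by (auto simp: Q_def)
  qed
  then have "\<exists>z. z \<in> M \<and> nrm z = 1 \<and> Re (ip (B z) z) < L + 1 / real (Suc n)" for n
  proof -
    assume "Q \<noteq> {}"
    then obtain y where "y \<in> Q" "y < L + 1 / real (Suc n)"
      using cInf_lessD[of Q "L + 1 / real (Suc n)"] unfolding L_def[symmetric] by auto
    then show ?thesis unfolding Q_def by blast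
  qed
  then obtain z where z: "\<And>n. z n \<in> M" "\<And>n. nrm (z n) = 1"
    and zL: "\<And>n. Re (ip (B (z n)) (z n)) < L + 1 / real (Suc n)"
    by metis
  have zH: "z n \<in> H" for n using z MH by blast
  define R where "R = (\<lambda>u. B u - of_real L \<odot> u)"
  have RH [simp]: "u \<in> H \<Longrightarrow> R u \<in> H" for u by (simp add: R_def)
  have RM: "u \<in> M \<Longrightarrow> R u \<in> M" for u
    using M BM by (simp add: R_def subspace_diff subspace_scale)
  have ipR: "ip (R u) w = ip (B u) w - of_real L * ip u w" if "u \<in> H" "w \<in> H" for u w
    using that by (simp add: R_def ip_diff ip_scale)
  have R_diff: "nrm (R (u - w)) \<le> nrm (R u) + nrm (R w)" if uw: "u \<in> H" "w \<in> H" for u w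
  proof -
    have "R (u - w) - (R u - R w) = B (u - w) - (B u - B w)"
      by (simp add: R_def scale_right_diff_distrib)
    then have "nrm (R (u - w)) = nrm (R u - R w)"
      using bounded_op_diff[OF B uw] nrm_diff_ge[of "R (u - w)" "R u - R w"] uw by simp
    then show ?thesis using nrm_diff[of "R u" "R w"] uw by simp
  qed
  interpret F: semi_inner scale M "\<lambda>u w. ip (R u) w"
  proof
    show "subspace M" by (rule M)
  next
    fix u w x assume "u \<in> M" "w \<in> M" "x \<in> M"
    then show "ip (R (u + w)) x = ip (R u) x + ip (R w) x"
      using bounded_opD(2)[OF B, of u w x] by (simp add: ipR MH ip_add algebra_simps)
  next
    fix c u w assume "u \<in> M" "w \<in> M"
    then show "ip (R (c \<odot> u)) w = c * ip (R u) w"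
      using bounded_opD(3)[OF B, of u w c] by (simp add: ipR MH ip_scale algebra_simps)
  next
    fix u w assume "u \<in> M" "w \<in> M"
    then have uw: "u \<in> H" "w \<in> H" by (simp_all add: MH)
    have "ip (B w) u = cnj (ip (B u) w)"
      using uw ip_sym[of "B u" w] by (simp add: B_sym)
    then show "ip (R w) u = cnj (ip (R u) w)"
      using uw ip_sym[of u w] by (simp add: ipR)
  next
    fix u assume "u \<in> M"
    then show "0 \<le> Re (ip (R u) u)"
      using L_le[of u] by (simp add: ipR MH nrm_square)
  qed
  \<comment> \<open>Cauchy-Schwarz for the form of \<open>R\<close>, applied to \<open>u\<close> and
    \<open>R u\<close>, bounds the fourth power of \<open>nrm (R u)\<close> by
    \<open>(R u, u) * (R R u, R u)\<close>; the second factor is at most a constant times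
    \<open>(nrm (R u))^2\<close>, which cancels.\<close>
  have R_small: "(nrm (R u))\<^sup>2 \<le> (C + \<bar>L\<bar>) * Re (ip (R u) u)" if u: "u \<in> M" for u
  proof (cases "nrm (R u) = 0")
    case True
    then show ?thesis using F.ip_nonneg[OF u] C by simp
  next
    case False
    then have pos: "(nrm (R u))\<^sup>2 > 0" by simp
    have Ru: "R u \<in> M" "R u \<in> H" using RM[OF u] MH by auto
    have "((nrm (R u))\<^sup>2)\<^sup>2 = (cmod (ip (R u) (R u)))\<^sup>2"
      using Ru ip_self[of "R u"] ip_nonneg[of "R u"]
      by (metis nrm_square norm_of_real power2_abs)
    also have "\<dots> \<le> Re (ip (R u) u) * Re (ip (R (R u)) (R u))"
      using F.Cauchy_Schwarz_form[OF u Ru(1)] .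
    also have "\<dots> \<le> Re (ip (R u) u) * ((C + \<bar>L\<bar>) * (nrm (R u))\<^sup>2)"
    proof (rule mult_left_mono[OF _ F.ip_nonneg[OF u]])
      have "Re (ip (R (R u)) (R u)) = Re (ip (B (R u)) (R u)) - L * (nrm (R u))\<^sup>2"
        using Ru by (simp add: ipR nrm_square)
      also have "\<dots> \<le> C * (nrm (R u))\<^sup>2 + \<bar>L\<bar> * (nrm (R u))\<^sup>2"
        using q_bound[OF Ru(2)] L0 by simp
      finally show "Re (ip (R (R u)) (R u)) \<le> (C + \<bar>L\<bar>) * (nrm (R u))\<^sup>2"
        by (simp add: algebra_simps)
    qed
    finally have "(nrm (R u))\<^sup>2 * (nrm (R u))\<^sup>2 \<le> ((C + \<bar>L\<bar>) * Re (ip (R u) u)) * (nrm (R u))\<^sup>2"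
      by (simp only: power2_eq_square mult.assoc mult.commute mult.left_commute)
    then show ?thesis using pos by (rule mult_right_le_imp_le)
  qed
  have Rz: "(\<lambda>n. nrm (R (z n))) \<longlonglongrightarrow> 0"
  proof -
    have le: "(nrm (R (z n)))\<^sup>2 \<le> (C + \<bar>L\<bar>) * (1 / real (Suc n))" for n
    proof -
      have "Re (ip (R (z n)) (z n)) = Re (ip (B (z n)) (z n)) - L"
        using zH[of n] z(2)[of n] nrm_square[of "z n"] by (simp add: ipR)
      then have "Re (ip (R (z n)) (z n)) \<le> 1 / real (Suc n)" using zL[of n] by simp
      then show ?thesis
        by (intro order.trans[OF R_small[OF z(1)] mult_left_mono]) (use C in auto)
    qed
    have lim: "(\<lambda>n. (C + \<bar>L\<bar>) * (1 / real (Suc n))) \<longlonglongrightarrow> (C + \<bar>L\<bar>) * 0"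
      by (intro tendsto_mult tendsto_const LIMSEQ_inverse_real_of_nat[unfolded inverse_eq_divide])
    have "(\<lambda>n. (nrm (R (z n)))\<^sup>2) \<longlonglongrightarrow> 0"
      by (rule tendsto_sandwich[OF _ _ tendsto_const lim[unfolded mult_zero_right]])
        (use le in \<open>auto intro!: always_eventually\<close>)
    then have "(\<lambda>n. sqrt ((nrm (R (z n)))\<^sup>2)) \<longlonglongrightarrow> sqrt 0"
      by (rule tendsto_real_sqrt)
    then show ?thesis using nrm_nonneg[OF RH[OF zH]] by simp
  qed
  have "\<exists>s::nat \<Rightarrow> nat. strict_mono s \<and> (\<forall>\<epsilon>>0. \<exists>n0. \<forall>m\<ge>n0. \<forall>n\<ge>n0.
      nrm (K (z (s m)) - K (z (s n))) \<le> \<epsilon>)"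
    by (rule K(2)[unfolded compact_op_def, rule_format, where C = 1]) (use zH z in auto)
  then obtain s :: "nat \<Rightarrow> nat" where s: "strict_mono s"
    and Ks: "\<forall>\<epsilon>>0. \<exists>n0. \<forall>m\<ge>n0. \<forall>n\<ge>n0. nrm (K (z (s m)) - K (z (s n))) \<le> \<epsilon>"
    by (elim exE conjE)
  \<comment> \<open>Since \<open>B - K\<close> is nonnegative, \<open>(R u, u)\<close> is at least
    \<open>(K u, u)\<close> plus \<open>-L\<close> times the squared norm. Here the strict sign of
    \<open>L\<close> is essential.\<close>
  have coercive: "\<bar>L\<bar> * nrm u \<le> nrm (R u) + nrm (K u)" if u: "u \<in> H" for u
  proof (cases "nrm u = 0")
    case True
    then show ?thesis using u nrm_nonneg[of "R u"] nrm_nonneg[of "K u"] bounded_opD(1)[OF K(1) u] by simp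
  next
    case False
    then have pos: "nrm u > 0" using nrm_nonneg[OF u] by simp
    have KH: "K u \<in> H" using K(1) u by (rule bounded_opD)
    have "\<bar>L\<bar> * nrm u * nrm u = - L * Re (ip u u)"
      using L0 u by (simp add: nrm_square[symmetric] power2_eq_square)
    also have "\<dots> \<le> Re (ip (R u) u) - Re (ip (K u) u)"
      using BK[OF u] u by (simp add: ipR)
    also have "\<dots> \<le> nrm (R u) * nrm u + nrm (K u) * nrm u"
      using Cauchy_Schwarz[of "R u" u] Cauchy_Schwarz[of "K u" u] u KH
        abs_Re_le_cmod[of "ip (R u) u"] abs_Re_le_cmod[of "ip (K u) u"] by simp
    finally have "\<bar>L\<bar> * nrm u * nrm u \<le> (nrm (R u) + nrm (K u)) * nrm u"
      by (simp add: algebra_simps)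
    then show ?thesis using pos by simp
  qed
  have "\<exists>x\<in>H. (\<lambda>n. nrm (z (s n) - x)) \<longlonglongrightarrow> 0"
  proof (rule complete)
    fix \<epsilon> :: real assume \<epsilon>: "\<epsilon> > 0"
    \<comment> \<open>One third for each of the two residuals and one for the difference of the
      images under \<open>K\<close>.\<close>
    define \<eta> where "\<eta> = \<bar>L\<bar> * \<epsilon> / 3"
    have \<eta>: "\<eta> > 0" using L0 \<epsilon> by (simp add: \<eta>_def mult_neg_pos)
    obtain n1 where n1: "\<And>m n. m \<ge> n1 \<Longrightarrow> n \<ge> n1 \<Longrightarrow> nrm (K (z (s m)) - K (z (s n))) \<le> \<eta>"
      using Ks \<eta> by blast
    obtain n2 where n2: "\<And>n. n \<ge> n2 \<Longrightarrow> nrm (R (z n)) < \<eta>"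
      using order_tendstoD(2)[OF Rz \<eta>] by (auto simp: eventually_sequentially)
    have "nrm (z (s m) - z (s n)) \<le> \<epsilon>" if mn: "m \<ge> max n1 n2" "n \<ge> max n1 n2" for m n
    proof -
      have sm: "m \<le> s m" "n \<le> s n" using s by (simp_all add: seq_suble)
      have "\<bar>L\<bar> * nrm (z (s m) - z (s n)) \<le> nrm (R (z (s m) - z (s n))) + nrm (K (z (s m) - z (s n)))"
        by (rule coercive) (simp add: zH)
      also have "\<dots> \<le> (nrm (R (z (s m))) + nrm (R (z (s n)))) + nrm (K (z (s m)) - K (z (s n)))"
        using R_diff[OF zH zH, of "s m" "s n"] nrm_bounded_op_diff[OF K(1) zH zH, of "s m" "s n"] by simp
      also have "\<dots> \<le> \<bar>L\<bar> * \<epsilon>"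
        using n1[of m n] n2[of "s m"] n2[of "s n"] mn sm by (simp add: \<eta>_def)
      finally show ?thesis using L0 by simp
    qed
    then show "\<exists>n0. \<forall>m\<ge>n0. \<forall>n\<ge>n0. nrm (z (s m) - z (s n)) \<le> \<epsilon>" by blast
  qed (rule zH)
  then obtain x where x: "x \<in> H" and zx: "(\<lambda>n. nrm (z (s n) - x)) \<longlonglongrightarrow> 0" by blast
  have "(\<lambda>n. nrm (z (s n)) - nrm x) \<longlonglongrightarrow> 0"
    by (rule Lim_null_comparison[OF _ zx]) (use nrm_diff_ge zH x in auto)
  then have x1: "nrm x = 1" using z(2) by (simp add: LIMSEQ_const_iff)
  have xe: "ip x (e i) = 0" if i: "i < j" for i
  proof -
    have le: "cmod (ip x (e i)) \<le> nrm (z (s n) - x) * nrm (e i)" for n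
    proof -
      have "ip (z (s n) - x) (e i) = - ip x (e i)"
        using z(1)[of "s n"] x i e by (simp add: ip_diff zH M_def)
      then show ?thesis using Cauchy_Schwarz[of "z (s n) - x" "e i"] zH x e i by simp
    qed
    have "(\<lambda>n. nrm (z (s n) - x) * nrm (e i)) \<longlonglongrightarrow> 0 * nrm (e i)"
      by (intro tendsto_mult zx tendsto_const)
    from LIMSEQ_le_const[OF this, of "cmod (ip x (e i))"] have "cmod (ip x (e i)) \<le> 0"
      using le by auto
    then show ?thesis by simp
  qed
  have Rx_le: "nrm (R x) \<le> nrm (R (z (s n))) + (C + \<bar>L\<bar>) * nrm (z (s n) - x)" for n
  proof -
    let ?d = "z (s n) - x"
    have d: "?d \<in> H" using zH x by simp
    have "x = z (s n) - ?d" by simp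
    then have "nrm (R x) \<le> nrm (R (z (s n))) + nrm (R ?d)"
      using R_diff[OF zH[of "s n"] d] by simp
    also have "nrm (R ?d) \<le> nrm (B ?d) + nrm (of_real L \<odot> ?d)"
      unfolding R_def using d by (intro nrm_diff) auto
    also have "\<dots> \<le> (C + \<bar>L\<bar>) * nrm ?d"
      using C(2)[OF d] nrm_scale[OF d, of "of_real L"] by (simp add: algebra_simps)
    finally show ?thesis by simp
  qed
  have "(\<lambda>n. nrm (R (z (s n))) + (C + \<bar>L\<bar>) * nrm (z (s n) - x)) \<longlonglongrightarrow> 0 + (C + \<bar>L\<bar>) * 0"
    using LIMSEQ_subseq_LIMSEQ[OF Rz s, unfolded o_def]
    by (intro tendsto_add tendsto_mult tendsto_const zx)
  from LIMSEQ_le_const[OF this, of "nrm (R x)"] have "nrm (R x) \<le> 0"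
    using Rx_le by auto
  then have "nrm (R x) = 0" using nrm_nonneg[of "R x"] x by simp
  then show ?thesis using x x1 xe L0 unfolding R_def by blast
qed

text \<open>A dimension count keeps the minimization going: orthogonality to \<open>j < k\<close>
  eigenvectors imposes \<open>j\<close> conditions on \<open>k\<close> coefficients, so some
  nontrivial combination of the \<open>u i\<close> is orthogonal to all of them and still has
  negative form.\<close>

theorem orthonormal_eigenvectors_of_negative_subspace:
  assumes complete: "\<And>z. (\<And>n. z n \<in> H) \<Longrightarrow>
      (\<And>\<epsilon>. \<epsilon> > 0 \<Longrightarrow> \<exists>n0. \<forall>m\<ge>n0. \<forall>n\<ge>n0. nrm (z m - z n) \<le> \<epsilon>) \<Longrightarrow>
      \<exists>x\<in>H. (\<lambda>n::nat. nrm (z n - x)) \<longlonglongrightarrow> 0"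
    and B: "bounded_op B" and B_sym: "\<And>u v. u \<in> H \<Longrightarrow> v \<in> H \<Longrightarrow> ip (B u) v = ip u (B v)"
    and K: "bounded_op K" "compact_op K"
    and BK: "\<And>u. u \<in> H \<Longrightarrow> Re (ip (K u) u) \<le> Re (ip (B u) u)"
    and u: "\<And>i::nat. i < k \<Longrightarrow> u i \<in> H"
    and neg: "\<And>c. \<exists>i<k. c i \<noteq> 0 \<Longrightarrow> 
      Re (ip (B (\<Sum>i<k. c i \<odot> u i)) (\<Sum>i<k. c i \<odot> u i)) < 0"
  shows "\<exists>e l. (\<forall>i<k. e i \<in> H \<and> l i < 0 \<and> nrm (B (e i) - of_real (l i) \<odot> e i) = 0) \<and>
    (\<forall>i<k. \<forall>j<k. ip (e i) (e j) = (if i = j then 1 else 0))"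
proof -
  have "\<exists>e l. (\<forall>i<j. e i \<in> H \<and> l i < 0 \<and> nrm (B (e i) - of_real (l i) \<odot> e i) = 0) \<and>
    (\<forall>i<j. \<forall>i'<j. ip (e i) (e i') = (if i = i' then 1 else 0))" if "j \<le> k" for j
    using that
  proof (induction j)
    case (Suc j)
    then obtain e l where e: "\<And>i. i < j \<Longrightarrow> e i \<in> H" "\<And>i. i < j \<Longrightarrow> l i < 0"
      "\<And>i. i < j \<Longrightarrow> nrm (B (e i) - of_real (l i) \<odot> e i) = 0"
      "\<And>i i'. i < j \<Longrightarrow> i' < j \<Longrightarrow> ip (e i) (e i') = (if i = i' then 1 else 0)"
      by (metis Suc_leD)
    obtain c where c: "\<exists>i<k. c i \<noteq> 0" "\<And>a. a < j \<Longrightarrow> (\<Sum>i<k. c i * ip (u i) (e a)) = 0"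
      using underdetermined_system[of j k "\<lambda>a i. ip (u i) (e a)"] Suc.prems by auto
    define v where "v = (\<Sum>i<k. c i \<odot> u i)"
    have vH: "v \<in> H" unfolding v_def by (intro sum_H scale_H u) simp
    have ve: "ip v (e a) = 0" if "a < j" for a
    proof -
      have "ip v (e a) = (\<Sum>i<k. ip (c i \<odot> u i) (e a))"
        unfolding v_def using e that u by (intro ip_sum) auto
      also have "\<dots> = (\<Sum>i<k. c i * ip (u i) (e a))"
        using e that u by (intro sum.cong) (auto simp: ip_scale)
      finally show ?thesis using c that by simp
    qed
    have "Re (ip (B v) v) < 0" unfolding v_def using c(1) by (rule neg)
    with next_eigenvector[where j = j and e = e and l = l and v = v, OF _ B B_sym K BK e(1) e(3) vH ve] complete
    have "\<exists>x L. x \<in> H \<and> nrm x = 1 \<and> (\<forall>i<j. ip x (e i) = 0) \<and> L < 0 \<and> nrm (B x - of_real L \<odot> x) = 0"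
      by fast
    then obtain x L where x: "x \<in> H" "nrm x = 1" "\<And>i. i < j \<Longrightarrow> ip x (e i) = 0" "L < 0"
      "nrm (B x - of_real L \<odot> x) = 0"
      by (elim exE conjE) blast
    have xx: "ip x x = 1"
      using nrm_square[OF x(1)] x(2) ip_self[OF x(1)] by simp
    have ex: "ip (e i) x = 0" if "i < j" for i
      using ip_sym[of x "e i"] x e that by simp
    show ?case
      by (rule exI[of _ "e(j := x)"], rule exI[of _ "l(j := L)"]) (auto simp: less_Suc_eq e x xx ex)
  qed simp
  then show ?thesis by blast
qed

end

section \<open>The Hilbert space $L_2$\<close>

definition l2ip :: "('a::euclidean_space \<Rightarrow> complex) \<Rightarrow> ('a \<Rightarrow> complex) \<Rightarrow> complex" where
  "l2ip u v = (LINT x|lborel. u x * cnj (v x))"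

lemma L2_measurable [measurable_dest]: "u \<in> L2 \<Longrightarrow> u \<in> borel_measurable borel"
  by (simp add: L2_def)

lemma L2_integrable: "u \<in> L2 \<Longrightarrow> integrable lborel (\<lambda>x. (cmod (u x))\<^sup>2)"
  by (simp add: L2_def)

lemma measurable_cnj [measurable (raw)]:
  "f \<in> borel_measurable M \<Longrightarrow> (\<lambda>x. cnj (f x)) \<in> borel_measurable M"
  by (rule measurable_compose[of f M borel cnj])
    (auto intro!: borel_measurable_continuous_onI continuous_intros)

lemma L2_iff_nn_integral:
  "u \<in> L2 \<longleftrightarrow> u \<in> borel_measurable borel \<and> (\<integral>\<^sup>+x. ennreal ((cmod (u x))\<^sup>2) \<partial>lborel) < \<infinity>"
  by (auto simp: L2_def integrable_iff_bounded)

lemma L2_mult_integrable: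
  assumes [measurable]: "u \<in> L2" "v \<in> L2"
  shows "integrable lborel (\<lambda>x. u x * cnj (v x))"
proof (rule Bochner_Integration.integrable_bound)
  show "integrable lborel (\<lambda>x. ((cmod (u x))\<^sup>2 + (cmod (v x))\<^sup>2) / 2)"
    using assms by (simp add: L2_integrable)
  have "cmod (u x) * cmod (v x) \<le> ((cmod (u x))\<^sup>2 + (cmod (v x))\<^sup>2) / 2" for x
    using sum_squares_bound[of "cmod (u x)" "cmod (v x)"] by simp
  then show "AE x in lborel. norm (u x * cnj (v x)) \<le> norm (((cmod (u x))\<^sup>2 + (cmod (v x))\<^sup>2) / 2)"
    by (simp add: norm_mult)
qed measurable

lemma L2_subspace: "cfun.subspace L2"
proof (rule cfun.subspaceI)
  show "(0 :: 'a \<Rightarrow> complex) \<in> L2" by (simp add: L2_def zero_fun_def)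
next
  fix u v :: "'a \<Rightarrow> complex" assume uv [measurable]: "u \<in> L2" "v \<in> L2"
  have "integrable lborel (\<lambda>x. (cmod (u x + v x))\<^sup>2)"
  proof (rule Bochner_Integration.integrable_bound)
    show "integrable lborel (\<lambda>x. 2 * (cmod (u x))\<^sup>2 + 2 * (cmod (v x))\<^sup>2)"
      using uv by (simp add: L2_integrable)
    have "(cmod (u x + v x))\<^sup>2 \<le> 2 * (cmod (u x))\<^sup>2 + 2 * (cmod (v x))\<^sup>2" for x
    proof -
      have "(cmod (u x + v x))\<^sup>2 \<le> (cmod (u x) + cmod (v x))\<^sup>2"
        by (intro power_mono norm_triangle_ineq) simp
      also have "\<dots> \<le> 2 * (cmod (u x))\<^sup>2 + 2 * (cmod (v x))\<^sup>2"
        using sum_squares_bound[of "cmod (u x)" "cmod (v x)"] by (simp add: power2_sum)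
      finally show ?thesis .
    qed
    then show "AE x in lborel. norm ((cmod (u x + v x))\<^sup>2) \<le> norm (2 * (cmod (u x))\<^sup>2 + 2 * (cmod (v x))\<^sup>2)"
      by simp
  qed measurable
  then show "u + v \<in> L2" by (simp add: L2_def plus_fun_def)
next
  fix c and u :: "'a \<Rightarrow> complex" assume uv [measurable]: "u \<in> L2"
  then show "(\<lambda>x. c * u x) \<in> L2"
    using L2_integrable[OF uv] by (simp add: L2_def norm_mult power_mult_distrib)
qed

global_interpretation l2: semi_inner "\<lambda>(c::complex) (f::'a::euclidean_space \<Rightarrow> complex) x. c * f x" L2 l2ip
proof
  show "cfun.subspace (L2 :: ('a \<Rightarrow> complex) set)" by (rule L2_subspace)
next
  fix u v w :: "'a \<Rightarrow> complex" assume "u \<in> L2" "v \<in> L2" "w \<in> L2"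
  then show "l2ip (u + v) w = l2ip u w + l2ip v w"
    by (simp add: l2ip_def distrib_right L2_mult_integrable)
next
  fix c and u w :: "'a \<Rightarrow> complex"
  show "l2ip (\<lambda>x. c * u x) w = c * l2ip u w" by (simp add: l2ip_def mult.assoc)
next
  fix u v :: "'a \<Rightarrow> complex"
  show "l2ip v u = cnj (l2ip u v)"
    unfolding l2ip_def by (subst Bochner_Integration.integral_cnj[symmetric]) (simp add: mult.commute)
next
  fix u :: "'a \<Rightarrow> complex"
  have "l2ip u u = (LINT x|lborel. complex_of_real ((cmod (u x))\<^sup>2))"
    unfolding l2ip_def complex_norm_square ..
  then show "0 \<le> Re (l2ip u u)" by (simp del: of_real_power)
qed

abbreviation nrm2 :: "('a::euclidean_space \<Rightarrow> complex) \<Rightarrow> real" where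
  "nrm2 \<equiv> l2.nrm"

lemma l2ip_self: "l2ip u u = complex_of_real (LINT x|lborel. (cmod (u x))\<^sup>2)"
  unfolding l2ip_def complex_norm_square[symmetric] by (rule integral_complex_of_real)

lemma nrm2_square: "(nrm2 u)\<^sup>2 = (LINT x|lborel. (cmod (u x))\<^sup>2)"
  by (simp add: l2.nrm_def l2ip_self)

lemma nrm2_nonneg: "0 \<le> nrm2 u"
  by (simp add: l2.nrm_def l2ip_self)

lemma nn_integral_square_L2:
  "u \<in> L2 \<Longrightarrow> (\<integral>\<^sup>+x. ennreal ((cmod (u x))\<^sup>2) \<partial>lborel) = ennreal ((nrm2 u)\<^sup>2)"
  unfolding nrm2_square by (rule nn_integral_eq_integral) (auto intro: L2_integrable)

text \<open>Estimates are made for the nonnegative integral, so that square integrability and the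
  norm bound come together.\<close>

lemma nrm2_leI:
  assumes "(\<integral>\<^sup>+x. ennreal ((cmod (u x))\<^sup>2) \<partial>lborel) \<le> ennreal (C\<^sup>2)" "u \<in> borel_measurable borel" "0 \<le> C"
  shows "u \<in> L2" "nrm2 u \<le> C"
proof -
  show u: "u \<in> L2" using assms(1,2) by (simp add: L2_iff_nn_integral le_less_trans)
  have "(nrm2 u)\<^sup>2 \<le> C\<^sup>2"
    using assms(1) by (simp add: nn_integral_square_L2[OF u])
  then show "nrm2 u \<le> C" using assms(3) by (rule power2_le_imp_le)
qed

lemma nrm2_eq_0_iff: "u \<in> L2 \<Longrightarrow> nrm2 u = 0 \<longleftrightarrow> (AE x in lborel. u x = 0)"
  using integral_nonneg_eq_0_iff_AE[OF L2_integrable, of u]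
  by (simp add: nrm2_square[symmetric])

lemma l2ip_cong_AE:
  assumes "u \<in> L2" "u' \<in> L2" "v \<in> L2" "AE x in lborel. u x = u' x"
  shows "l2ip u v = l2ip u' v"
proof (rule l2.nrm_zero_ip)
  show "nrm2 (u - u') = 0"
    using assms by (subst nrm2_eq_0_iff) auto
qed (use assms in auto)

lemma nrm2_cong_AE:
  assumes "u \<in> L2" "u' \<in> L2" "AE x in lborel. u x = u' x"
  shows "nrm2 u = nrm2 u'"
proof -
  have "nrm2 (u - u') = 0" using assms by (subst nrm2_eq_0_iff) auto
  then show ?thesis using l2.nrm_diff_ge[OF assms(1,2)] by simp
qed

lemma ennreal_le_suminf: "f k \<le> (\<Sum>k. f k)" for f :: "nat \<Rightarrow> ennreal"
  using sum_le_suminf[of f "{k}"] by simp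

lemma ennreal_finiteE:
  assumes "(S :: ennreal) \<noteq> \<infinity>"
  obtains C where "S = ennreal C" "0 \<le> C"
  using assms by (cases S) auto

text \<open>A sequence with \<open>\<parallel>d\<^sub>k\<parallel> \<le> 2\<^sup>-\<^sup>k\<close> has \<open>\<Sum> 2\<^sup>k \<bar>d\<^sub>k\<bar>\<^sup>2\<close> integrable, so it is summable
  almost everywhere.\<close>

lemma AE_summable_of_fast_decay:
  fixes d :: "nat \<Rightarrow> 'a::euclidean_space \<Rightarrow> complex"
  assumes d: "\<And>k. d k \<in> L2" "\<And>k. nrm2 (d k) \<le> (1 / 2) ^ k"
  shows "AE x in lborel. summable (\<lambda>k. d k x)"
proof -
  have [measurable]: "d k \<in> borel_measurable borel" for k using L2_measurable[OF d(1)] .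
  have "(\<integral>\<^sup>+x. ennreal (2 ^ k * (cmod (d k x))\<^sup>2) \<partial>lborel) \<le> ennreal ((1 / 2) ^ k)" for k
  proof -
    have "(\<integral>\<^sup>+x. ennreal (2 ^ k * (cmod (d k x))\<^sup>2) \<partial>lborel) = ennreal (2 ^ k) * ennreal ((nrm2 (d k))\<^sup>2)"
      unfolding nn_integral_square_L2[OF d(1), symmetric]
      by (subst nn_integral_cmult[symmetric]) (simp_all add: ennreal_mult)
    also have "\<dots> = ennreal (2 ^ k * (nrm2 (d k))\<^sup>2)" by (simp add: ennreal_mult)
    also have "\<dots> \<le> ennreal (2 ^ k * ((1 / 2) ^ k)\<^sup>2)"
      by (intro ennreal_leI mult_left_mono power_mono d nrm2_nonneg) simp
    also have "2 ^ k * ((1 / 2) ^ k)\<^sup>2 = ((1 / 2) ^ k :: real)"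
      by (simp add: power2_eq_square power_divide)
    finally show ?thesis .
  qed
  then have "(\<Sum>k. \<integral>\<^sup>+x. ennreal (2 ^ k * (cmod (d k x))\<^sup>2) \<partial>lborel) \<le> (\<Sum>k. ennreal ((1 / 2) ^ k))"
    by (intro suminf_le) auto
  also have "\<dots> = ennreal (\<Sum>k. (1 / 2) ^ k)"
    by (intro suminf_ennreal2) (auto simp: summable_geometric)
  finally have "(\<integral>\<^sup>+x. (\<Sum>k. ennreal (2 ^ k * (cmod (d k x))\<^sup>2)) \<partial>lborel) < \<infinity>"
    by (subst nn_integral_suminf) (auto intro: le_less_trans)
  then have "AE x in lborel. (\<Sum>k. ennreal (2 ^ k * (cmod (d k x))\<^sup>2)) \<noteq> \<infinity>"
    by (intro nn_integral_PInf_AE) auto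
  then show ?thesis
  proof eventually_elim
    case (elim x)
    then obtain C where C: "(\<Sum>k. ennreal (2 ^ k * (cmod (d k x))\<^sup>2)) = ennreal C" "C \<ge> 0"
      using ennreal_finiteE by blast
    have le: "cmod (d k x) \<le> sqrt C * (1 / sqrt 2) ^ k" for k
    proof -
      have "ennreal (2 ^ k * (cmod (d k x))\<^sup>2) \<le> ennreal C"
        unfolding C(1)[symmetric] by (rule ennreal_le_suminf)
      then have "2 ^ k * (cmod (d k x))\<^sup>2 \<le> C" using C(2) by simp
      then have "(cmod (d k x))\<^sup>2 \<le> C / 2 ^ k" by (simp add: field_simps)
      then have "cmod (d k x) \<le> sqrt (C / 2 ^ k)" by (rule real_le_rsqrt)
      also have "\<dots> = sqrt C * (1 / sqrt 2) ^ k"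
        by (simp add: real_sqrt_divide real_sqrt_power power_divide)
      finally show ?thesis .
    qed
    have "summable (\<lambda>k. sqrt C * (1 / sqrt 2) ^ k)"
      by (intro summable_mult summable_geometric) simp
    from summable_comparison_test'[OF this, of 0 "\<lambda>k. d k x"] le show ?case by blast
  qed
qed

text \<open>Riesz-Fischer: a rapidly converging subsequence converges almost everywhere, and Fatou's
  lemma bounds the distance from every late term of the original sequence to the limit.\<close>

theorem L2_complete:
  fixes z :: "nat \<Rightarrow> 'a::euclidean_space \<Rightarrow> complex"
  assumes z: "\<And>n. z n \<in> L2"
    and Cauchy: "\<And>\<epsilon>. \<epsilon> > 0 \<Longrightarrow> \<exists>n0. \<forall>m\<ge>n0. \<forall>n\<ge>n0. nrm2 (z m - z n) \<le> \<epsilon>"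
  shows "\<exists>w\<in>L2. (\<lambda>n. nrm2 (z n - w)) \<longlonglongrightarrow> 0"
proof -
  have [measurable]: "z k \<in> borel_measurable borel" for k using L2_measurable[OF z] .
  have "\<forall>k. \<exists>n0. \<forall>m\<ge>n0. \<forall>n\<ge>n0. nrm2 (z m - z n) \<le> (1 / 2) ^ k"
    using Cauchy by simp
  then obtain N where N: "\<And>k m n. m \<ge> N k \<Longrightarrow> n \<ge> N k \<Longrightarrow> nrm2 (z m - z n) \<le> (1 / 2) ^ k"
    by metis
  \<comment> \<open>The sum makes \<open>s\<close> monotone and at least \<open>N k\<close>; the
    summand \<open>k\<close> drives it to infinity.\<close>
  define s where "s k = (\<Sum>i\<le>k. N i) + k" for k
  have sN: "N k \<le> s k" for k
    using member_le_sum[of k "{..k}" N] by (simp add: s_def)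
  have s_mono: "s k \<le> s (Suc k)" for k by (simp add: s_def)
  have s_ge: "k \<le> s k" for k by (simp add: s_def)
  define d where "d k = z (s (Suc k)) - z (s k)" for k
  have "AE x in lborel. summable (\<lambda>k. d k x)"
  proof (rule AE_summable_of_fast_decay)
    show "d k \<in> L2" for k unfolding d_def using z by (intro l2.diff_H)
    show "nrm2 (d k) \<le> (1 / 2) ^ k" for k
      unfolding d_def using sN[of k] s_mono[of k] by (intro N) auto
  qed
  then have conv: "AE x in lborel. convergent (\<lambda>k. z (s k) x)"
  proof eventually_elim
    case (elim x)
    have "z (s k) x = (\<Sum>i<k. d i x) + z (s 0) x" for k
      by (induction k) (auto simp: d_def)
    then have "(\<lambda>k. z (s k) x) = (\<lambda>k. (\<Sum>i<k. d i x) + z (s 0) x)" by (rule ext)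
    moreover have "convergent (\<lambda>k. (\<Sum>i<k. d i x) + z (s 0) x)"
      by (intro convergent_add convergent_const) (use elim in \<open>simp add: summable_iff_convergent\<close>)
    ultimately show ?case by (rule ssubst[where P = convergent])
  qed
  define w where "w x = lim (\<lambda>k. z (s k) x)" for x
  have [measurable]: "w \<in> borel_measurable borel" unfolding w_def by measurable
  have lim: "AE x in lborel. (\<lambda>k. z (s k) x) \<longlonglongrightarrow> w x"
    using conv by eventually_elim (simp add: w_def convergent_LIMSEQ_iff)
  have est: "z n - w \<in> L2 \<and> nrm2 (z n - w) \<le> \<epsilon>"
    if n0: "\<And>m n. m \<ge> n0 \<Longrightarrow> n \<ge> n0 \<Longrightarrow> nrm2 (z m - z n) \<le> \<epsilon>" and n: "n \<ge> n0" and \<epsilon>: "\<epsilon> > 0" for n n0 \<epsilon>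
  proof -
    have "(\<integral>\<^sup>+x. ennreal ((cmod ((z n - w) x))\<^sup>2) \<partial>lborel)
        = (\<integral>\<^sup>+x. liminf (\<lambda>k. ennreal ((cmod ((z n - z (s k)) x))\<^sup>2)) \<partial>lborel)"
    proof (rule nn_integral_cong_AE)
      show "AE x in lborel. ennreal ((cmod ((z n - w) x))\<^sup>2)
        = liminf (\<lambda>k. ennreal ((cmod ((z n - z (s k)) x))\<^sup>2))"
        using lim
      proof eventually_elim
        case (elim x)
        have "(\<lambda>k. ennreal ((cmod ((z n - z (s k)) x))\<^sup>2)) \<longlonglongrightarrow> ennreal ((cmod ((z n - w) x))\<^sup>2)"
          using elim by (auto intro!: tendsto_intros)
        then show ?case by (rule lim_imp_Liminf[symmetric, rotated]) simp
      qed
    qed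
    also have "\<dots> \<le> liminf (\<lambda>k. \<integral>\<^sup>+x. ennreal ((cmod ((z n - z (s k)) x))\<^sup>2) \<partial>lborel)"
      by (rule nn_integral_liminf) (simp add: fun_diff_def, measurable)
    also have "\<dots> \<le> liminf (\<lambda>k. ennreal (\<epsilon>\<^sup>2))"
    proof (rule Liminf_mono, unfold eventually_sequentially, intro exI[of _ n0] allI impI)
      fix k assume k: "n0 \<le> k"
      have "z n - z (s k) \<in> L2" using z by (intro l2.diff_H)
      moreover have "nrm2 (z n - z (s k)) \<le> \<epsilon>" using n k s_ge[of k] by (intro n0) auto
      ultimately show "(\<integral>\<^sup>+x. ennreal ((cmod ((z n - z (s k)) x))\<^sup>2) \<partial>lborel) \<le> ennreal (\<epsilon>\<^sup>2)"
        using nrm2_nonneg by (simp only: nn_integral_square_L2) (intro ennreal_leI power_mono)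
    qed
    also have "\<dots> = ennreal (\<epsilon>\<^sup>2)" by (simp add: Liminf_const)
    finally have "(\<integral>\<^sup>+x. ennreal ((cmod ((z n - w) x))\<^sup>2) \<partial>lborel) \<le> ennreal (\<epsilon>\<^sup>2)" .
    moreover have "z n - w \<in> borel_measurable borel" by (simp add: fun_diff_def)
    ultimately show ?thesis using nrm2_leI less_imp_le[OF \<epsilon>] by blast
  qed
  show ?thesis
  proof
    obtain n0 where "\<And>m n. m \<ge> n0 \<Longrightarrow> n \<ge> n0 \<Longrightarrow> nrm2 (z m - z n) \<le> 1"
      using Cauchy[of 1] by auto
    then have "z n0 - w \<in> L2" using est[of n0 1 n0] by simp
    then have "z n0 - (z n0 - w) \<in> L2" by (rule l2.diff_H[OF z])
    moreover have "z n0 - (z n0 - w) = w" by (simp add: fun_eq_iff)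
    ultimately show "w \<in> L2" by metis
    show "(\<lambda>n. nrm2 (z n - w)) \<longlonglongrightarrow> 0"
    proof (rule LIMSEQ_I)
      fix r :: real assume "r > 0"
      then obtain n0 where "\<And>m n. m \<ge> n0 \<Longrightarrow> n \<ge> n0 \<Longrightarrow> nrm2 (z m - z n) \<le> r / 2"
        using Cauchy[of "r / 2"] by auto
      then have "nrm2 (z n - w) \<le> r / 2" if "n \<ge> n0" for n
        using est[of n0 "r / 2" n] that \<open>r > 0\<close> by simp
      then show "\<exists>no. \<forall>n\<ge>no. norm (nrm2 (z n - w) - 0) < r"
        using \<open>r > 0\<close> by (intro exI[of _ n0]) (auto simp: nrm2_nonneg intro: le_less_trans[of _ "r / 2"])
    qed
  qed
qed

section \<open>Convolution operators on $L_2$\<close>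

definition conv :: "('a::euclidean_space \<Rightarrow> complex) \<Rightarrow> ('a \<Rightarrow> complex) \<Rightarrow> 'a \<Rightarrow> complex" where
  "conv a u x = (LINT y|lborel. a (x - y) * u y)"

lemma distr_lborel_reflect: "distr lborel borel (\<lambda>y. x - y) = (lborel :: 'a::euclidean_space measure)"
  using lborel_affine[of "-1" x] by (simp add: density_1)

lemma nn_integral_lborel_reflect:
  fixes x :: "'a::euclidean_space"
  assumes [measurable]: "f \<in> borel_measurable borel"
  shows "(\<integral>\<^sup>+y. f (x - y) \<partial>lborel) = (\<integral>\<^sup>+y. f y \<partial>lborel)"
proof -
  have "(\<integral>\<^sup>+y. f y \<partial>lborel) = (\<integral>\<^sup>+y. f y \<partial>distr lborel borel (\<lambda>y. x - y))"
    by (simp only: distr_lborel_reflect)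
  also have "\<dots> = (\<integral>\<^sup>+y. f (x - y) \<partial>lborel)" by (rule nn_integral_distr) measurable
  finally show ?thesis ..
qed

lemma nn_integral_lborel_translate:
  fixes y :: "'a::euclidean_space"
  assumes [measurable]: "f \<in> borel_measurable borel"
  shows "(\<integral>\<^sup>+x. f (x - y) \<partial>lborel) = (\<integral>\<^sup>+x. f x \<partial>lborel)"
proof -
  have "(\<integral>\<^sup>+x. f x \<partial>lborel) = (\<integral>\<^sup>+x. f x \<partial>distr lborel borel (\<lambda>x. - y + x))"
    by (simp only: lborel_distr_plus)
  also have "\<dots> = (\<integral>\<^sup>+x. f (- y + x) \<partial>lborel)" by (rule nn_integral_distr) measurable
  finally show ?thesis by simp
qed

definition norm1 :: "('a::euclidean_space \<Rightarrow> complex) \<Rightarrow> real" where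
  "norm1 a = (LINT x|lborel. cmod (a x))"

lemma norm1_nonneg: "0 \<le> norm1 a"
  by (simp add: norm1_def)

lemma nn_integral_norm1: "integrable lborel a \<Longrightarrow> (\<integral>\<^sup>+x. ennreal (cmod (a x)) \<partial>lborel) = ennreal (norm1 a)"
  unfolding norm1_def by (rule nn_integral_eq_integral) auto

lemma integrable_lborel_measurable [measurable_dest]:
  "integrable lborel f \<Longrightarrow> f \<in> borel_measurable borel"
  using borel_measurable_integrable[of lborel f] by simp

text \<open>Young's inequality: write the kernel as a product of two square roots, apply
  Cauchy-Schwarz in \<open>y\<close>, then Tonelli. Nonnegative integrals are used since the
  existence of the convolution almost everywhere is itself deduced from this bound.\<close>

lemma nn_integral_convolution_kernel:
  fixes a u :: "'a::euclidean_space \<Rightarrow> complex"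
  assumes a [measurable]: "integrable lborel a" and u [measurable]: "u \<in> L2"
  shows "(\<integral>\<^sup>+x. (\<integral>\<^sup>+y. ennreal (cmod (a (x - y) * u y)) \<partial>lborel)\<^sup>2 \<partial>lborel) \<le> ennreal ((norm1 a * nrm2 u)\<^sup>2)"
proof -
  have [measurable]: "u \<in> borel_measurable borel" using u by (rule L2_measurable)
  have "(\<integral>\<^sup>+y. ennreal (cmod (a (x - y) * u y)) \<partial>lborel)\<^sup>2
      \<le> ennreal (norm1 a) * (\<integral>\<^sup>+y. ennreal (cmod (a (x - y)) * (cmod (u y))\<^sup>2) \<partial>lborel)" for x
  proof -
    have "(\<integral>\<^sup>+y. ennreal (cmod (a (x - y) * u y)) \<partial>lborel)\<^sup>2 =
      (\<integral>\<^sup>+y. ennreal (sqrt (cmod (a (x - y)))) * ennreal (sqrt (cmod (a (x - y))) * cmod (u y)) \<partial>lborel)\<^sup>2"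
      by (simp add: ennreal_mult'[symmetric] norm_mult mult.assoc[symmetric])
    also have "\<dots> \<le> (\<integral>\<^sup>+y. (ennreal (sqrt (cmod (a (x - y)))))\<^sup>2 \<partial>lborel)
        * (\<integral>\<^sup>+y. (ennreal (sqrt (cmod (a (x - y))) * cmod (u y)))\<^sup>2 \<partial>lborel)"
      by (rule Cauchy_Schwarz_nn_integral) measurable
    also have "(\<integral>\<^sup>+y. (ennreal (sqrt (cmod (a (x - y)))))\<^sup>2 \<partial>lborel) = (\<integral>\<^sup>+y. ennreal (cmod (a (x - y))) \<partial>lborel)"
      by (simp add: ennreal_power)
    also have "\<dots> = ennreal (norm1 a)"
      using nn_integral_lborel_reflect[of "\<lambda>y. ennreal (cmod (a y))" x] by (simp add: nn_integral_norm1[OF a])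
    finally show ?thesis by (simp add: ennreal_power power_mult_distrib)
  qed
  then have "(\<integral>\<^sup>+x. (\<integral>\<^sup>+y. ennreal (cmod (a (x - y) * u y)) \<partial>lborel)\<^sup>2 \<partial>lborel)
      \<le> (\<integral>\<^sup>+x. ennreal (norm1 a) * (\<integral>\<^sup>+y. ennreal (cmod (a (x - y)) * (cmod (u y))\<^sup>2) \<partial>lborel) \<partial>lborel)"
    by (rule nn_integral_mono)
  also have "\<dots> = ennreal (norm1 a) * (\<integral>\<^sup>+x. (\<integral>\<^sup>+y. ennreal (cmod (a (x - y)) * (cmod (u y))\<^sup>2) \<partial>lborel) \<partial>lborel)"
    by (rule nn_integral_cmult) measurable
  also have "(\<integral>\<^sup>+x. (\<integral>\<^sup>+y. ennreal (cmod (a (x - y)) * (cmod (u y))\<^sup>2) \<partial>lborel) \<partial>lborel)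
      = (\<integral>\<^sup>+y. (\<integral>\<^sup>+x. ennreal (cmod (a (x - y)) * (cmod (u y))\<^sup>2) \<partial>lborel) \<partial>lborel)"
    by (rule lborel_pair.Fubini') measurable
  also have "\<dots> = (\<integral>\<^sup>+y. ennreal (norm1 a) * ennreal ((cmod (u y))\<^sup>2) \<partial>lborel)"
  proof (rule nn_integral_cong)
    fix y
    have "(\<integral>\<^sup>+x. ennreal (cmod (a (x - y)) * (cmod (u y))\<^sup>2) \<partial>lborel)
      = (\<integral>\<^sup>+x. ennreal (cmod (a (x - y))) \<partial>lborel) * ennreal ((cmod (u y))\<^sup>2)"
      by (subst nn_integral_multc[symmetric]) (simp_all add: ennreal_mult)
    then show "(\<integral>\<^sup>+x. ennreal (cmod (a (x - y)) * (cmod (u y))\<^sup>2) \<partial>lborel)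
      = ennreal (norm1 a) * ennreal ((cmod (u y))\<^sup>2)"
      using nn_integral_lborel_translate[of "\<lambda>y. ennreal (cmod (a y))" y] by (simp add: nn_integral_norm1[OF a])
  qed
  also have "\<dots> = ennreal (norm1 a) * (\<integral>\<^sup>+y. ennreal ((cmod (u y))\<^sup>2) \<partial>lborel)"
    by (rule nn_integral_cmult) measurable
  also have "\<dots> = ennreal (norm1 a) * ennreal ((nrm2 u)\<^sup>2)"
    by (simp only: nn_integral_square_L2[OF u])
  also have "ennreal (norm1 a) * (ennreal (norm1 a) * ennreal ((nrm2 u)\<^sup>2)) = ennreal ((norm1 a * nrm2 u)\<^sup>2)"
    by (simp add: ennreal_mult'[symmetric] norm1_nonneg power_mult_distrib power2_eq_square mult_ac)
  finally show ?thesis .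
qed

lemma conv_measurable [measurable]:
  assumes [measurable]: "a \<in> borel_measurable borel" "u \<in> borel_measurable borel"
  shows "conv a u \<in> borel_measurable borel"
  unfolding conv_def[abs_def] by measurable

lemma conv_integrand_integrable:
  assumes a [measurable]: "integrable lborel a" and u [measurable]: "u \<in> L2"
  shows "AE x in lborel. integrable lborel (\<lambda>y. a (x - y) * u y)"
proof -
  have [measurable]: "u \<in> borel_measurable borel" using u by (rule L2_measurable)
  have "AE x in lborel. (\<integral>\<^sup>+y. ennreal (cmod (a (x - y) * u y)) \<partial>lborel)\<^sup>2 \<noteq> \<infinity>"
  proof (rule nn_integral_PInf_AE)
    show "(\<integral>\<^sup>+x. (\<integral>\<^sup>+y. ennreal (cmod (a (x - y) * u y)) \<partial>lborel)\<^sup>2 \<partial>lborel) \<noteq> \<infinity>"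
      using nn_integral_convolution_kernel[OF a u] by (metis ennreal_less_top infinity_ennreal_def leD)
  qed measurable
  then show ?thesis
    by eventually_elim (simp add: integrable_iff_bounded less_top[symmetric] power_eq_top_ennreal)
qed

lemma conv_in_L2:
  assumes a [measurable]: "integrable lborel a" and u [measurable]: "u \<in> L2"
  shows "conv a u \<in> L2" and "nrm2 (conv a u) \<le> norm1 a * nrm2 u"
proof -
  have [measurable]: "u \<in> borel_measurable borel" using u by (rule L2_measurable)
  have ptwise: "ennreal ((cmod (conv a u x))\<^sup>2) \<le> (\<integral>\<^sup>+y. ennreal (cmod (a (x - y) * u y)) \<partial>lborel)\<^sup>2" for x
  proof -
    \<comment> \<open>Where the integrand is not integrable, the integral is 0 by convention and the
      bound is trivial.\<close>
    have "ennreal (cmod (conv a u x)) \<le> (\<integral>\<^sup>+y. ennreal (cmod (a (x - y) * u y)) \<partial>lborel)"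
      unfolding conv_def
      by (cases "integrable lborel (\<lambda>y. a (x - y) * u y)")
        (auto intro: integral_norm_bound_ennreal simp: not_integrable_integral_eq)
    from power_mono[OF this, of 2] show ?thesis by (simp add: ennreal_power)
  qed
  have le: "(\<integral>\<^sup>+x. ennreal ((cmod (conv a u x))\<^sup>2) \<partial>lborel) \<le> ennreal ((norm1 a * nrm2 u)\<^sup>2)"
    by (rule order.trans[OF nn_integral_mono[OF ptwise] nn_integral_convolution_kernel[OF a u]])
  have nonneg: "0 \<le> norm1 a * nrm2 u" by (simp add: norm1_nonneg nrm2_nonneg)
  have meas: "conv a u \<in> borel_measurable borel" by measurable
  show "conv a u \<in> L2" by (rule nrm2_leI[OF le meas nonneg])
  show "nrm2 (conv a u) \<le> norm1 a * nrm2 u" by (rule nrm2_leI[OF le meas nonneg])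
qed

lemma conv_add_AE:
  assumes "integrable lborel a" "u \<in> L2" "v \<in> L2"
  shows "AE x in lborel. conv a (u + v) x = conv a u x + conv a v x"
  using conv_integrand_integrable[OF assms(1,2)] conv_integrand_integrable[OF assms(1,3)]
  by eventually_elim (simp add: conv_def distrib_left)

lemma conv_scale: "conv a (\<lambda>x. c * u x) = (\<lambda>x. c * conv a u x)"
  by (simp add: conv_def fun_eq_iff mult.left_commute)

lemma conv_kernel_diff_AE:
  assumes "integrable lborel a" "integrable lborel b" "u \<in> L2"
  shows "AE x in lborel. conv (\<lambda>x. a x - b x) u x = conv a u x - conv b u x"
  using conv_integrand_integrable[OF assms(1,3)] conv_integrand_integrable[OF assms(2,3)]
  by eventually_elim (simp add: conv_def left_diff_distrib)

text \<open>Cauchy-Schwarz in \<open>x\<close> between the inner absolute integral, square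
  integrable by the kernel estimate, and \<open>v\<close>. This justifies the exchange of integrals
  in \<open>conv_symmetric\<close>.\<close>

lemma conv_form_integrable:
  fixes a u v :: "'a::euclidean_space \<Rightarrow> complex"
  assumes a [measurable]: "integrable lborel a" and u [measurable]: "u \<in> L2" and v [measurable]: "v \<in> L2"
  shows "integrable (lborel \<Otimes>\<^sub>M lborel) (\<lambda>(x, y). a (x - y) * u y * cnj (v x))"
  unfolding integrable_iff_bounded
proof
  have [measurable]: "u \<in> borel_measurable borel" using u by (rule L2_measurable)
  have [measurable]: "v \<in> borel_measurable borel" using v by (rule L2_measurable)
  let ?N = "\<lambda>x. \<integral>\<^sup>+y. ennreal (cmod (a (x - y) * u y)) \<partial>lborel"
  have "(\<integral>\<^sup>+z. ennreal (norm (case z of (x, y) \<Rightarrow> a (x - y) * u y * cnj (v x))) \<partial>(lborel \<Otimes>\<^sub>M lborel))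
    = (\<integral>\<^sup>+x. (\<integral>\<^sup>+y. ennreal (cmod (a (x - y) * u y * cnj (v x))) \<partial>lborel) \<partial>lborel)"
    by (subst lborel.nn_integral_fst[symmetric]) simp_all
  also have "\<dots> = (\<integral>\<^sup>+x. ?N x * ennreal (cmod (v x)) \<partial>lborel)"
    by (intro nn_integral_cong, subst nn_integral_multc[symmetric]) (simp_all add: ennreal_mult norm_mult)
  finally have eq: "(\<integral>\<^sup>+z. ennreal (norm (case z of (x, y) \<Rightarrow> a (x - y) * u y * cnj (v x))) \<partial>(lborel \<Otimes>\<^sub>M lborel))
    = (\<integral>\<^sup>+x. ?N x * ennreal (cmod (v x)) \<partial>lborel)" .
  have "(\<integral>\<^sup>+x. ?N x * ennreal (cmod (v x)) \<partial>lborel)\<^sup>2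
      \<le> (\<integral>\<^sup>+x. (?N x)\<^sup>2 \<partial>lborel) * (\<integral>\<^sup>+x. (ennreal (cmod (v x)))\<^sup>2 \<partial>lborel)"
    by (rule Cauchy_Schwarz_nn_integral) measurable
  also have "\<dots> \<le> ennreal ((norm1 a * nrm2 u)\<^sup>2) * ennreal ((nrm2 v)\<^sup>2)"
    using nn_integral_convolution_kernel[OF a u] nn_integral_square_L2[OF v]
    by (intro mult_mono) (simp_all add: ennreal_power)
  also have "\<dots> < \<infinity>" by (simp add: ennreal_mult_less_top)
  finally show "(\<integral>\<^sup>+z. ennreal (norm (case z of (x, y) \<Rightarrow> a (x - y) * u y * cnj (v x))) \<partial>(lborel \<Otimes>\<^sub>M lborel)) < \<infinity>"
    unfolding eq by (simp add: power_less_top_ennreal)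
  show "(\<lambda>(x, y). a (x - y) * u y * cnj (v x)) \<in> borel_measurable (lborel \<Otimes>\<^sub>M lborel)"
    by measurable
qed

lemma conv_symmetric:
  fixes a u v :: "real ^ 'd \<Rightarrow> complex"
  assumes a [measurable]: "integrable lborel a" and "hermitian_ae a" and u: "u \<in> L2" and v: "v \<in> L2"
  shows "l2ip (conv a u) v = l2ip u (conv a v)"
proof -
  have "l2ip (conv a u) v = (LINT y|lborel. LINT x|lborel. a (x - y) * u y * cnj (v x))"
    using lborel_pair.Fubini_integral[OF conv_form_integrable[OF a u v]]
    by (simp add: l2ip_def conv_def)
  also have "\<dots> = (LINT y|lborel. u y * (LINT x|lborel. a (x - y) * cnj (v x)))"
    by (simp add: mult.assoc mult.left_commute)
  also have "\<dots> = (LINT y|lborel. u y * cnj (conv a v y))"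
  proof (intro Bochner_Integration.integral_cong refl arg_cong2[where f = "(*)"])
    fix y
    have "AE x in lborel. a (- x) = cnj (a x)" using assms(2) by (simp add: hermitian_ae_def)
    \<comment> \<open>The Hermitian relation holds only almost everywhere; as reflection about
      \<open>y\<close> preserves the measure, for each fixed \<open>y\<close> it holds at
      \<open>y - x\<close> for almost every \<open>x\<close>.\<close>
    then have "AE x in distr lborel borel (\<lambda>x. y - x). a (- x) = cnj (a x)"
      by (simp only: distr_lborel_reflect)
    then have ae: "AE x in lborel. a (x - y) = cnj (a (y - x))"
      by (subst (asm) AE_distr_iff) auto
    have [measurable]: "v \<in> borel_measurable borel" using v by (rule L2_measurable)
    have "(LINT x|lborel. a (x - y) * cnj (v x)) = (LINT x|lborel. cnj (a (y - x) * v x))"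
      by (rule integral_cong_AE) (use ae in auto)
    also have "\<dots> = cnj (conv a v y)"
      unfolding conv_def by (rule Bochner_Integration.integral_cnj)
    finally show "(LINT x|lborel. a (x - y) * cnj (v x)) = cnj (conv a v y)" .
  qed
  finally show ?thesis by (simp add: l2ip_def)
qed

lemma bounded_op_conv:
  assumes "integrable lborel a"
  shows "l2.bounded_op (conv a)"
  unfolding l2.bounded_op_def
proof (intro conjI ballI allI exI)
  fix u v w :: "'a \<Rightarrow> complex" assume "u \<in> L2" "v \<in> L2" "w \<in> L2"
  then show "l2ip (conv a (u + v)) w = l2ip (conv a u) w + l2ip (conv a v) w"
    using l2ip_cong_AE[of "conv a (u + v)" "conv a u + conv a v" w] conv_add_AE[OF assms, of u v]
    by (simp add: conv_in_L2[OF assms] l2.ip_add)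
next
  fix c and u w :: "'a \<Rightarrow> complex" assume "u \<in> L2" "w \<in> L2"
  then show "l2ip (conv a (\<lambda>x. c * u x)) w = c * l2ip (conv a u) w"
    unfolding conv_scale by (intro l2.ip_scale conv_in_L2[OF assms])
qed (use conv_in_L2[OF assms] in auto)

lemma mult_in_L2:
  assumes [measurable]: "g \<in> borel_measurable borel" and g: "\<And>x. cmod (g x) \<le> C" and u [measurable]: "u \<in> L2"
  shows "(\<lambda>x. g x * u x) \<in> L2" and "nrm2 (\<lambda>x. g x * u x) \<le> C * nrm2 u"
proof -
  have C: "0 \<le> C" using g[of 0] norm_ge_zero order_trans by blast
  have "(\<integral>\<^sup>+x. ennreal ((cmod (g x * u x))\<^sup>2) \<partial>lborel) \<le> (\<integral>\<^sup>+x. ennreal (C\<^sup>2) * ennreal ((cmod (u x))\<^sup>2) \<partial>lborel)"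
    using g by (intro nn_integral_mono)
      (auto simp: ennreal_mult'[symmetric] norm_mult power_mult_distrib intro!: ennreal_leI mult_right_mono power_mono)
  also have "\<dots> = ennreal (C\<^sup>2) * (\<integral>\<^sup>+x. ennreal ((cmod (u x))\<^sup>2) \<partial>lborel)"
    by (rule nn_integral_cmult) measurable
  also have "\<dots> = ennreal ((C * nrm2 u)\<^sup>2)"
    by (simp only: nn_integral_square_L2[OF u] power_mult_distrib) (simp add: ennreal_mult')
  finally have le: "(\<integral>\<^sup>+x. ennreal ((cmod (g x * u x))\<^sup>2) \<partial>lborel) \<le> ennreal ((C * nrm2 u)\<^sup>2)" .
  have meas: "(\<lambda>x. g x * u x) \<in> borel_measurable borel" by measurable
  have nonneg: "0 \<le> C * nrm2 u" using C by (simp add: nrm2_nonneg)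
  show "(\<lambda>x. g x * u x) \<in> L2" by (rule nrm2_leI[OF le meas nonneg])
  show "nrm2 (\<lambda>x. g x * u x) \<le> C * nrm2 u" by (rule nrm2_leI[OF le meas nonneg])
qed

lemma bounded_op_mult:
  assumes "g \<in> borel_measurable borel" "\<And>x. cmod (g x) \<le> C"
  shows "l2.bounded_op (\<lambda>u x. g x * u x)"
  unfolding l2.bounded_op_def
proof (intro conjI ballI allI exI)
  fix u v w :: "'a \<Rightarrow> complex" assume "u \<in> L2" "v \<in> L2" "w \<in> L2"
  moreover have "(\<lambda>x. g x * (u + v) x) = (\<lambda>x. g x * u x) + (\<lambda>x. g x * v x)"
    by (simp add: fun_eq_iff distrib_left)
  ultimately show "l2ip (\<lambda>x. g x * (u + v) x) w = l2ip (\<lambda>x. g x * u x) w + l2ip (\<lambda>x. g x * v x) w"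
    by (simp add: mult_in_L2[OF assms] l2.ip_add del: plus_fun_apply)
next
  fix c and u w :: "'a \<Rightarrow> complex" assume "u \<in> L2" "w \<in> L2"
  then show "l2ip (\<lambda>x. g x * (c * u x)) w = c * l2ip (\<lambda>x. g x * u x) w"
    by (simp add: l2ip_def mult.assoc mult.left_commute)
qed (use mult_in_L2[OF assms] in auto)

lemma mult_symmetric:
  assumes "\<And>x. g x \<in> \<real>"
  shows "l2ip (\<lambda>x. g x * u x) v = l2ip u (\<lambda>x. g x * v x)"
  using assms by (simp add: l2ip_def Reals_cnj_iff mult.assoc mult.left_commute)

section \<open>Approximation by continuous functions of compact support\<close>

definition cpt_cont :: "('a::euclidean_space \<Rightarrow> complex) \<Rightarrow> bool" where
  "cpt_cont f \<longleftrightarrow> continuous_on UNIV f \<and> (\<exists>R. \<forall>x. norm x > R \<longrightarrow> f x = 0)"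

lemma cpt_cont_measurable [measurable_dest]: "cpt_cont f \<Longrightarrow> f \<in> borel_measurable borel"
  by (simp add: cpt_cont_def borel_measurable_continuous_onI)

lemma integrable_indicator_cball [intro]:
  "integrable lborel (indicator (cball (c::'a::euclidean_space) R) :: 'a \<Rightarrow> real)"
  using emeasure_lborel_cball_finite[of c R] by (intro integrable_real_indicator) auto

text \<open>Lebesgue measurability, in the form of \<open>measurable_on\<close>, already means
  convergence of continuous functions off a negligible set. These approximants are neither bounded
  nor compactly supported, which the next lemma repairs.\<close>

lemma AE_lborel_measurable_on_limit:
  fixes f :: "'a::euclidean_space \<Rightarrow> complex"
  assumes "f \<in> borel_measurable borel"
  obtains g where "\<And>n::nat. continuous_on UNIV (g n)" "AE x in lborel. (\<lambda>n. g n x) \<longlonglongrightarrow> f x"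
proof -
  have "f \<in> borel_measurable (lebesgue_on UNIV)"
    using assms by (auto simp: lebesgue_on_UNIV_eq intro!: measurable_completion)
  then have "f measurable_on UNIV"
    by (simp add: measurable_on_iff_borel_measurable)
  then obtain N g where N: "negligible N" and g: "\<And>n. continuous_on UNIV (g n)"
    and lim: "\<And>x. x \<notin> N \<Longrightarrow> (\<lambda>n. g n x) \<longlonglongrightarrow> f x"
    unfolding measurable_on_def by auto
  have "AE x in lebesgue. x \<notin> N"
    using N by (intro AE_not_in) (simp add: negligible_iff_null_sets)
  then have "AE x in lborel. x \<notin> N" by (simp add: AE_completion_iff)
  then have "AE x in lborel. (\<lambda>n. g n x) \<longlonglongrightarrow> f x"
    by eventually_elim (rule lim)
  with g that show thesis by blast
qed

lemma bounded_support_approx: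
  fixes f :: "'a::euclidean_space \<Rightarrow> complex"
  assumes f: "f \<in> borel_measurable borel" "\<And>x. cmod (f x) \<le> M" "\<And>x. norm x > R \<Longrightarrow> f x = 0"
    and M: "M > 0"
  obtains \<phi> where "\<And>n::nat. cpt_cont (\<phi> n)" "\<And>n x. cmod (\<phi> n x) \<le> M"
    "\<And>n x. norm x > R + 1 \<Longrightarrow> \<phi> n x = 0" "AE x in lborel. (\<lambda>n. \<phi> n x) \<longlonglongrightarrow> f x"
proof -
  obtain g where g: "\<And>n::nat. continuous_on UNIV (g n)" and lim: "AE x in lborel. (\<lambda>n. g n x) \<longlonglongrightarrow> f x"
    using AE_lborel_measurable_on_limit[OF f(1)] by blast
  \<comment> \<open>\<open>clip\<close> is the radial retraction onto the disc of radius
    \<open>M\<close>, and the cutoff \<open>cut\<close> is 1 on the ball of radius \<open>R\<close>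
    and 0 beyond \<open>R + 1\<close>. Neither changes \<open>f\<close>, so the convergence
    survives.\<close>
  define clip where "clip z = z / of_real (max 1 (cmod z / M))" for z
  define cut where "cut x = max 0 (min 1 (R + 1 - norm x))" for x :: 'a
  define \<phi> where "\<phi> n x = of_real (cut x) * clip (g n x)" for n x
  have cut01: "0 \<le> cut x" "cut x \<le> 1" for x by (auto simp: cut_def)
  have clip_cont: "continuous_on UNIV clip"
    unfolding clip_def using M by (intro continuous_intros) (auto simp: max_def)
  have clip_le: "cmod (clip z) \<le> M" for z
    using M by (auto simp: clip_def norm_divide max_def field_simps)
  have clip_id: "clip z = z" if "cmod z \<le> M" for z
    using that M by (simp add: clip_def max_def field_simps)
  have "cpt_cont (\<phi> n)" for n
    unfolding cpt_cont_def
  proof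
    have "continuous_on UNIV (\<lambda>x. clip (g n x))"
      using continuous_on_compose2[OF clip_cont g[of n]] by simp
    then show "continuous_on UNIV (\<phi> n)"
      unfolding \<phi>_def cut_def by (intro continuous_intros)
    show "\<exists>R. \<forall>x. R < norm x \<longrightarrow> \<phi> n x = 0"
      by (intro exI[of _ "R + 1"]) (simp add: \<phi>_def cut_def)
  qed
  moreover have "cmod (\<phi> n x) \<le> M" for n x
    using mult_mono[OF cut01(2)[of x] clip_le[of "g n x"]] cut01 M by (simp add: \<phi>_def norm_mult)
  moreover have "\<phi> n x = 0" if "norm x > R + 1" for n x
    using that by (simp add: \<phi>_def cut_def)
  moreover have "AE x in lborel. (\<lambda>n. \<phi> n x) \<longlonglongrightarrow> f x"
    using lim
  proof eventually_elim
    case (elim x)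
    have "isCont clip (f x)"
      using clip_cont by (simp add: continuous_on_eq_continuous_at)
    then have "(\<lambda>n. clip (g n x)) \<longlonglongrightarrow> clip (f x)"
      using elim by (rule isCont_tendsto_compose)
    then have "(\<lambda>n. \<phi> n x) \<longlonglongrightarrow> of_real (cut x) * f x"
      unfolding \<phi>_def clip_id[OF f(2)] by (intro tendsto_intros)
    moreover have "of_real (cut x) * f x = f x"
      using f(3)[of x] by (cases "norm x > R") (auto simp: cut_def)
    ultimately show ?case by simp
  qed
  ultimately show thesis using that by blast
qed

lemma power_add_le:
  fixes x y :: real
  assumes "0 \<le> x" "0 \<le> y"
  shows "(x + y) ^ p \<le> 2 ^ p * (x ^ p + y ^ p)"
proof -
  have "(x + y) ^ p \<le> (2 * max x y) ^ p" using assms by (intro power_mono) auto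
  also have "\<dots> = 2 ^ p * (max x y) ^ p" by (rule power_mult_distrib)
  also have "(max x y) ^ p \<le> x ^ p + y ^ p" using assms by (auto simp: max_def)
  finally show ?thesis by simp
qed

text \<open>Truncate domain and values, then approximate the truncation by continuous functions
  under a common bound; both limits are dominated convergence. The exponent covers \<open>L1\<close>
  and \<open>L2\<close> at once.\<close>

lemma cpt_cont_dense:
  fixes f :: "'a::euclidean_space \<Rightarrow> complex"
  assumes f [measurable]: "f \<in> borel_measurable borel" and int: "integrable lborel (\<lambda>x. cmod (f x) ^ p)"
    and p: "p > 0" and \<epsilon>: "\<epsilon> > 0"
  obtains b where "cpt_cont b" "integrable lborel (\<lambda>x. cmod (f x - b x) ^ p)"
    "(LINT x|lborel. cmod (f x - b x) ^ p) < \<epsilon>"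
proof -
  \<comment> \<open>The factor \<open>2 ^ p\<close> comes from \<open>power_add_le\<close>; two
    errors below \<open>\<eta>\<close> then contribute less than
    \<open>2 * \<epsilon> / 3\<close>.\<close>
  define \<eta> where "\<eta> = \<epsilon> / (2 ^ p * 3)"
  have \<eta>: "\<eta> > 0" using \<epsilon> by (simp add: \<eta>_def)
  define t where "t k x = (if norm x \<le> real k \<and> cmod (f x) \<le> real k then f x else 0)" for k x
  have t_meas [measurable]: "t k \<in> borel_measurable borel" for k
    unfolding t_def by measurable
  have "(\<lambda>k. LINT x|lborel. cmod (f x - t k x) ^ p) \<longlonglongrightarrow> (LINT x::'a|lborel. (0::real))"
  proof (rule integral_dominated_convergence[where w = "\<lambda>x. cmod (f x) ^ p"])
    show "AE x in lborel. (\<lambda>k. cmod (f x - t k x) ^ p) \<longlonglongrightarrow> 0"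
    proof (rule AE_I2)
      fix x
      obtain K where K: "norm x \<le> real K" "cmod (f x) \<le> real K"
        by (meson linear order_trans real_arch_simple)
      have "\<forall>\<^sub>F k in sequentially. cmod (f x - t k x) ^ p = 0"
        unfolding eventually_sequentially
      proof (intro exI allI impI)
        fix k assume "K \<le> k"
        then have "real K \<le> real k" by simp
        then show "cmod (f x - t k x) ^ p = 0" using K p by (auto simp: t_def)
      qed
      then show "(\<lambda>k. cmod (f x - t k x) ^ p) \<longlonglongrightarrow> 0" by (rule tendsto_eventually)
    qed
    show "AE x in lborel. norm (cmod (f x - t k x) ^ p) \<le> cmod (f x) ^ p" for k
      by (rule AE_I2) (use p in \<open>auto simp: t_def\<close>)
    show "integrable lborel (\<lambda>x. cmod (f x) ^ p)" by (rule int)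
  qed measurable
  then have "\<forall>\<^sub>F k in sequentially. (LINT x|lborel. cmod (f x - t k x) ^ p) < \<eta>"
    using \<eta> by (intro order_tendstoD(2)) auto
  then obtain k0 where k0: "\<And>k. k \<ge> k0 \<Longrightarrow> (LINT x|lborel. cmod (f x - t k x) ^ p) < \<eta>"
    by (auto simp: eventually_sequentially)
  \<comment> \<open>A successor, because the bound \<open>M\<close> in
    \<open>bounded_support_approx\<close> has to be positive.\<close>
  define k where "k = Suc k0"
  have k: "(LINT x|lborel. cmod (f x - t k x) ^ p) < \<eta>" using k0 by (simp add: k_def)
  have t_int: "integrable lborel (\<lambda>x. cmod (f x - t k x) ^ p)"
    by (rule Bochner_Integration.integrable_bound[OF int]) (measurable, use p in \<open>auto simp: t_def\<close>)
  obtain \<phi> where \<phi>: "\<And>n::nat. cpt_cont (\<phi> n)" "\<And>n x. cmod (\<phi> n x) \<le> real k"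
    "\<And>n x. norm x > real k + 1 \<Longrightarrow> \<phi> n x = 0" "AE x in lborel. (\<lambda>n. \<phi> n x) \<longlonglongrightarrow> t k x"
  proof (rule bounded_support_approx[of "t k" "real k" "real k"])
    show "cmod (t k x) \<le> real k" for x by (simp add: t_def)
    show "t k x = 0" if "real k < norm x" for x using that by (simp add: t_def)
  qed (auto simp: k_def)
  have [measurable]: "\<phi> n \<in> borel_measurable borel" for n using \<phi>(1) by (rule cpt_cont_measurable)
  let ?w = "\<lambda>x. (2 * real k) ^ p * indicator (cball (0::'a) (real k + 1)) x"
  have w: "integrable lborel ?w" by auto
  have bound: "cmod (t k x - \<phi> n x) ^ p \<le> ?w x" for n x
  proof (cases "norm x \<le> real k + 1")
    case True
    have "cmod (t k x) \<le> real k" by (simp add: t_def)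
    then have "cmod (t k x - \<phi> n x) \<le> 2 * real k"
      using norm_triangle_ineq4[of "t k x" "\<phi> n x"] \<phi>(2)[of n x] by simp
    from power_mono[OF this, of p] show ?thesis using True by (simp add: power_mult_distrib)
  next
    case False
    then show ?thesis using \<phi>(3)[of x n] p by (simp add: t_def zero_power)
  qed
  have "(\<lambda>n. LINT x|lborel. cmod (t k x - \<phi> n x) ^ p) \<longlonglongrightarrow> (LINT x::'a|lborel. (0::real))"
  proof (rule integral_dominated_convergence[where w = ?w])
    show "AE x in lborel. (\<lambda>n. cmod (t k x - \<phi> n x) ^ p) \<longlonglongrightarrow> 0"
      using \<phi>(4)
    proof eventually_elim
      case (elim x)
      have "(\<lambda>n. cmod (t k x - \<phi> n x) ^ p) \<longlonglongrightarrow> cmod (t k x - t k x) ^ p"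
        using elim by (intro tendsto_intros)
      then show ?case using p by (simp only: diff_self norm_zero zero_power)
    qed
    show "AE x in lborel. norm (cmod (t k x - \<phi> n x) ^ p) \<le> ?w x" for n
      using bound by simp
    show "integrable lborel ?w" by (rule w)
  qed measurable
  then have "\<forall>\<^sub>F n in sequentially. (LINT x|lborel. cmod (t k x - \<phi> n x) ^ p) < \<eta>"
    using \<eta> by (intro order_tendstoD(2)) auto
  then obtain n where n: "(LINT x|lborel. cmod (t k x - \<phi> n x) ^ p) < \<eta>"
    by (auto simp: eventually_sequentially)
  have \<phi>_int: "integrable lborel (\<lambda>x. cmod (t k x - \<phi> n x) ^ p)"
    by (rule Bochner_Integration.integrable_bound[OF w]) (measurable, use bound in auto)
  let ?s = "\<lambda>x. 2 ^ p * (cmod (f x - t k x) ^ p + cmod (t k x - \<phi> n x) ^ p)"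
  have s_int: "integrable lborel ?s" using t_int \<phi>_int by auto
  have le: "cmod (f x - \<phi> n x) ^ p \<le> ?s x" for x
  proof -
    have "cmod (f x - \<phi> n x) \<le> cmod (f x - t k x) + cmod (t k x - \<phi> n x)"
      using norm_triangle_ineq[of "f x - t k x" "t k x - \<phi> n x"] by simp
    then have "cmod (f x - \<phi> n x) ^ p \<le> (cmod (f x - t k x) + cmod (t k x - \<phi> n x)) ^ p"
      by (intro power_mono) auto
    also have "\<dots> \<le> ?s x" by (rule power_add_le) auto
    finally show ?thesis .
  qed
  have int': "integrable lborel (\<lambda>x. cmod (f x - \<phi> n x) ^ p)"
    by (rule Bochner_Integration.integrable_bound[OF s_int]) (measurable, use le in auto)
  have "(LINT x|lborel. cmod (f x - \<phi> n x) ^ p) \<le> (LINT x|lborel. ?s x)"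
    by (rule integral_mono[OF int' s_int le])
  also have "\<dots> = 2 ^ p * ((LINT x|lborel. cmod (f x - t k x) ^ p) + (LINT x|lborel. cmod (t k x - \<phi> n x) ^ p))"
    using t_int \<phi>_int by simp
  also have "\<dots> < 2 ^ p * (\<eta> + \<eta>)" using k n by simp
  also have "\<dots> < \<epsilon>" using \<epsilon> by (simp add: \<eta>_def)
  finally show thesis using that[OF \<phi>(1) int'] by blast
qed

lemma cpt_cont_uniform:
  fixes f :: "'a::euclidean_space \<Rightarrow> complex"
  assumes f: "cpt_cont f" and \<epsilon>: "\<epsilon> > 0"
  obtains \<delta> where "\<delta> > 0" "\<And>x y. dist x y < \<delta> \<Longrightarrow> cmod (f x - f y) < \<epsilon>"
proof -
  obtain R where cont: "continuous_on UNIV f" and R: "\<And>x. norm x > R \<Longrightarrow> f x = 0"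
    using f by (auto simp: cpt_cont_def)
  have "uniformly_continuous_on (cball 0 (R + 1)) f"
    by (intro compact_uniformly_continuous continuous_on_subset[OF cont]) auto
  then obtain d where d: "d > 0"
    "\<And>x y. x \<in> cball 0 (R + 1) \<Longrightarrow> y \<in> cball 0 (R + 1) \<Longrightarrow> dist y x < d \<Longrightarrow> dist (f y) (f x) < \<epsilon>"
    using \<epsilon> unfolding uniformly_continuous_on_def by meson
  \<comment> \<open>At distance below 1, if one point leaves the ball of radius
    \<open>R + 1\<close>, then both lie beyond \<open>R\<close>, where \<open>f\<close>
    vanishes.\<close>
  have "cmod (f x - f y) < \<epsilon>" if xy: "dist x y < min d 1" for x y
  proof (cases "norm x \<le> R + 1 \<and> norm y \<le> R + 1")
    case True
    then show ?thesis using d(2)[of y x] xy by (simp add: dist_norm)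
  next
    case False
    have "norm x \<le> norm y + dist x y" "norm y \<le> norm x + dist x y"
      using norm_triangle_sub[of x y] norm_triangle_sub[of y x] by (simp_all add: dist_norm norm_minus_commute)
    then have "norm x > R" "norm y > R" using False xy by auto
    then show ?thesis using R \<epsilon> by simp
  qed
  with d(1) that show thesis by (metis min_less_iff_conj zero_less_one)
qed

lemma cpt_cont_bounded:
  fixes f :: "'a::euclidean_space \<Rightarrow> complex"
  assumes f: "cpt_cont f"
  obtains M where "M > 0" "\<And>x. cmod (f x) \<le> M"
proof -
  obtain R where cont: "continuous_on UNIV f" and R: "\<And>x. norm x > R \<Longrightarrow> f x = 0"
    using f by (auto simp: cpt_cont_def)
  have "bounded (f ` cball 0 R)"
    by (intro compact_imp_bounded compact_continuous_image continuous_on_subset[OF cont]) auto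
  then obtain B where B: "B > 0" "\<And>x. x \<in> cball 0 R \<Longrightarrow> cmod (f x) \<le> B"
    by (auto simp: bounded_pos)
  have "cmod (f x) \<le> B" for x
    using B R[of x] by (cases "norm x \<le> R") auto
  with B that show thesis by blast
qed

lemma integrable_bounded_support:
  fixes f :: "'a::euclidean_space \<Rightarrow> 'b::{banach,second_countable_topology}"
  assumes "f \<in> borel_measurable borel" "\<And>x. norm (f x) \<le> M" "\<And>x. norm x > R \<Longrightarrow> f x = 0"
  shows "integrable lborel f"
proof (rule Bochner_Integration.integrable_bound)
  show "integrable lborel (\<lambda>x::'a. M * indicator (cball 0 R) x)" by auto
  have "norm (f x) \<le> norm (M * indicator (cball 0 R) x)" for x
    using assms(2)[of x] assms(3)[of x] by (cases "norm x \<le> R") auto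
  then show "AE x in lborel. norm (f x) \<le> norm (M * indicator (cball 0 R) x)" by simp
qed (use assms in auto)

lemma L2_bounded_support:
  fixes f :: "'a::euclidean_space \<Rightarrow> complex"
  assumes "f \<in> borel_measurable borel" "\<And>x. cmod (f x) \<le> M" "\<And>x. norm x > R \<Longrightarrow> f x = 0"
  shows "f \<in> L2"
  unfolding L2_def
proof (clarsimp, intro conjI)
  show "integrable lborel (\<lambda>x. (cmod (f x))\<^sup>2)"
    by (rule integrable_bounded_support[where M = "M\<^sup>2" and R = R])
      (use assms in \<open>auto intro!: power_mono\<close>)
qed (rule assms(1))

lemma cpt_cont_integrable: "cpt_cont f \<Longrightarrow> integrable lborel f"
  by (metis cpt_cont_bounded cpt_cont_def cpt_cont_measurable integrable_bounded_support)

lemma cpt_cont_L2: "cpt_cont f \<Longrightarrow> f \<in> L2"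
  by (metis cpt_cont_bounded cpt_cont_def cpt_cont_measurable L2_bounded_support)

lemma cpt_cont_dense_L1:
  assumes "integrable lborel a" "\<epsilon> > 0"
  obtains b where "cpt_cont b" "norm1 (\<lambda>x. a x - b x) < \<epsilon>"
  using cpt_cont_dense[of a 1 \<epsilon>] assms by (auto simp: norm1_def)

lemma cpt_cont_dense_L2:
  assumes u: "u \<in> L2" and \<epsilon>: "\<epsilon> > 0"
  obtains b where "cpt_cont b" "nrm2 (u - b) < \<epsilon>"
proof -
  obtain b where b: "cpt_cont b" "(LINT x|lborel. (cmod (u x - b x))\<^sup>2) < \<epsilon>\<^sup>2"
    using cpt_cont_dense[of u 2 "\<epsilon>\<^sup>2"] L2_measurable[OF u] L2_integrable[OF u] \<epsilon> by auto
  have "(nrm2 (u - b))\<^sup>2 < \<epsilon>\<^sup>2" using b(2) by (simp add: nrm2_square)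
  then have "nrm2 (u - b) < \<epsilon>" using \<epsilon> by (simp add: power2_less_imp_less)
  with b(1) that show thesis by blast
qed

lemma LINT_norm_le:
  fixes f :: "'a \<Rightarrow> 'b::{banach,second_countable_topology}" and g :: "'a \<Rightarrow> real"
  assumes "f \<in> borel_measurable M" "integrable M g" "\<And>x. norm (f x) \<le> g x"
  shows "norm (integral\<^sup>L M f) \<le> integral\<^sup>L M g"
proof -
  have "integrable M (\<lambda>x. norm (f x))"
    by (rule Bochner_Integration.integrable_bound[OF assms(2)])
      (use assms(1) in \<open>auto intro!: AE_I2 order.trans[OF assms(3) abs_ge_self]\<close>)
  then have "integral\<^sup>L M (\<lambda>x. norm (f x)) \<le> integral\<^sup>L M g"
    using assms by (intro integral_mono) auto
  then show ?thesis using integral_norm_bound[of M f] by linarith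
qed

section \<open>Fourier transforms of integrable functions\<close>

lemma norm_exp_i_real [simp]: "cmod (exp (- (\<i> * complex_of_real t))) = 1"
  by (simp add: norm_exp_eq_Re)

lemma exp_i_inner_measurable [measurable]:
  "(\<lambda>\<xi>. exp (- (\<i> * complex_of_real (x \<bullet> \<xi>)))) \<in> borel_measurable borel"
  "(\<lambda>\<xi>. exp (- (\<i> * complex_of_real (\<xi> \<bullet> x)))) \<in> borel_measurable borel"
  by (intro borel_measurable_continuous_onI continuous_intros)+

lemma fourier_integrable:
  assumes "integrable lborel u"
  shows "integrable lborel (\<lambda>\<xi>. u \<xi> * exp (- (\<i> * complex_of_real (x \<bullet> \<xi>))))"
proof -
  have [measurable]: "u \<in> borel_measurable borel" using assms by (rule integrable_lborel_measurable)
  show ?thesis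
    by (rule Bochner_Integration.integrable_bound[OF assms]) (simp_all add: norm_mult)
qed

lemma fourier_diff_le:
  fixes u v :: "real ^ 'd \<Rightarrow> complex"
  assumes "integrable lborel u" "integrable lborel v"
  shows "cmod (fourier u x - fourier v x) \<le> norm1 (\<lambda>\<xi>. u \<xi> - v \<xi>)"
proof -
  have "fourier u x - fourier v x = fourier (\<lambda>\<xi>. u \<xi> - v \<xi>) x"
    unfolding fourier_def left_diff_distrib
    by (rule Bochner_Integration.integral_diff[symmetric]) (rule fourier_integrable assms)+
  then show ?thesis using norm_fourier_le[of "\<lambda>\<xi>. u \<xi> - v \<xi>" x] by (simp add: norm1_def)
qed

lemma fourier_continuous:
  fixes u :: "real ^ 'd \<Rightarrow> complex"
  assumes u: "integrable lborel u"
  shows "continuous_on UNIV (fourier u)"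
  unfolding continuous_on_sequentially
proof (intro ballI allI impI)
  fix X :: "nat \<Rightarrow> real ^ 'd" and x assume "(\<forall>n. X n \<in> UNIV) \<and> X \<longlonglongrightarrow> x"
  then have X: "X \<longlonglongrightarrow> x" by simp
  have [measurable]: "u \<in> borel_measurable borel" using u by (rule integrable_lborel_measurable)
  show "(fourier u \<circ> X) \<longlonglongrightarrow> fourier u x"
    unfolding o_def fourier_def
  proof (rule integral_dominated_convergence[where w = "\<lambda>\<xi>. cmod (u \<xi>)"])
    show "AE \<xi> in lborel. (\<lambda>n. u \<xi> * exp (- (\<i> * complex_of_real (X n \<bullet> \<xi>))))
        \<longlonglongrightarrow> u \<xi> * exp (- (\<i> * complex_of_real (x \<bullet> \<xi>)))"
      by (rule AE_I2) (intro tendsto_intros X)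
  qed (use u in \<open>auto simp: norm_mult\<close>)
qed

lemma LINT_lborel_translate:
  fixes f :: "'a::euclidean_space \<Rightarrow> 'b::{banach,second_countable_topology}"
  assumes [measurable]: "f \<in> borel_measurable borel"
  shows "(LINT x|lborel. f (x + s)) = (LINT x|lborel. f x)"
proof -
  have "(LINT x|lborel. f x) = (LINT x|distr lborel borel (\<lambda>x. s + x). f x)"
    by (simp only: lborel_distr_plus)
  also have "\<dots> = (LINT x|lborel. f (s + x))"
    by (rule integral_distr) measurable
  finally show ?thesis by (simp add: add.commute)
qed

text \<open>Shifting the integration variable by \<open>s = \<pi> x / \<bar>x\<bar>\<^sup>2\<close> changes the sign of the exponential.\<close>

lemma fourier_half_period_shift:
  fixes f :: "real ^ 'd \<Rightarrow> complex"
  assumes f: "integrable lborel f" and x: "x \<noteq> 0"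
  defines "s \<equiv> (pi / (norm x)\<^sup>2) *\<^sub>R x"
  shows "2 * fourier f x = (LINT \<xi>|lborel. (f \<xi> - f (\<xi> + s)) * exp (- (\<i> * complex_of_real (x \<bullet> \<xi>))))"
proof -
  have [measurable]: "f \<in> borel_measurable borel" using f by (rule integrable_lborel_measurable)
  let ?E = "\<lambda>\<xi>. exp (- (\<i> * complex_of_real (x \<bullet> \<xi>)))"
  have xs: "x \<bullet> s = pi" using x by (simp add: s_def power2_norm_eq_inner)
  have E: "?E (\<xi> + s) = - ?E \<xi>" for \<xi>
    by (simp add: inner_add_right xs distrib_left exp_diff exp_pi_i' exp_minus)
  have "fourier f x = (LINT \<xi>|lborel. f (\<xi> + s) * ?E (\<xi> + s))"
    unfolding fourier_def by (rule LINT_lborel_translate[symmetric]) measurable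
  also have "\<dots> = (LINT \<xi>|lborel. - (f (\<xi> + s) * ?E \<xi>))" unfolding E by simp
  also have "\<dots> = - (LINT \<xi>|lborel. f (\<xi> + s) * ?E \<xi>)" by simp
  finally have shifted: "fourier f x = - (LINT \<xi>|lborel. f (\<xi> + s) * ?E \<xi>)" .
  have "integrable (distr lborel borel (\<lambda>x. s + x)) f" using f by (simp add: lborel_distr_plus)
  then have "integrable lborel (\<lambda>\<xi>. f (s + \<xi>))"
    by (subst (asm) integrable_distr_eq) auto
  then have "integrable lborel (\<lambda>\<xi>. f (\<xi> + s))" by (simp add: add.commute)
  then have "(LINT \<xi>|lborel. (f \<xi> - f (\<xi> + s)) * ?E \<xi>) = fourier f x - (LINT \<xi>|lborel. f (\<xi> + s) * ?E \<xi>)"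
    unfolding fourier_def left_diff_distrib
    by (intro Bochner_Integration.integral_diff fourier_integrable f)
  then show ?thesis using shifted by simp
qed

text \<open>By density a compactly supported continuous \<open>f\<close> may be considered; the
  half-period shift has length \<open>pi / norm x\<close>, so uniform continuity makes the shifted
  difference small. Applied to \<open>Vhat\<close>, this gives the decay of \<open>V\<close> on
  which compactness rests.\<close>

theorem Riemann_Lebesgue:
  fixes u :: "real ^ 'd \<Rightarrow> complex"
  assumes u: "integrable lborel u" and \<epsilon>: "\<epsilon> > 0"
  obtains R where "R > 0" "\<And>x. norm x > R \<Longrightarrow> cmod (fourier u x) < \<epsilon>"
proof -
  have "\<epsilon> / 2 > 0" using \<epsilon> by simp
  obtain f where f: "cpt_cont f" and uf: "norm1 (\<lambda>\<xi>. u \<xi> - f \<xi>) < \<epsilon> / 2"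
    using cpt_cont_dense_L1[OF u \<open>\<epsilon> / 2 > 0\<close>] by blast
  note fint = cpt_cont_integrable[OF f]
  have [measurable]: "f \<in> borel_measurable borel" using f by (rule cpt_cont_measurable)
  obtain B where B: "\<And>x. norm x > B \<Longrightarrow> f x = 0" using f by (auto simp: cpt_cont_def)
  \<comment> \<open>The volume of a ball that contains the support of \<open>f\<close> and, as the
    shift will be shorter than 1, also that of the translate.\<close>
  define C where "C = (LINT \<xi>::real^'d|lborel. indicator (cball 0 (B + 1)) \<xi> :: real)"
  have C: "C \<ge> 0" by (simp add: C_def)
  define \<eta> where "\<eta> = \<epsilon> / (C + 1)"
  have \<eta>: "\<eta> > 0" using \<epsilon> C by (simp add: \<eta>_def)
  obtain \<delta> where \<delta>: "\<delta> > 0" "\<And>x y. dist x y < \<delta> \<Longrightarrow> cmod (f x - f y) < \<eta>"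
    using cpt_cont_uniform[OF f \<eta>] by blast
  define R where "R = pi / min \<delta> 1"
  have "cmod (fourier u x) < \<epsilon>" if x: "norm x > R" for x
  proof -
    have "R > 0" using \<delta> by (simp add: R_def)
    then have nx: "norm x > 0" using x by linarith
    define s where "s = (pi / (norm x)\<^sup>2) *\<^sub>R x"
    have "norm s = pi / norm x" using nx by (simp add: s_def power2_eq_square)
    also have "\<dots> < min \<delta> 1"
      using x \<delta>(1) pos_divide_less_eq[OF nx, of pi "min \<delta> 1"] pos_divide_less_eq[of "min \<delta> 1" pi "norm x"]
      by (simp add: R_def mult.commute del: min_less_iff_conj)
    finally have s: "norm s < \<delta>" "norm s < 1" by simp_all
    have ptwise: "norm ((f \<xi> - f (\<xi> + s)) * exp (- (\<i> * complex_of_real (x \<bullet> \<xi>))))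
        \<le> \<eta> * indicator (cball 0 (B + 1)) \<xi>" for \<xi>
    proof (cases "norm \<xi> \<le> B + 1")
      case True
      have "cmod (f \<xi> - f (\<xi> + s)) < \<eta>" by (rule \<delta>) (simp add: dist_norm s)
      then show ?thesis using True by (simp add: norm_mult)
    next
      case False
      have "norm \<xi> \<le> norm (\<xi> + s) + norm s" using norm_triangle_ineq4[of "\<xi> + s" s] by simp
      then have "norm \<xi> > B" "norm (\<xi> + s) > B" using False s by auto
      then show ?thesis using B \<eta> by simp
    qed
    have "2 * fourier f x = (LINT \<xi>|lborel. (f \<xi> - f (\<xi> + s)) * exp (- (\<i> * complex_of_real (x \<bullet> \<xi>))))"
      using fourier_half_period_shift[OF fint, of x] nx unfolding s_def by auto
    also have "cmod \<dots> \<le> (LINT \<xi>::real^'d|lborel. \<eta> * indicator (cball 0 (B + 1)) \<xi>)"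
      by (rule LINT_norm_le) (use ptwise in auto)
    also have "\<dots> = \<eta> * C" by (simp add: C_def)
    also have "\<dots> < \<epsilon>" using \<epsilon> C by (simp add: \<eta>_def field_simps)
    finally have "cmod (fourier f x) < \<epsilon> / 2" by (simp add: norm_mult)
    then show ?thesis
      using fourier_diff_le[OF u fint, of x] uf norm_triangle_sub[of "fourier u x" "fourier f x"] by linarith
  qed
  moreover have "R > 0" using \<delta> by (simp add: R_def)
  ultimately show thesis using that by blast
qed

section \<open>Compactness of convolution composed with a decaying multiplier\<close>

lemma conv_equicontinuous:
  fixes b u :: "'a::euclidean_space \<Rightarrow> complex"
  assumes b: "cpt_cont b" and u: "integrable lborel u" "norm1 u \<le> C" and \<epsilon>: "\<epsilon> > 0"
    and unif: "\<And>x y. dist x y < \<delta> \<Longrightarrow> cmod (b x - b y) < \<epsilon>" and xy: "dist x y < \<delta>"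
  shows "cmod (conv b u x - conv b u y) \<le> \<epsilon> * C"
proof -
  have [measurable]: "u \<in> borel_measurable borel" using u(1) by (rule integrable_lborel_measurable)
  have [measurable]: "b \<in> borel_measurable borel" using b by (rule cpt_cont_measurable)
  obtain M where M: "M > 0" "\<And>x. cmod (b x) \<le> M" using cpt_cont_bounded[OF b] by blast
  have int: "integrable lborel (\<lambda>t. b (x - t) * u t)" for x
  proof (rule Bochner_Integration.integrable_bound)
    show "integrable lborel (\<lambda>t. M * cmod (u t))" using u by simp
    show "AE t in lborel. norm (b (x - t) * u t) \<le> norm (M * cmod (u t))"
      using M by (auto simp: norm_mult intro!: mult_right_mono)
  qed measurable
  have "conv b u x - conv b u y = (LINT t|lborel. (b (x - t) - b (y - t)) * u t)"
    unfolding conv_def left_diff_distrib by (rule Bochner_Integration.integral_diff[symmetric]) (rule int)+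
  also have "cmod \<dots> \<le> (LINT t|lborel. \<epsilon> * cmod (u t))"
  proof (rule LINT_norm_le)
    show "(\<lambda>t. (b (x - t) - b (y - t)) * u t) \<in> borel_measurable lborel" by measurable
    have "cmod (b (x - t) - b (y - t)) \<le> \<epsilon>" for t
      using unif[of "x - t" "y - t"] xy by (simp add: dist_norm less_imp_le)
    then show "norm ((b (x - t) - b (y - t)) * u t) \<le> \<epsilon> * cmod (u t)" for t
      by (simp add: norm_mult mult_right_mono)
  qed (use u in simp)
  also have "\<dots> = \<epsilon> * norm1 u" by (simp add: norm1_def)
  also have "\<dots> \<le> \<epsilon> * C" using u(2) \<epsilon> by simp
  finally show ?thesis .
qed

text \<open>Arzela-Ascoli: for inputs supported in one ball, an \<open>L2\<close> bound gives an
  \<open>L1\<close> bound, so the convolutions are uniformly bounded, equicontinuous and supported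
  in a common ball. There uniform closeness implies \<open>L2\<close> closeness.\<close>

lemma conv_cpt_cont_subseq:
  fixes b :: "'a::euclidean_space \<Rightarrow> complex"
  assumes b: "cpt_cont b" and R: "\<And>n x. norm x > R \<Longrightarrow> u n x = 0"
    and u: "\<And>n::nat. u n \<in> L2" "\<And>n. nrm2 (u n) \<le> C" and \<epsilon>: "\<epsilon> > 0"
  shows "\<exists>s::nat \<Rightarrow> nat. strict_mono s \<and> (\<forall>m n. nrm2 (conv b (u (s m)) - conv b (u (s n))) \<le> \<epsilon>)"
proof -
  have [measurable]: "b \<in> borel_measurable borel" using b by (rule cpt_cont_measurable)
  have [measurable]: "u n \<in> borel_measurable borel" for n using u(1) by (rule L2_measurable)
  obtain M where M: "M > 0" "\<And>x. cmod (b x) \<le> M" using cpt_cont_bounded[OF b] by blast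
  obtain R' where R': "\<And>x. norm x > R' \<Longrightarrow> b x = 0" using b by (auto simp: cpt_cont_def)
  let ?I = "indicator (cball (0::'a) R) :: 'a \<Rightarrow> real"
  define C1 where "C1 = (LINT x|lborel. ?I x) + C\<^sup>2"
  \<comment> \<open>The elementary bound \<open>t \<le> 1 + t^2\<close> on the ball controls the
    \<open>L1\<close> norm by volume and \<open>L2\<close> norm.\<close>
  have ptw: "cmod (u n x) \<le> ?I x + (cmod (u n x))\<^sup>2" for n x
  proof (cases "norm x \<le> R")
    case True
    have "2 * cmod (u n x) \<le> 1 + (cmod (u n x))\<^sup>2"
      using sum_squares_bound[of 1 "cmod (u n x)"] by simp
    moreover have "0 \<le> (cmod (u n x))\<^sup>2 " by simp
    ultimately have "cmod (u n x) \<le> 1 + (cmod (u n x))\<^sup>2" by linarith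
    then show ?thesis using True by simp
  next
    case False
    then show ?thesis using R[of x n] by simp
  qed
  have int2: "integrable lborel (\<lambda>x. ?I x + (cmod (u n x))\<^sup>2)" for n
    using L2_integrable[OF u(1)] by auto
  have int: "integrable lborel (u n)" for n
    by (rule Bochner_Integration.integrable_bound[OF int2]) (use ptw in auto)
  have norm1: "norm1 (u n) \<le> C1" for n
  proof -
    have "norm1 (u n) \<le> (LINT x|lborel. ?I x + (cmod (u n x))\<^sup>2)"
      unfolding norm1_def by (rule integral_mono[OF integrable_norm[OF int] int2]) (rule ptw)
    also have "\<dots> = (LINT x|lborel. ?I x) + (nrm2 (u n))\<^sup>2"
      unfolding nrm2_square by (rule Bochner_Integration.integral_add) (use L2_integrable[OF u(1)] in auto)
    also have "\<dots> \<le> C1" unfolding C1_def using u(2) nrm2_nonneg by (intro add_left_mono power_mono)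
    finally show ?thesis .
  qed
  have C1: "C1 \<ge> 0" using norm1[of 0] norm1_nonneg[of "u 0"] by linarith
  let ?S = "cball (0::'a) (R + R')"
  define v where "v = (LINT x|lborel. indicator ?S x :: real)"
  have v: "v \<ge> 0" by (simp add: v_def)
  have zero: "conv b (u n) x = 0" if x: "norm x > R + R'" for n x
  proof -
    have "b (x - y) * u n y = 0" for y
      using R[of y n] R'[of "x - y"] norm_triangle_sub[of x y] x by (cases "norm y > R") auto
    then have eq: "(\<lambda>y. b (x - y) * u n y) = (\<lambda>_. 0)" by (rule ext)
    show ?thesis unfolding conv_def eq by simp
  qed
  \<comment> \<open>Then \<open>2 * \<eta> * (v + 1) = \<epsilon>\<close>; estimating the volume
    \<open>v\<close> by \<open>(v + 1)^2\<close> avoids its square root.\<close>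
  define \<eta> where "\<eta> = \<epsilon> / (2 * (v + 1))"
  have \<eta>: "\<eta> > 0" using \<epsilon> v by (simp add: \<eta>_def)
  obtain g k where "continuous_on ?S g" and k: "strict_mono (k :: nat \<Rightarrow> nat)"
    and lim: "\<And>e. 0 < e \<Longrightarrow> \<exists>N. \<forall>n x. n \<ge> N \<and> x \<in> ?S \<longrightarrow> norm (conv b (u (k n)) x - g x) < e"
  proof (rule Arzela_Ascoli[of ?S "\<lambda>n. conv b (u n)" "M * C1"])
    show "norm (conv b (u n) x) \<le> M * C1" for n x
    proof -
      have "norm (conv b (u n) x) \<le> (LINT y|lborel. M * cmod (u n y))"
        unfolding conv_def
      proof (rule LINT_norm_le)
        show "integrable lborel (\<lambda>y. M * cmod (u n y))" using int by simp
        show "norm (b (x - y) * u n y) \<le> M * cmod (u n y)" for y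
          using M by (auto simp: norm_mult intro!: mult_right_mono)
      qed measurable
      also have "\<dots> = M * norm1 (u n)" by (simp add: norm1_def)
      also have "\<dots> \<le> M * C1" using norm1 M by simp
      finally show ?thesis .
    qed
  next
    fix x :: 'a and e :: real assume e: "0 < e"
    have e': "e / (C1 + 1) > 0" using e C1 by simp
    obtain \<delta> where \<delta>: "\<delta> > 0" "\<And>x y. dist x y < \<delta> \<Longrightarrow> cmod (b x - b y) < e / (C1 + 1)"
      using cpt_cont_uniform[OF b e'] by blast
    have "norm (conv b (u n) x - conv b (u n) y) < e" if "norm (x - y) < \<delta>" for n y
    proof -
      have "cmod (conv b (u n) x - conv b (u n) y) \<le> e / (C1 + 1) * C1"
        by (rule conv_equicontinuous[OF b int norm1 e' \<delta>(2)]) (use that in \<open>auto simp: dist_norm\<close>)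
      also have "\<dots> < e" using e C1 by (simp add: field_simps)
      finally show ?thesis .
    qed
    then show "\<exists>d>0. \<forall>n y. y \<in> ?S \<and> norm (x - y) < d \<longrightarrow> norm (conv b (u n) x - conv b (u n) y) < e"
      using \<delta>(1) by blast
  qed (auto intro: that)
  obtain N where N: "\<And>n x. n \<ge> N \<Longrightarrow> x \<in> ?S \<Longrightarrow> norm (conv b (u (k n)) x - g x) < \<eta>"
    using lim[OF \<eta>] by blast
  define s where "s n = k (n + N)" for n
  have "strict_mono s" using k by (simp add: s_def strict_mono_def)
  moreover have "nrm2 (conv b (u (s m)) - conv b (u (s n))) \<le> \<epsilon>" for m n
  proof (rule nrm2_leI)
    let ?f = "conv b (u (s m)) - conv b (u (s n))"
    have "(cmod (?f x))\<^sup>2 \<le> (2 * \<eta>)\<^sup>2 * indicator ?S x" for x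
    proof (cases "x \<in> ?S")
      case True
      have "cmod (?f x) \<le> cmod (conv b (u (s m)) x - g x) + cmod (conv b (u (s n)) x - g x)"
        using norm_triangle_ineq4[of "conv b (u (s m)) x - g x" "conv b (u (s n)) x - g x"] by simp
      also have "\<dots> \<le> 2 * \<eta>" using N[of "m + N" x] N[of "n + N" x] True by (simp add: s_def)
      finally show ?thesis using True power_mono[of "cmod (?f x)" "2 * \<eta>" 2] by simp
    next
      case False
      then show ?thesis using zero[of x] by simp
    qed
    then have "(\<integral>\<^sup>+x. ennreal ((cmod (?f x))\<^sup>2) \<partial>lborel) \<le> (\<integral>\<^sup>+x. ennreal ((2 * \<eta>)\<^sup>2 * indicator ?S x) \<partial>lborel)"
      by (intro nn_integral_mono ennreal_leI)
    also have "\<dots> = ennreal (LINT x|lborel. (2 * \<eta>)\<^sup>2 * indicator ?S x)"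
      by (rule nn_integral_eq_integral) auto
    also have "(LINT x|lborel. (2 * \<eta>)\<^sup>2 * indicator ?S x) = (2 * \<eta>)\<^sup>2 * v" by (simp add: v_def)
    also have "\<dots> \<le> (2 * \<eta>)\<^sup>2 * (v + 1)\<^sup>2"
      using v by (intro mult_left_mono) (auto simp: power2_eq_square algebra_simps)
    also have "\<dots> = (2 * \<eta> * (v + 1))\<^sup>2" by (simp only: power_mult_distrib)
    also have "2 * \<eta> * (v + 1) = \<epsilon>" using v by (auto simp: \<eta>_def divide_simps)
    finally show "(\<integral>\<^sup>+x. ennreal ((cmod (?f x))\<^sup>2) \<partial>lborel) \<le> ennreal (\<epsilon>\<^sup>2)"
      by (simp add: ennreal_leI)
    show "?f \<in> borel_measurable borel" by (simp add: fun_diff_def)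
  qed (use \<epsilon> in simp)
  ultimately show ?thesis by blast
qed

text \<open>Up to an error small in operator norm, the kernel may be taken continuous with compact
  support and the multiplier cut off to a ball; what remains is the Arzela-Ascoli case.\<close>

theorem compact_op_conv_mult:
  fixes a g :: "'a::euclidean_space \<Rightarrow> complex"
  assumes a: "integrable lborel a" and g [measurable]: "g \<in> borel_measurable borel"
    and G: "\<And>x. cmod (g x) \<le> G"
    and decay: "\<And>\<epsilon>. \<epsilon> > 0 \<Longrightarrow> \<exists>R. \<forall>x. norm x > R \<longrightarrow> cmod (g x) \<le> \<epsilon>"
  shows "l2.compact_op (\<lambda>u. conv a (\<lambda>x. g x * u x))"
proof (rule l2.compact_opI)
  fix z :: "nat \<Rightarrow> 'a \<Rightarrow> complex" and C \<epsilon> :: real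
  assume z: "\<And>n. z n \<in> L2" "\<And>n. nrm2 (z n) \<le> C" and \<epsilon>: "\<epsilon> > 0"
  have [measurable]: "z n \<in> borel_measurable borel" for n using z(1) by (rule L2_measurable)
  have G0: "0 \<le> G" using G[of 0] norm_ge_zero order_trans by blast
  have C: "0 \<le> C" using z(2)[of 0] nrm2_nonneg[of "z 0"] by linarith
  have frac: "\<epsilon> / (8 * (K + 1)) * K \<le> \<epsilon> / 8" if "K \<ge> 0" for K
  proof -
    have "\<epsilon> / (8 * (K + 1)) * K = \<epsilon> / 8 * (K / (K + 1))" by simp
    also have "\<dots> \<le> \<epsilon> / 8 * 1" using that \<epsilon> by (intro mult_left_mono) auto
    finally show ?thesis by simp
  qed
  \<comment> \<open>Replacing the kernel and cutting off \<open>g\<close> cost at most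
    \<open>\<epsilon> / 8\<close> each, hence \<open>\<epsilon> / 4\<close> for each of two terms,
    which leaves \<open>\<epsilon> / 2\<close> for the subsequence.\<close>
  define \<eta> where "\<eta> = \<epsilon> / (8 * (G * C + 1))"
  have \<eta>: "\<eta> > 0" using \<epsilon> G0 C by (simp add: \<eta>_def add_nonneg_pos)
  obtain b where b: "cpt_cont b" "norm1 (\<lambda>x. a x - b x) < \<eta>"
    using cpt_cont_dense_L1[OF a \<eta>] by blast
  note bint = cpt_cont_integrable[OF b(1)]
  define \<theta> where "\<theta> = \<epsilon> / (8 * (norm1 b * C + 1))"
  have \<theta>: "\<theta> > 0" using \<epsilon> norm1_nonneg[of b] C by (simp add: \<theta>_def add_nonneg_pos)
  obtain R where R: "\<And>x. norm x > R \<Longrightarrow> cmod (g x) \<le> \<theta>" using decay[OF \<theta>] by blast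
  define g1 where "g1 x = (if norm x \<le> R then g x else 0)" for x
  define g2 where "g2 x = (if norm x \<le> R then 0 else g x)" for x
  have g1_meas: "g1 \<in> borel_measurable borel" and g2_meas: "g2 \<in> borel_measurable borel"
    unfolding g1_def g2_def by measurable
  have g1: "cmod (g1 x) \<le> G" and g2: "cmod (g2 x) \<le> \<theta>" for x
    using G[of x] G0 R[of x] \<theta> by (auto simp: g1_def g2_def)
  have gz: "(\<lambda>x. g x * z n x) \<in> L2" "nrm2 (\<lambda>x. g x * z n x) \<le> G * C"
    and g1z: "(\<lambda>x. g1 x * z n x) \<in> L2" "nrm2 (\<lambda>x. g1 x * z n x) \<le> G * C"
    and g2z: "(\<lambda>x. g2 x * z n x) \<in> L2" "nrm2 (\<lambda>x. g2 x * z n x) \<le> \<theta> * C" for n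
    using mult_in_L2[OF g G z(1)[of n]] mult_in_L2[OF g1_meas g1 z(1)[of n]] mult_in_L2[OF g2_meas g2 z(1)[of n]]
      mult_left_mono[OF z(2)[of n] G0] mult_left_mono[OF z(2)[of n] less_imp_le[OF \<theta>]]
    by (auto intro: order.trans)
  let ?A = "\<lambda>n. conv a (\<lambda>x. g x * z n x)" and ?B = "\<lambda>n. conv b (\<lambda>x. g1 x * z n x)"
  have approx: "nrm2 (?A n - ?B n) \<le> \<epsilon> / 4" for n
  proof -
    let ?d = "conv (\<lambda>x. a x - b x) (\<lambda>x. g x * z n x)" and ?e = "conv b (\<lambda>x. g2 x * z n x)"
    have ab: "integrable lborel (\<lambda>x. a x - b x)" using a bint by simp
    have L: "?A n \<in> L2" "?B n \<in> L2" "?d \<in> L2" "?e \<in> L2"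
      using conv_in_L2(1) a bint ab gz(1) g1z(1) g2z(1) by blast+
    have eq: "(\<lambda>x. g x * z n x) = (\<lambda>x. g1 x * z n x) + (\<lambda>x. g2 x * z n x)"
      by (auto simp: fun_eq_iff g1_def g2_def)
    have "AE x in lborel. (?A n - ?B n) x = (?d + ?e) x"
      using conv_kernel_diff_AE[OF a bint gz(1)[of n]] conv_add_AE[OF bint g1z(1)[of n] g2z(1)[of n]]
      by eventually_elim (simp add: eq[symmetric])
    then have "nrm2 (?A n - ?B n) = nrm2 (?d + ?e)"
      by (rule nrm2_cong_AE[of "?A n - ?B n" "?d + ?e", rotated 2]) (rule l2.diff_H l2.add_H L)+
    also have "\<dots> \<le> nrm2 ?d + nrm2 ?e" using L by (intro l2.nrm_add)
    also have "nrm2 ?d \<le> \<eta> * (G * C)"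
      using conv_in_L2(2)[OF ab gz(1)[of n]] gz(2)[of n] b(2) nrm2_nonneg norm1_nonneg
      by (meson less_imp_le mult_mono order.trans \<eta>)
    also have "\<dots> \<le> \<epsilon> / 8" unfolding \<eta>_def using \<epsilon> G0 C by (intro frac) auto
    also have "nrm2 ?e \<le> norm1 b * (\<theta> * C)"
      using conv_in_L2(2)[OF bint g2z(1)[of n]] g2z(2)[of n] norm1_nonneg
      by (meson mult_left_mono order.trans)
    also have "\<dots> = \<theta> * (norm1 b * C)" by simp
    also have "\<dots> \<le> \<epsilon> / 8" unfolding \<theta>_def using norm1_nonneg[of b] \<epsilon> C by (intro frac) auto
    finally show ?thesis by linarith
  qed
  have "\<exists>s::nat \<Rightarrow> nat. strict_mono s \<and> (\<forall>m n. nrm2 (?B (s m) - ?B (s n)) \<le> \<epsilon> / 2)"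
    by (rule conv_cpt_cont_subseq[OF b(1), where R = R and C = "G * C"])
      (use g1z \<epsilon> in \<open>auto simp: g1_def\<close>)
  then obtain s :: "nat \<Rightarrow> nat" where s: "strict_mono s"
    and sB: "\<And>m n. nrm2 (?B (s m) - ?B (s n)) \<le> \<epsilon> / 2" by blast
  have "nrm2 (?A (s m) - ?A (s n)) \<le> \<epsilon>" for m n
  proof -
    have L: "?A n \<in> L2" "?B n \<in> L2" for n
      using conv_in_L2(1) a bint gz(1) g1z(1) by blast+
    have "nrm2 (?A (s m) - ?A (s n))
        \<le> nrm2 (?A (s m) - ?B (s m)) + (nrm2 (?B (s m) - ?B (s n)) + nrm2 (?B (s n) - ?A (s n)))"
      using L by (intro order.trans[OF l2.nrm_triangle[where v = "?B (s m)"]] add_left_mono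
          l2.nrm_triangle[where v = "?B (s n)"]) auto
    also have "nrm2 (?B (s n) - ?A (s n)) = nrm2 (?A (s n) - ?B (s n))"
      using L by (intro l2.nrm_minus_commute)
    finally show ?thesis using approx[of "s m"] approx[of "s n"] sB[of m n] by linarith
  qed
  with s show "\<exists>s::nat \<Rightarrow> nat. strict_mono s \<and> (\<forall>m n. nrm2 (?A (s m) - ?A (s n)) \<le> \<epsilon>)" by blast
qed

section \<open>Product integrals and scaling\<close>

lemma bij_betw_axis_Basis: "bij_betw (\<lambda>i. axis i (1::real)) UNIV (Basis :: (real ^ 'n) set)"
  by (auto simp: bij_betw_def inj_on_def axis_eq_axis Basis_vec_def)

text \<open>\<open>lborel\<close> is the image of a product measure indexed by \<open>Basis\<close>;
  reindexing along \<open>axis\<close> makes this a product over coordinates.\<close>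

lemma
  fixes h :: "'n::finite \<Rightarrow> real \<Rightarrow> complex"
  assumes h: "\<And>i. integrable lborel (h i)"
  shows integrable_lborel_prod: "integrable lborel (\<lambda>x::real^'n. \<Prod>i\<in>UNIV. h i (x $ i))"
    and LINT_lborel_prod: "(LINT x::real^'n|lborel. (\<Prod>i\<in>UNIV. h i (x $ i))) = (\<Prod>i\<in>UNIV. LINT t|lborel. h i t)"
proof -
  interpret product_sigma_finite "\<lambda>_ :: real^'n. lborel :: real measure" ..
  let ?ax = "\<lambda>i::'n. axis i (1::real)"
  define H where "H b = h (inv_into UNIV ?ax b)" for b
  have inv: "inv_into UNIV ?ax (?ax i) = i" for i
    by (rule inv_into_f_f) (auto simp: inj_on_def axis_eq_axis)
  have Hint: "integrable lborel (H b)" for b unfolding H_def by (rule h)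
  have [measurable]: "h i \<in> borel_measurable borel" for i using h by (rule integrable_lborel_measurable)
  have meas: "(\<lambda>x::real^'n. \<Prod>i\<in>UNIV. h i (x $ i)) \<in> borel_measurable borel"
    by measurable
  have T: "(\<lambda>f. \<Sum>b\<in>Basis. f b *\<^sub>R b) \<in> measurable (\<Pi>\<^sub>M b\<in>Basis. lborel) (borel :: (real^'n) measure)"
    by measurable
  have comp: "(\<Sum>b\<in>Basis. f b *\<^sub>R b) $ i = f (?ax i)" for f :: "real^'n \<Rightarrow> real" and i
  proof -
    have "(\<Sum>b\<in>Basis. f b *\<^sub>R b) $ i = (\<Sum>b\<in>Basis. f b *\<^sub>R b) \<bullet> ?ax i"
      by (simp add: inner_axis)
    also have "\<dots> = f (?ax i)" by (rule inner_sum_left_Basis) (auto simp: Basis_vec_def)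
    finally show ?thesis .
  qed
  have prodeq: "(\<Prod>i\<in>UNIV. h i ((\<Sum>b\<in>Basis. f b *\<^sub>R b) $ i)) = (\<Prod>b\<in>Basis. H b (f b))" for f :: "real^'n \<Rightarrow> real"
    unfolding comp
    by (subst prod.reindex_bij_betw[OF bij_betw_axis_Basis, symmetric]) (simp add: H_def inv)
  have "integrable (\<Pi>\<^sub>M b\<in>(Basis::(real^'n) set). lborel) (\<lambda>f. \<Prod>b\<in>Basis. H b (f b))"
    by (rule product_integrable_prod) (auto intro: Hint)
  then show "integrable lborel (\<lambda>x::real^'n. \<Prod>i\<in>UNIV. h i (x $ i))"
    by (subst lborel_eq, subst integrable_distr_eq[OF T meas]) (simp only: prodeq)
  have "(LINT x::real^'n|lborel. (\<Prod>i\<in>UNIV. h i (x $ i)))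
    = (LINT f|(\<Pi>\<^sub>M b\<in>(Basis::(real^'n) set). lborel). (\<Prod>b\<in>Basis. H b (f b)))"
    by (subst lborel_eq, subst integral_distr[OF T meas]) (simp only: prodeq)
  also have "\<dots> = (\<Prod>b\<in>(Basis::(real^'n) set). LINT t|lborel. H b t)"
    by (rule product_integral_prod) (auto intro: Hint)
  also have "\<dots> = (\<Prod>i\<in>UNIV. LINT t|lborel. h i t)"
    by (subst prod.reindex_bij_betw[OF bij_betw_axis_Basis, symmetric]) (simp add: H_def inv)
  finally show "(LINT x::real^'n|lborel. (\<Prod>i\<in>UNIV. h i (x $ i))) = (\<Prod>i\<in>UNIV. LINT t|lborel. h i t)" .
qed

lemma
  fixes f :: "'a::euclidean_space \<Rightarrow> complex"
  assumes [measurable]: "f \<in> borel_measurable borel" and c: "c > 0"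
  shows LINT_lborel_affine: "(LINT x|lborel. f x) = of_real (c ^ DIM('a)) * (LINT x|lborel. f (t + c *\<^sub>R x))"
    and integrable_lborel_affine: "integrable lborel f \<Longrightarrow> integrable lborel (\<lambda>x. f (t + c *\<^sub>R x))"
proof -
  let ?d = "distr lborel borel (\<lambda>x. t + c *\<^sub>R x) :: 'a measure"
  have eq: "lborel = density ?d (\<lambda>_. ennreal (\<bar>c\<bar> ^ DIM('a)))"
    by (rule lborel_affine) (use c in simp)
  have "(LINT x|lborel. f x) = (LINT x|?d. (\<bar>c\<bar> ^ DIM('a)) *\<^sub>R f x)"
    by (subst eq, rule integral_density) auto
  also have "\<dots> = (LINT x|lborel. (\<bar>c\<bar> ^ DIM('a)) *\<^sub>R f (t + c *\<^sub>R x))"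
    by (rule integral_distr) auto
  finally show "(LINT x|lborel. f x) = of_real (c ^ DIM('a)) * (LINT x|lborel. f (t + c *\<^sub>R x))"
    using c by (simp add: scaleR_conv_of_real)
  assume "integrable lborel f"
  then have "integrable ?d (\<lambda>x. (\<bar>c\<bar> ^ DIM('a)) *\<^sub>R f x)"
    by (subst (asm) eq, subst (asm) integrable_density) auto
  then have "integrable lborel (\<lambda>x. (\<bar>c\<bar> ^ DIM('a)) *\<^sub>R f (t + c *\<^sub>R x))"
    by (subst (asm) integrable_distr_eq) auto
  from integrable_scaleR_right[OF this, of "1 / \<bar>c\<bar> ^ DIM('a)"]
  show "integrable lborel (\<lambda>x. f (t + c *\<^sub>R x))"
    using c by simp
qed

lemma LINT_lborel_reflect:
  fixes f :: "'a::euclidean_space \<Rightarrow> 'b::{banach,second_countable_topology}"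
  assumes [measurable]: "f \<in> borel_measurable borel"
  shows "(LINT y|lborel. f (x - y)) = (LINT y|lborel. f y)"
proof -
  have "(LINT y|lborel. f y) = (LINT y|distr lborel borel (\<lambda>y. x - y). f y)"
    by (simp only: distr_lborel_reflect)
  also have "\<dots> = (LINT y|lborel. f (x - y))" by (rule integral_distr) measurable
  finally show ?thesis ..
qed

section \<open>Convolution of integrable functions\<close>

lemma conv_pair_integrable:
  fixes f g :: "'a::euclidean_space \<Rightarrow> complex"
  assumes f: "integrable lborel f" and g: "integrable lborel g"
  shows "integrable (lborel \<Otimes>\<^sub>M lborel) (\<lambda>(x, y). f (x - y) * g y)"
  unfolding integrable_iff_bounded
proof
  have fm [measurable]: "f \<in> borel_measurable borel" using f by (rule integrable_lborel_measurable)
  have gm [measurable]: "g \<in> borel_measurable borel" using g by (rule integrable_lborel_measurable)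
  have "(\<integral>\<^sup>+z. ennreal (norm (case z of (x, y) \<Rightarrow> f (x - y) * g y)) \<partial>(lborel \<Otimes>\<^sub>M lborel))
    = (\<integral>\<^sup>+y. (\<integral>\<^sup>+x. ennreal (cmod (f (x - y) * g y)) \<partial>lborel) \<partial>lborel)"
    by (subst lborel_pair.nn_integral_snd[symmetric]) simp_all
  also have "\<dots> = (\<integral>\<^sup>+y. ennreal (norm1 f) * ennreal (cmod (g y)) \<partial>lborel)"
  proof (rule nn_integral_cong)
    fix y
    have "(\<integral>\<^sup>+x. ennreal (cmod (f (x - y) * g y)) \<partial>lborel)
      = (\<integral>\<^sup>+x. ennreal (cmod (f (x - y))) \<partial>lborel) * ennreal (cmod (g y))"
      by (subst nn_integral_multc[symmetric]) (simp_all add: ennreal_mult norm_mult)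
    then show "(\<integral>\<^sup>+x. ennreal (cmod (f (x - y) * g y)) \<partial>lborel) = ennreal (norm1 f) * ennreal (cmod (g y))"
      using nn_integral_lborel_translate[of "\<lambda>y. ennreal (cmod (f y))" y] by (simp add: nn_integral_norm1[OF f])
  qed
  also have "\<dots> = ennreal (norm1 f) * ennreal (norm1 g)"
    by (subst nn_integral_cmult) (simp_all add: nn_integral_norm1[OF g])
  also have "\<dots> < \<infinity>" by (simp add: ennreal_mult_less_top)
  finally show "(\<integral>\<^sup>+z. ennreal (norm (case z of (x, y) \<Rightarrow> f (x - y) * g y)) \<partial>(lborel \<Otimes>\<^sub>M lborel)) < \<infinity>" .
  show "(\<lambda>(x, y). f (x - y) * g y) \<in> borel_measurable (lborel \<Otimes>\<^sub>M lborel)" by measurable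
qed

lemma
  fixes f g :: "'a::euclidean_space \<Rightarrow> complex"
  assumes f: "integrable lborel f" and g: "integrable lborel g"
  shows conv_integrable: "integrable lborel (conv f g)"
    and LINT_conv: "(LINT x|lborel. conv f g x) = (LINT x|lborel. f x) * (LINT x|lborel. g x)"
proof -
  have fm [measurable]: "f \<in> borel_measurable borel" using f by (rule integrable_lborel_measurable)
  show "integrable lborel (conv f g)"
    unfolding conv_def[abs_def] using lborel_pair.integrable_fst'[OF conv_pair_integrable[OF f g]] by simp
  have "(LINT x|lborel. conv f g x) = (LINT y|lborel. LINT x|lborel. f (x - y) * g y)"
    unfolding conv_def using lborel_pair.Fubini_integral[OF conv_pair_integrable[OF f g]] by simp
  also have "\<dots> = (LINT y|lborel. (LINT x|lborel. f x) * g y)"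
    using LINT_lborel_translate[of f "- _"] by simp
  finally show "(LINT x|lborel. conv f g x) = (LINT x|lborel. f x) * (LINT x|lborel. g x)" by simp
qed

text \<open>The exponential factors as its value at \<open>x - y\<close> times its value at
  \<open>y\<close>, so a convolution times the exponential is the convolution of the modulated
  functions, and \<open>LINT_conv\<close> applies.\<close>

lemma fourier_conv:
  fixes f g :: "real ^ 'd \<Rightarrow> complex"
  assumes f: "integrable lborel f" and g: "integrable lborel g"
  shows "fourier (conv f g) \<xi> = fourier f \<xi> * fourier g \<xi>"
proof -
  let ?E = "\<lambda>x. exp (- (\<i> * complex_of_real (\<xi> \<bullet> x)))"
  have E: "?E x = ?E (x - y) * ?E y" for x y
    by (simp add: exp_add[symmetric] inner_diff_right algebra_simps)
  have "conv f g x * ?E x = conv (\<lambda>x. f x * ?E x) (\<lambda>x. g x * ?E x) x" for x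
  proof -
    have pt: "f (x - y) * g y * ?E x = (f (x - y) * ?E (x - y)) * (g y * ?E y)" for y
      by (subst E[of x y]) (simp only: mult_ac)
    have "conv f g x * ?E x = (LINT y|lborel. f (x - y) * g y * ?E x)" by (simp add: conv_def)
    also have "\<dots> = (LINT y|lborel. (f (x - y) * ?E (x - y)) * (g y * ?E y))"
      by (simp only: pt)
    finally show ?thesis by (simp add: conv_def)
  qed
  then show ?thesis
    unfolding fourier_def using LINT_conv[OF fourier_integrable[OF f] fourier_integrable[OF g], of \<xi> \<xi>] by simp
qed

lemma conv_commute:
  assumes [measurable]: "f \<in> borel_measurable borel" "g \<in> borel_measurable borel"
  shows "conv f g x = conv g f x"
  unfolding conv_def using LINT_lborel_reflect[of "\<lambda>y. f (x - y) * g y" x] by (simp add: mult.commute)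

lemma conv_bounded_le:
  assumes a: "integrable lborel a" and b [measurable]: "b \<in> borel_measurable borel" "\<And>x. cmod (b x) \<le> M"
  shows "cmod (conv a b x) \<le> norm1 a * M"
proof -
  have [measurable]: "a \<in> borel_measurable borel" using a by (rule integrable_lborel_measurable)
  have "cmod (conv b a x) \<le> (LINT y|lborel. cmod (a y) * M)"
    unfolding conv_def
  proof (rule LINT_norm_le)
    show "norm (b (x - y) * a y) \<le> cmod (a y) * M" for y
      using mult_right_mono[OF b(2)[of "x - y"] norm_ge_zero[of "a y"]] by (simp add: norm_mult mult.commute)
  qed (use a in auto)
  then show ?thesis by (simp add: norm1_def conv_commute[of a b])
qed

lemma conv_bounded_continuous:
  fixes a b :: "'a::euclidean_space \<Rightarrow> complex"
  assumes a: "integrable lborel a" and b: "continuous_on UNIV b" "\<And>x. cmod (b x) \<le> M"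
  shows "continuous_on UNIV (conv a b)"
  unfolding continuous_on_sequentially
proof (intro ballI allI impI)
  fix X :: "nat \<Rightarrow> 'a" and x assume "(\<forall>n. X n \<in> UNIV) \<and> X \<longlonglongrightarrow> x"
  then have X: "X \<longlonglongrightarrow> x" by simp
  have [measurable]: "a \<in> borel_measurable borel" using a by (rule integrable_lborel_measurable)
  have [measurable]: "b \<in> borel_measurable borel" using b(1) by (rule borel_measurable_continuous_onI)
  have "(\<lambda>n. conv b a (X n)) \<longlonglongrightarrow> conv b a x"
    unfolding conv_def
  proof (rule integral_dominated_convergence[where w = "\<lambda>y. M * cmod (a y)"])
    show "AE y in lborel. (\<lambda>n. b (X n - y) * a y) \<longlonglongrightarrow> b (x - y) * a y"
    proof (rule AE_I2)
      fix y
      have "isCont b (x - y)" using b(1) by (simp add: continuous_on_eq_continuous_at)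
      then have "(\<lambda>n. b (X n - y)) \<longlonglongrightarrow> b (x - y)"
        by (rule isCont_tendsto_compose) (intro tendsto_intros X)
      then show "(\<lambda>n. b (X n - y) * a y) \<longlonglongrightarrow> b (x - y) * a y" by (intro tendsto_intros)
    qed
    show "AE y in lborel. norm (b (X n - y) * a y) \<le> M * cmod (a y)" for n
      using b(2) by (auto simp: norm_mult intro!: mult_right_mono)
    show "integrable lborel (\<lambda>y. M * cmod (a y))" using a by simp
  qed measurable
  then show "(conv a b \<circ> X) \<longlonglongrightarrow> conv a b x"
    by (simp add: o_def conv_commute[of a b])
qed

section \<open>Functions with nonnegative Fourier transform are nonnegative at the origin\<close>

text \<open>The integral is the characteristic function of the standard normal distribution at
  \<open>-s\<close>.\<close>

lemma fourier_std_normal_density: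
  "(LINT t|lborel. complex_of_real (std_normal_density t) * exp (- (\<i> * complex_of_real (s * t)))) = complex_of_real (exp (- s\<^sup>2 / 2))"
proof -
  have "char std_normal_distribution (- s) = complex_of_real (exp (- s\<^sup>2 / 2))"
    by (simp add: char_std_normal_distribution)
  moreover have "char std_normal_distribution (- s)
      = (LINT t|lborel. std_normal_density t *\<^sub>R exp (\<i> * complex_of_real (- s * t)))"
    unfolding char_def
    by (rule integral_density) (auto intro!: borel_measurable_continuous_onI continuous_intros)
  ultimately show ?thesis by (simp add: scaleR_conv_of_real)
qed

definition gauss :: "real ^ 'd::finite \<Rightarrow> complex" where
  "gauss x = (\<Prod>i\<in>UNIV. complex_of_real (std_normal_density (x $ i)))"

lemma gauss_integrable: "integrable lborel (gauss :: real ^ 'd::finite \<Rightarrow> complex)"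
  unfolding gauss_def[abs_def] by (rule integrable_lborel_prod) simp

lemma gauss_nonneg: "\<exists>r\<ge>0. gauss x = complex_of_real r"
  by (intro exI[of _ "\<Prod>i\<in>UNIV. std_normal_density (x $ i)"]) (auto simp: gauss_def intro!: prod_nonneg)

lemma fourier_gauss: "fourier gauss x = complex_of_real (sqrt (2 * pi) ^ CARD('d)) * gauss x"
  for x :: "real ^ 'd::finite"
proof -
  let ?e = "\<lambda>i t. complex_of_real (std_normal_density t) * exp (- (\<i> * complex_of_real (x $ i * t)))"
  have int: "integrable lborel (?e i)" for i
  proof (rule Bochner_Integration.integrable_bound[of lborel std_normal_density])
    show "?e i \<in> borel_measurable lborel"
      by (auto intro!: borel_measurable_times borel_measurable_continuous_onI continuous_intros)
    show "AE t in lborel. norm (?e i t) \<le> norm (std_normal_density t)"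
      by (simp add: norm_mult norm_exp_eq_Re)
  qed simp
  have std: "exp (- t\<^sup>2 / 2) = sqrt (2 * pi) * std_normal_density t" for t
    by (simp add: std_normal_density_def)
  have "gauss \<xi> * exp (- (\<i> * complex_of_real (x \<bullet> \<xi>))) = (\<Prod>i\<in>UNIV. ?e i (\<xi> $ i))" for \<xi>
    by (simp add: gauss_def prod.distrib exp_sum[symmetric] inner_vec_def sum_distrib_left sum_negf)
  then have "fourier gauss x = (\<Prod>i\<in>UNIV. LINT t|lborel. ?e i t)"
    unfolding fourier_def by (simp only: LINT_lborel_prod[OF int])
  also have "\<dots> = (\<Prod>i\<in>UNIV. complex_of_real (exp (- (x $ i)\<^sup>2 / 2)))"
    by (simp only: fourier_std_normal_density)
  also have "\<dots> = (\<Prod>i\<in>UNIV. complex_of_real (sqrt (2 * pi)) * complex_of_real (std_normal_density (x $ i)))"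
    unfolding std of_real_mult ..
  also have "\<dots> = complex_of_real (sqrt (2 * pi) ^ CARD('d)) * gauss x"
    by (simp add: gauss_def prod.distrib)
  finally show ?thesis .
qed

lemma LINT_gauss: "(LINT x::real^'d::finite|lborel. gauss x) = 1"
  unfolding gauss_def by (subst LINT_lborel_prod) simp_all

text \<open>Fubini for the product with the exponential kernel. It takes the place of an inversion
  formula: the transform is moved from the Gaussian to the function under study.\<close>

lemma fourier_multiplication_formula:
  fixes f g :: "real ^ 'd \<Rightarrow> complex"
  assumes f: "integrable lborel f" and g: "integrable lborel g"
  shows "(LINT x|lborel. f x * fourier g x) = (LINT x|lborel. fourier f x * g x)"
proof -
  have fm [measurable]: "f \<in> borel_measurable borel" using f by (rule integrable_lborel_measurable)
  have gm [measurable]: "g \<in> borel_measurable borel" using g by (rule integrable_lborel_measurable)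
  have Em: "(\<lambda>z::(real^'d) \<times> (real^'d). exp (- (\<i> * complex_of_real (fst z \<bullet> snd z)))) \<in> borel_measurable borel"
    by (intro borel_measurable_continuous_onI continuous_intros)
  have [measurable]: "(\<lambda>z::(real^'d) \<times> (real^'d). exp (- (\<i> * complex_of_real (fst z \<bullet> snd z)))) \<in> borel_measurable (lborel \<Otimes>\<^sub>M lborel)"
    using Em by (simp add: lborel_prod)
  have "integrable (lborel \<Otimes>\<^sub>M lborel) (\<lambda>(x, y). f x * g y)"
  proof (rule lborel_pair.Fubini_integrable)
    show "integrable lborel (\<lambda>x. LINT y|lborel. norm (case (x, y) of (x, y) \<Rightarrow> f x * g y))"
      using f by (simp add: norm_mult)
    show "AE x in lborel. integrable lborel (\<lambda>y. case (x, y) of (x, y) \<Rightarrow> f x * g y)"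
      using g by simp
  qed measurable
  then have int: "integrable (lborel \<Otimes>\<^sub>M lborel) (\<lambda>(x, y). f x * g y * exp (- (\<i> * complex_of_real (x \<bullet> y))))"
    by (rule Bochner_Integration.integrable_bound) (auto simp: norm_mult case_prod_beta')
  have "(LINT x|lborel. f x * fourier g x)
      = (LINT x|lborel. LINT y|lborel. f x * g y * exp (- (\<i> * complex_of_real (x \<bullet> y))))"
    by (simp add: fourier_def mult.assoc)
  also have "\<dots> = (LINT y|lborel. LINT x|lborel. f x * g y * exp (- (\<i> * complex_of_real (x \<bullet> y))))"
    using lborel_pair.Fubini_integral[OF int] by simp
  also have "\<dots> = (LINT y|lborel. (LINT x|lborel. f x * exp (- (\<i> * complex_of_real (y \<bullet> x)))) * g y)"
  proof (intro Bochner_Integration.integral_cong refl)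
    fix y
    have "f x * g y * exp (- (\<i> * complex_of_real (x \<bullet> y))) = f x * exp (- (\<i> * complex_of_real (y \<bullet> x))) * g y" for x
      by (simp add: inner_commute)
    then show "(LINT x|lborel. f x * g y * exp (- (\<i> * complex_of_real (x \<bullet> y)))) =
        (LINT x|lborel. f x * exp (- (\<i> * complex_of_real (y \<bullet> x)))) * g y"
      by (simp only: Bochner_Integration.integral_mult_left_zero)
  qed
  finally show ?thesis by (simp add: fourier_def)
qed

lemma fourier_scale:
  fixes f :: "real ^ 'd \<Rightarrow> complex"
  assumes f: "integrable lborel f" and c: "c > 0"
  shows "fourier f \<xi> = of_real (c ^ CARD('d)) * fourier (\<lambda>x. f (c *\<^sub>R x)) (c *\<^sub>R \<xi>)"
proof -
  have [measurable]: "f \<in> borel_measurable borel" using f by (rule integrable_lborel_measurable)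
  show ?thesis
    unfolding fourier_def
    by (subst LINT_lborel_affine[OF _ c, where t = 0]) (simp_all add: inner_commute)
qed

text \<open>Testing \<open>f(\<epsilon> \<cdot>)\<close> against a Gaussian, whose Fourier transform is again a positive Gaussian.\<close>

lemma nonneg_at_0_of_nonneg_fourier:
  fixes f :: "real ^ 'd \<Rightarrow> complex"
  assumes f: "integrable lborel f" and cont: "continuous_on UNIV f" and M: "\<And>x. cmod (f x) \<le> M"
    and pos: "\<And>\<xi>. fourier f \<xi> \<in> \<real>" "\<And>\<xi>. 0 \<le> Re (fourier f \<xi>)"
  shows "0 \<le> Re (f 0)"
proof -
  have fm [measurable]: "f \<in> borel_measurable borel" using f by (rule integrable_lborel_measurable)
  have gm [measurable]: "gauss \<in> borel_measurable (borel :: (real^'d) measure)"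
    using gauss_integrable by (rule integrable_lborel_measurable)
  \<comment> \<open>Dilating by \<open>c n\<close> concentrates the test at the origin, while the
    transform of the dilate is a positive multiple of a dilate of \<open>fourier f\<close> and stays
    nonnegative.\<close>
  define c where "c n = 1 / real (Suc n)" for n
  have c: "c n > 0" for n by (simp add: c_def)
  define K where "K = complex_of_real (sqrt (2 * pi) ^ CARD('d))"
  have "0 \<le> Re (LINT x|lborel. f (c n *\<^sub>R x) * gauss x)" for n
  proof -
    let ?f = "\<lambda>x. f (c n *\<^sub>R x)"
    have fc: "integrable lborel ?f" using integrable_lborel_affine[OF fm c[of n] f, of 0] by simp
    have "?f x * fourier gauss x = K * (?f x * gauss x)" for x
      by (simp add: fourier_gauss K_def)
    then have "K * (LINT x|lborel. ?f x * gauss x) = (LINT x|lborel. ?f x * fourier gauss x)"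
      by (simp only: Bochner_Integration.integral_mult_right_zero)
    also have "\<dots> = (LINT x|lborel. fourier ?f x * gauss x)"
      by (rule fourier_multiplication_formula[OF fc gauss_integrable])
    finally have eq: "K * (LINT x|lborel. ?f x * gauss x) = (LINT x|lborel. fourier ?f x * gauss x)" .
    have "0 \<le> Re (fourier ?f x * gauss x)" for x
    proof -
      obtain r where r: "r \<ge> 0" "gauss x = complex_of_real r" using gauss_nonneg by blast
      have "fourier f ((1 / c n) *\<^sub>R x) = of_real (c n ^ CARD('d)) * fourier ?f x"
        using fourier_scale[OF f c[of n], of "(1 / c n) *\<^sub>R x"] c[of n] by simp
      then have "0 \<le> c n ^ CARD('d) * Re (fourier ?f x)"
        using pos(2)[of "(1 / c n) *\<^sub>R x"] by (simp flip: of_real_power)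
      then have "0 \<le> Re (fourier ?f x)"
        using zero_less_power[OF c[of n], of "CARD('d)"] by (simp add: zero_le_mult_iff)
      then show ?thesis using r by simp
    qed
    \<comment> \<open>Without integrability the integral is 0 by convention, so the sign is correct
      in both cases.\<close>
    then have "0 \<le> Re (LINT x|lborel. fourier ?f x * gauss x)"
      by (cases "integrable lborel (\<lambda>x. fourier ?f x * gauss x)")
        (auto simp: integral_Re[symmetric] not_integrable_integral_eq)
    also have "\<dots> = sqrt (2 * pi) ^ CARD('d) * Re (LINT x|lborel. ?f x * gauss x)"
      unfolding eq[symmetric] K_def by (simp flip: of_real_power)
    finally have "0 \<le> sqrt (2 * pi) ^ CARD('d) * Re (LINT x|lborel. ?f x * gauss x)" .
    moreover have "sqrt (2 * pi) ^ CARD('d) > 0" by simp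
    ultimately show ?thesis by (meson mult_pos_neg not_le)
  qed
  moreover have "(\<lambda>n. LINT x|lborel. f (c n *\<^sub>R x) * gauss x) \<longlonglongrightarrow> (LINT x::real^'d|lborel. f 0 * gauss x)"
  proof (rule integral_dominated_convergence[where w = "\<lambda>x. M * cmod (gauss x)"])
    have "c \<longlonglongrightarrow> 0" unfolding c_def by (rule LIMSEQ_inverse_real_of_nat[unfolded inverse_eq_divide])
    show "AE x in lborel. (\<lambda>n. f (c n *\<^sub>R x) * gauss x) \<longlonglongrightarrow> f 0 * gauss x"
    proof (rule AE_I2)
      fix x :: "real ^ 'd"
      have "isCont f (0 *\<^sub>R x)" using cont by (simp add: continuous_on_eq_continuous_at)
      then have "(\<lambda>n. f (c n *\<^sub>R x)) \<longlonglongrightarrow> f (0 *\<^sub>R x)"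
        by (rule isCont_tendsto_compose) (intro tendsto_intros \<open>c \<longlonglongrightarrow> 0\<close>)
      then show "(\<lambda>n. f (c n *\<^sub>R x) * gauss x) \<longlonglongrightarrow> f 0 * gauss x"
        by (intro tendsto_intros) simp
    qed
    show "AE x in lborel. norm (f (c n *\<^sub>R x) * gauss x) \<le> M * cmod (gauss x)" for n
      using M by (auto simp: norm_mult intro!: mult_right_mono)
    show "integrable lborel (\<lambda>x::real^'d. M * cmod (gauss x))"
      by (intro integrable_mult_right integrable_norm gauss_integrable)
  qed measurable
  moreover have "(LINT x::real^'d|lborel. f 0 * gauss x) = f 0" by (simp add: LINT_gauss)
  ultimately show ?thesis
    by (metis (no_types, lifting) LIMSEQ_le_const tendsto_Re)
qed

section \<open>The lower bound of a convolution operator\<close>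

lemma cpt_cont_conj_reflect:
  fixes u :: "'a::euclidean_space \<Rightarrow> complex"
  shows "cpt_cont u \<Longrightarrow> cpt_cont (\<lambda>x. cnj (u (- x)))"
  unfolding cpt_cont_def
proof (elim conjE exE, intro conjI exI allI impI)
  fix R and x :: 'a assume "\<forall>x. R < norm x \<longrightarrow> u x = 0" "R < norm x"
  then show "cnj (u (- x)) = 0" by (metis complex_cnj_zero norm_minus_cancel)
qed (auto intro!: continuous_intros elim!: continuous_on_compose2)

lemma fourier_conj_reflect:
  fixes u :: "real ^ 'd \<Rightarrow> complex"
  assumes [measurable]: "u \<in> borel_measurable borel"
  shows "fourier (\<lambda>x. cnj (u (- x))) \<xi> = cnj (fourier u \<xi>)"
proof -
  let ?g = "\<lambda>x. u x * exp (- (\<i> * complex_of_real (\<xi> \<bullet> x)))"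
  have "fourier (\<lambda>x. cnj (u (- x))) \<xi> = (LINT x|lborel. cnj (?g (0 - x)))"
    by (simp add: fourier_def exp_cnj)
  also have "\<dots> = (LINT x|lborel. cnj (?g x))"
    by (rule LINT_lborel_reflect) measurable
  also have "\<dots> = cnj (fourier u \<xi>)"
    unfolding fourier_def by (rule Bochner_Integration.integral_cnj)
  finally show ?thesis .
qed

text \<open>Two reflections and Fubini. The quadratic form becomes a point evaluation at the origin,
  where positivity of the Fourier transform can be exploited.\<close>

lemma conv_autocorrelation_at_0:
  fixes a u :: "'a::euclidean_space \<Rightarrow> complex"
  assumes a: "integrable lborel a" and u: "cpt_cont u"
  shows "conv a (conv u (\<lambda>x. cnj (u (- x)))) 0 = l2ip (conv a u) u"
proof -
  have am [measurable]: "a \<in> borel_measurable borel" using a by (rule integrable_lborel_measurable)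
  have um [measurable]: "u \<in> borel_measurable borel" using u by (rule cpt_cont_measurable)
  obtain M where M: "M > 0" "\<And>x. cmod (u x) \<le> M" using cpt_cont_bounded[OF u] by blast
  let ?h = "conv u (\<lambda>x. cnj (u (- x)))"
  have h: "?h (- z) = (LINT x|lborel. u (x - z) * cnj (u x))" for z
  proof -
    have "?h (- z) = (LINT x|lborel. u (- z - (0 - x)) * cnj (u (- (0 - x))))"
      unfolding conv_def
      by (rule LINT_lborel_reflect[of "\<lambda>y. u (- z - y) * cnj (u (- y))" 0, symmetric]) measurable
    then show ?thesis by (simp add: add.commute)
  qed
  have "conv a ?h 0 = (LINT z|lborel. a (0 - (0 - z)) * ?h (0 - z))"
    unfolding conv_def[of a]
    by (rule LINT_lborel_reflect[of "\<lambda>y. a (0 - y) * ?h y" 0, symmetric]) measurable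
  also have "\<dots> = (LINT z|lborel. a z * (LINT x|lborel. u (x - z) * cnj (u x)))"
    by (simp add: h)
  also have "\<dots> = (LINT z|lborel. LINT x|lborel. u (x - z) * a z * cnj (u x))"
    by (simp add: mult_ac flip: Bochner_Integration.integral_mult_right_zero)
  also have "\<dots> = (LINT x|lborel. LINT z|lborel. u (x - z) * a z * cnj (u x))"
  proof (rule lborel_pair.Fubini_integral)
    have int: "integrable (lborel \<Otimes>\<^sub>M lborel) (\<lambda>z. of_real M * (case z of (x, z) \<Rightarrow> u (x - z) * a z))"
      using conv_pair_integrable[OF cpt_cont_integrable[OF u] a] by (rule integrable_mult_right)
    show "integrable (lborel \<Otimes>\<^sub>M lborel) (\<lambda>(x, z). u (x - z) * a z * cnj (u x))"
    proof (rule Bochner_Integration.integrable_bound[OF int])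
      show "AE z in lborel \<Otimes>\<^sub>M lborel. norm (case z of (x, z) \<Rightarrow> u (x - z) * a z * cnj (u x))
          \<le> norm (of_real M * (case z of (x, z) \<Rightarrow> u (x - z) * a z))"
      proof (rule AE_I2, clarsimp simp: norm_mult)
        fix x z
        show "cmod (u (x - z)) * cmod (a z) * cmod (u x) \<le> \<bar>M\<bar> * (cmod (u (x - z)) * cmod (a z))"
          using mult_right_mono[OF M(2)[of x], of "cmod (u (x - z)) * cmod (a z)"] M(1) by (simp add: mult_ac)
      qed
    qed measurable
  qed
  also have "\<dots> = (LINT x|lborel. conv u a x * cnj (u x))"
    by (simp add: conv_def)
  also have "\<dots> = l2ip (conv a u) u"
    by (simp add: l2ip_def conv_commute[OF um am])
  finally show ?thesis .
qed

text \<open>With \<open>h\<close> the autocorrelation of \<open>u\<close>, the transform of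
  \<open>conv a h - m h\<close> is \<open>fourier a - m\<close> times the squared modulus of
  \<open>fourier u\<close>, hence nonnegative; the value of this function at 0 is the difference of
  the two sides.\<close>

lemma conv_form_ge_cpt_cont:
  fixes a u :: "real ^ 'd \<Rightarrow> complex"
  assumes a: "integrable lborel a" and herm: "hermitian_ae a"
    and m: "\<And>\<xi>. m \<le> Re (fourier a \<xi>)" and u: "cpt_cont u"
  shows "m * (nrm2 u)\<^sup>2 \<le> Re (l2ip (conv a u) u)"
proof -
  have am [measurable]: "a \<in> borel_measurable borel" using a by (rule integrable_lborel_measurable)
  have um [measurable]: "u \<in> borel_measurable borel" using u by (rule cpt_cont_measurable)
  let ?v = "\<lambda>x. cnj (u (- x))"
  have v: "cpt_cont ?v" using u by (rule cpt_cont_conj_reflect)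
  note uint = cpt_cont_integrable[OF u] and vint = cpt_cont_integrable[OF v]
  obtain M where M: "\<And>x. cmod (u x) \<le> M" using cpt_cont_bounded[OF u] by blast
  define h where "h = conv u ?v"
  have hint: "integrable lborel h" unfolding h_def by (rule conv_integrable[OF uint vint])
  have hm [measurable]: "h \<in> borel_measurable borel" using hint by (rule integrable_lborel_measurable)
  have hcont: "continuous_on UNIV h"
    unfolding h_def by (rule conv_bounded_continuous[OF uint]) (use v M in \<open>auto simp: cpt_cont_def\<close>)
  define M' where "M' = norm1 u * M"
  have hM: "cmod (h x) \<le> M'" for x
    unfolding h_def M'_def by (rule conv_bounded_le[OF uint]) (use M in auto)
  define f where "f x = conv a h x - of_real m * h x" for x
  have "0 \<le> Re (f 0)"
  proof (rule nonneg_at_0_of_nonneg_fourier)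
    show fint: "integrable lborel f"
      unfolding f_def using conv_integrable[OF a hint] hint by auto
    show "continuous_on UNIV f"
      unfolding f_def by (intro continuous_intros conv_bounded_continuous[OF a hcont hM] hcont)
    show "cmod (f x) \<le> norm1 a * M' + \<bar>m\<bar> * M'" for x
      unfolding f_def
      by (rule order.trans[OF norm_triangle_ineq4 add_mono[OF conv_bounded_le[OF a hm hM]]])
        (simp add: norm_mult mult_left_mono hM)
    have hhat: "fourier h \<xi> = complex_of_real ((cmod (fourier u \<xi>))\<^sup>2)" for \<xi>
      unfolding h_def fourier_conv[OF uint vint] fourier_conj_reflect[OF um] complex_norm_square ..
    have fhat: "fourier f \<xi> = (fourier a \<xi> - of_real m) * complex_of_real ((cmod (fourier u \<xi>))\<^sup>2)" for \<xi>
    proof -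
      have "fourier f \<xi> = fourier (conv a h) \<xi> - of_real m * fourier h \<xi>"
        unfolding fourier_def f_def left_diff_distrib mult.assoc
        using fourier_integrable[OF conv_integrable[OF a hint], of \<xi>] fourier_integrable[OF hint, of \<xi>]
        by (simp add: mult.assoc)
      then show ?thesis by (simp add: fourier_conv[OF a hint] hhat algebra_simps)
    qed
    show "fourier f \<xi> \<in> \<real>" for \<xi>
      unfolding fhat by (intro Reals_mult Reals_diff fourier_real[OF a herm]) auto
    show "0 \<le> Re (fourier f \<xi>)" for \<xi>
      unfolding fhat using m[of \<xi>] by (simp del: of_real_power)
  qed
  moreover have "conv a h 0 = l2ip (conv a u) u"
    unfolding h_def by (rule conv_autocorrelation_at_0[OF a u])
  moreover have "h 0 = l2ip u u"
  proof -
    have "h 0 = (LINT y|lborel. u (0 - y) * cnj (u (0 - y)))" by (simp add: h_def conv_def)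
    also have "\<dots> = l2ip u u"
      unfolding l2ip_def by (rule LINT_lborel_reflect) measurable
    finally show ?thesis .
  qed
  ultimately show ?thesis
    by (simp add: f_def l2ip_self nrm2_square)
qed

text \<open>Both sides are continuous in the \<open>L2\<close> norm, and continuous functions of
  compact support are dense.\<close>

theorem conv_form_ge:
  fixes a u :: "real ^ 'd \<Rightarrow> complex"
  assumes a: "integrable lborel a" and herm: "hermitian_ae a"
    and m: "\<And>\<xi>. m \<le> Re (fourier a \<xi>)" and u: "u \<in> L2"
  shows "m * (nrm2 u)\<^sup>2 \<le> Re (l2ip (conv a u) u)"
proof -
  define q where "q = (\<lambda>u :: real ^ 'd \<Rightarrow> complex. Re (l2ip (conv a u) u) - m * (nrm2 u)\<^sup>2)"
  have A: "l2.bounded_op (conv a)" using a by (rule bounded_op_conv)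
  have AL: "v \<in> L2 \<Longrightarrow> conv a v \<in> L2" for v using conv_in_L2(1)[OF a] .
  define C where "C = norm1 a + \<bar>m\<bar>"
  have q_diff: "\<bar>q u - q b\<bar> \<le> C * (nrm2 (u - b) * (2 * nrm2 u + nrm2 (u - b)))" if b: "b \<in> L2" for b
  proof -
    let ?d = "u - b"
    have d: "?d \<in> L2" using u b by (rule l2.diff_H)
    have nb: "nrm2 b \<le> nrm2 u + nrm2 ?d"
      using l2.nrm_diff_ge[OF u b] by linarith
    have e: "l2ip (conv a u) u - l2ip (conv a b) b = l2ip (conv a ?d) u + l2ip (conv a b) ?d"
      using l2.bounded_opD(2)[OF A d b u] u b d AL by (simp add: l2.ip_diff_right)
    have "cmod (l2ip (conv a u) u - l2ip (conv a b) b) \<le> cmod (l2ip (conv a ?d) u) + cmod (l2ip (conv a b) ?d)"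
      unfolding e by (rule norm_triangle_ineq)
    also have "\<dots> \<le> nrm2 (conv a ?d) * nrm2 u + nrm2 (conv a b) * nrm2 ?d"
      by (intro add_mono l2.Cauchy_Schwarz AL d u b)
    also have "\<dots> \<le> norm1 a * nrm2 ?d * nrm2 u + norm1 a * nrm2 b * nrm2 ?d"
      using conv_in_L2(2)[OF a d] conv_in_L2(2)[OF a b] nrm2_nonneg by (intro add_mono mult_right_mono)
    also have "\<dots> = norm1 a * (nrm2 ?d * (nrm2 u + nrm2 b))" by (simp add: algebra_simps)
    also have "\<dots> \<le> norm1 a * (nrm2 ?d * (2 * nrm2 u + nrm2 ?d))"
      using nb nrm2_nonneg norm1_nonneg by (intro mult_left_mono) auto
    finally have 1: "\<bar>Re (l2ip (conv a u) u) - Re (l2ip (conv a b) b)\<bar> \<le> norm1 a * (nrm2 ?d * (2 * nrm2 u + nrm2 ?d))"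
      using abs_Re_le_cmod[of "l2ip (conv a u) u - l2ip (conv a b) b"] by simp
    have "\<bar>(nrm2 u)\<^sup>2 - (nrm2 b)\<^sup>2\<bar> = \<bar>nrm2 u - nrm2 b\<bar> * (nrm2 u + nrm2 b)"
      using nrm2_nonneg[of u] nrm2_nonneg[of b]
      by (simp add: power2_eq_square square_diff_square_factored abs_mult)
    also have "\<dots> \<le> nrm2 ?d * (2 * nrm2 u + nrm2 ?d)"
      using l2.nrm_diff_ge[OF u b] nb nrm2_nonneg by (intro mult_mono) (auto intro: add_nonneg_nonneg)
    finally have 2: "\<bar>m\<bar> * \<bar>(nrm2 u)\<^sup>2 - (nrm2 b)\<^sup>2\<bar> \<le> \<bar>m\<bar> * (nrm2 ?d * (2 * nrm2 u + nrm2 ?d))"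
      by (rule mult_left_mono) simp
    have "q u - q b = (Re (l2ip (conv a u) u) - Re (l2ip (conv a b) b)) - m * ((nrm2 u)\<^sup>2 - (nrm2 b)\<^sup>2)"
      by (simp add: q_def algebra_simps)
    then have "\<bar>q u - q b\<bar> \<le> \<bar>Re (l2ip (conv a u) u) - Re (l2ip (conv a b) b)\<bar> + \<bar>m\<bar> * \<bar>(nrm2 u)\<^sup>2 - (nrm2 b)\<^sup>2\<bar>"
      using abs_triangle_ineq4 by (simp flip: abs_mult)
    also have "\<dots> \<le> C * (nrm2 ?d * (2 * nrm2 u + nrm2 ?d))"
      using 1 2 by (simp add: C_def algebra_simps)
    finally show ?thesis .
  qed
  have "0 \<le> q u"
  proof (rule field_le_epsilon)
    fix e :: real assume e: "0 < e"
    have C0: "C \<ge> 0" by (simp add: C_def norm1_nonneg)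
    \<comment> \<open>The bound 1 replaces the factor \<open>2 * nrm2 u + nrm2 (u - b)\<close> by
      one that does not depend on \<open>b\<close>.\<close>
    define \<delta> where "\<delta> = min 1 (e / (C * (2 * nrm2 u + 1) + 1))"
    have den: "C * (2 * nrm2 u + 1) \<ge> 0" using C0 nrm2_nonneg[of u] by simp
    have \<delta>: "\<delta> > 0" using e den by (simp add: \<delta>_def)
    obtain b where b: "cpt_cont b" "nrm2 (u - b) < \<delta>" using cpt_cont_dense_L2[OF u \<delta>] by blast
    have bL: "b \<in> L2" using b(1) by (rule cpt_cont_L2)
    have "0 \<le> q b" using conv_form_ge_cpt_cont[OF a herm m b(1)] by (simp add: q_def)
    moreover have "C * (nrm2 (u - b) * (2 * nrm2 u + nrm2 (u - b))) \<le> e"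
    proof -
      have d1: "nrm2 (u - b) \<le> 1" "nrm2 (u - b) \<le> e / (C * (2 * nrm2 u + 1) + 1)"
        using b(2) by (simp_all add: \<delta>_def)
      have "C * (nrm2 (u - b) * (2 * nrm2 u + nrm2 (u - b)))
          \<le> C * (e / (C * (2 * nrm2 u + 1) + 1) * (2 * nrm2 u + 1))"
        using d1 C0 e den nrm2_nonneg[of u] nrm2_nonneg[of "u - b"] by (intro mult_left_mono mult_mono) auto
      also have "\<dots> = e * (C * (2 * nrm2 u + 1) / (C * (2 * nrm2 u + 1) + 1))" by simp
      also have "\<dots> \<le> e * 1" using e den by (intro mult_left_mono) auto
      finally show ?thesis by simp
    qed
    ultimately show "0 \<le> q u + e" using q_diff[OF bL] by linarith
  qed
  then show ?thesis by (simp add: q_def)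
qed

section \<open>Taylor expansion in the coordinates\<close>

lemma Ck_on_Suc_imp: "Ck_on (Suc k) f U \<Longrightarrow> Ck_on k f U"
proof (induction k arbitrary: f)
  case (Suc k)
  then have "continuous_on U f" "\<And>i x. x \<in> U \<Longrightarrow> has_partial_at i f x"
    and part: "\<And>i. Ck_on (Suc k) (partial i f) U"
    by (simp_all only: Ck_on.simps(2)[of "Suc k"])
  then show ?case using Suc.IH[OF part] by simp
qed simp

lemma Ck_on_le: "Ck_on k f U \<Longrightarrow> j \<le> k \<Longrightarrow> Ck_on j f U"
  by (induction k) (auto simp: le_Suc_eq dest: Ck_on_Suc_imp simp del: Ck_on.simps)

lemma Ck_on_funpow_partial: "Ck_on (j + k) f U \<Longrightarrow> Ck_on k ((partial i ^^ j) f) U"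
  by (induction j arbitrary: f) (auto simp: funpow_swap1)

text \<open>Generalizes \<open>mi_deriv\<close> to an arbitrary list of directions, so that the
  expansion can proceed by induction on the list.\<close>

definition list_deriv :: "'d::finite list \<Rightarrow> ('d \<Rightarrow> nat) \<Rightarrow> (real ^ 'd \<Rightarrow> complex) \<Rightarrow> real ^ 'd \<Rightarrow> complex" where
  "list_deriv L n f = foldr (\<lambda>i. partial i ^^ n i) L f"

lemma list_deriv_simps [simp]:
  "list_deriv [] n f = f" "list_deriv (i # L) n f = (partial i ^^ n i) (list_deriv L n f)"
  by (simp_all add: list_deriv_def)

lemma list_deriv_cong: "(\<And>i. i \<in> set L \<Longrightarrow> n i = m i) \<Longrightarrow> list_deriv L n f = list_deriv L m f"
  by (induction L) auto

lemma Ck_on_list_deriv: "Ck_on (sum_list (map n L) + k) f U \<Longrightarrow> Ck_on k (list_deriv L n f) U"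
  by (induction L arbitrary: k) (auto simp: add_ac intro: Ck_on_funpow_partial)

lemma has_vector_derivative_partial:
  assumes "has_partial_at i f (b + (s * t) *\<^sub>R axis i 1)"
  shows "((\<lambda>s. f (b + (s * t) *\<^sub>R axis i 1)) has_vector_derivative t *\<^sub>R partial i f (b + (s * t) *\<^sub>R axis i 1)) (at s)"
proof -
  let ?x = "b + (s * t) *\<^sub>R axis i 1"
  have "((\<lambda>u. f (?x + u *\<^sub>R axis i 1)) has_vector_derivative partial i f ?x) (at 0)"
    using assms unfolding has_partial_at_def partial_def by (simp add: vector_derivative_works)
  moreover have "((\<lambda>\<sigma>. (\<sigma> - s) * t) has_vector_derivative t) (at s)"
    by (auto intro!: derivative_eq_intros simp flip: has_real_derivative_iff_has_vector_derivative)
  ultimately have "((\<lambda>u. f (?x + u *\<^sub>R axis i 1)) \<circ> (\<lambda>\<sigma>. (\<sigma> - s) * t) has_vector_derivative t *\<^sub>R partial i f ?x) (at s)"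
    by (intro vector_diff_chain_at) simp_all
  moreover have "?x + ((\<sigma> - s) * t) *\<^sub>R axis i 1 = b + (\<sigma> * t) *\<^sub>R axis i 1" for \<sigma>
    by (simp add: algebra_simps)
  ultimately show ?thesis by (simp add: o_def)
qed

text \<open>The one-variable formula with integral remainder on the segment from \<open>b\<close>,
  parametrized by the unit interval; the weight of the remainder is simply bounded by 1.\<close>

lemma Taylor_coordinate:
  fixes f :: "real ^ 'd::finite \<Rightarrow> complex"
  assumes f: "Ck_on p f U" and seg: "\<And>s. 0 \<le> s \<Longrightarrow> s \<le> 1 \<Longrightarrow> b + (s * t) *\<^sub>R axis i 1 \<in> U"
    and M: "\<And>s. 0 \<le> s \<Longrightarrow> s \<le> 1 \<Longrightarrow> cmod ((partial i ^^ p) f (b + (s * t) *\<^sub>R axis i 1)) \<le> M"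
  shows "cmod (f (b + t *\<^sub>R axis i 1) - (\<Sum>j<p. of_real (t ^ j / fact j) * (partial i ^^ j) f b)) \<le> M * \<bar>t\<bar> ^ p"
proof (cases "p = 0")
  case True
  then show ?thesis using M[of 1] by simp
next
  case False
  have M0: "M \<ge> 0" using M[of 0] norm_ge_zero order_trans by blast
  \<comment> \<open>By the chain rule \<open>D j\<close> is the \<open>j\<close>-th derivative of
    \<open>f\<close> along the segment with respect to \<open>s\<close>.\<close>
  define D where "D j s = of_real (t ^ j) * (partial i ^^ j) f (b + (s * t) *\<^sub>R axis i 1)" for j s
  have "((\<lambda>x. ((1 - x) ^ (p - 1) / fact (p - 1)) *\<^sub>R D p x) has_integral
      D 0 1 - (\<Sum>j<p. ((1 - 0) ^ j / fact j) *\<^sub>R D j 0)) {0..1}"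
  proof (rule Taylor_has_integral)
    fix m s :: real and j assume "j < p" "0 \<le> s" "s \<le> 1"
    have "Ck_on (Suc 0) ((partial i ^^ j) f) U"
      by (rule Ck_on_funpow_partial[of j]) (use f \<open>j < p\<close> in \<open>auto intro: Ck_on_le simp del: Ck_on.simps\<close>)
    then have "has_partial_at i ((partial i ^^ j) f) (b + (s * t) *\<^sub>R axis i 1)"
      using seg[of s] \<open>0 \<le> s\<close> \<open>s \<le> 1\<close> by simp
    from has_vector_derivative_partial[OF this]
    have "(D j has_vector_derivative of_real (t ^ j) * (t *\<^sub>R partial i ((partial i ^^ j) f) (b + (s * t) *\<^sub>R axis i 1))) (at s)"
      unfolding D_def by (intro has_vector_derivative_mult_right)
    also have "of_real (t ^ j) * (t *\<^sub>R partial i ((partial i ^^ j) f) (b + (s * t) *\<^sub>R axis i 1)) = D (Suc j) s"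
      by (simp add: D_def scaleR_conv_of_real mult_ac)
    finally show "(D j has_vector_derivative D (Suc j) s) (at s within {0..1})"
      by (rule has_vector_derivative_at_within)
  qed (use False in auto)
  moreover have "norm (((1 - x) ^ (p - 1) / fact (p - 1)) *\<^sub>R D p x) \<le> M * \<bar>t\<bar> ^ p" if "x \<in> {0..1}" for x
  proof -
    have x: "0 \<le> x" "x \<le> 1" using that by auto
    have "(1 - x) ^ (p - 1) \<le> 1" using x by (intro power_le_one) auto
    also have "(1::real) \<le> fact (p - 1)" by (rule fact_ge_1)
    finally have "(1 - x) ^ (p - 1) / fact (p - 1) \<le> 1" by simp
    moreover have nonneg: "0 \<le> (1 - x) ^ (p - 1) / fact (p - 1)" using x by simp
    moreover have "norm (D p x) \<le> M * \<bar>t\<bar> ^ p"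
      using mult_left_mono[OF M[OF x], of "\<bar>t\<bar> ^ p"] by (simp add: D_def norm_mult norm_power mult.commute)
    ultimately show ?thesis
      using mult_mono[of "(1 - x) ^ (p - 1) / fact (p - 1)" 1 "norm (D p x)" "M * \<bar>t\<bar> ^ p"]
      unfolding norm_scaleR abs_of_nonneg[OF nonneg] by simp
  qed
  ultimately have "norm (D 0 1 - (\<Sum>j<p. ((1 - 0) ^ j / fact j) *\<^sub>R D j 0)) \<le> M * \<bar>t\<bar> ^ p * measure lborel {0..1::real}"
    by (intro has_integral_bound_real) (use M0 in auto)
  then show ?thesis
    by (simp add: D_def scaleR_conv_of_real)
qed

section \<open>Expansion in all coordinates\<close>

definition mi_fact :: "('d::finite \<Rightarrow> nat) \<Rightarrow> real" where
  "mi_fact n = (\<Prod>i\<in>UNIV. fact (n i))"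

definition mi_on :: "'d::finite list \<Rightarrow> nat \<Rightarrow> ('d \<Rightarrow> nat) set" where
  "mi_on L K = {n. (\<forall>i. i \<notin> set L \<longrightarrow> n i = 0) \<and> mi_abs n \<le> K}"

definition restrict_coords :: "'d list \<Rightarrow> real ^ 'd \<Rightarrow> real ^ 'd" where
  "restrict_coords L z = (\<chi> i. if i \<in> set L then z $ i else 0)"

lemma finite_mi_on: "finite (mi_on L K)"
  by (rule finite_subset[OF _ finite_mi_upto[of K]]) (auto simp: mi_on_def mi_upto_def)

lemma mi_abs_upd: "n i = 0 \<Longrightarrow> mi_abs (n(i := k)) = k + mi_abs n"
  unfolding mi_abs_def by (simp add: sum.remove[of UNIV i])

lemma mi_power_upd: "n (i :: 'd::finite) = 0 \<Longrightarrow> mi_power z (n(i := k)) = (z $ i) ^ k * mi_power z n"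
  unfolding mi_power_def by (simp add: prod.remove[of UNIV i])

lemma mi_fact_upd: "n i = 0 \<Longrightarrow> mi_fact (n(i := k)) = fact k * mi_fact n"
  unfolding mi_fact_def by (simp add: prod.remove[of UNIV i])

lemma mi_fact_pos: "mi_fact n > 0"
  by (simp add: mi_fact_def prod_pos)

lemma mi_fact_ge_1: "mi_fact n \<ge> 1"
  unfolding mi_fact_def by (intro prod_ge_1) (simp add: fact_ge_1)

lemma abs_mi_power_le:
  fixes z :: "real ^ 'd::finite"
  assumes "\<And>i. \<bar>z $ i\<bar> \<le> \<tau>"
  shows "\<bar>mi_power z n\<bar> \<le> \<tau> ^ mi_abs n"
proof -
  have "\<bar>mi_power z n\<bar> = (\<Prod>i\<in>UNIV. \<bar>z $ i\<bar> ^ n i)"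
    by (simp add: mi_power_def abs_prod power_abs)
  also have "\<dots> \<le> (\<Prod>i\<in>UNIV. \<tau> ^ n i)" by (intro prod_mono conjI power_mono assms) auto
  also have "\<dots> = \<tau> ^ mi_abs n" by (simp add: mi_abs_def power_sum)
  finally show ?thesis .
qed

lemma mi_abs_list: "distinct L \<Longrightarrow> n \<in> mi_on L K \<Longrightarrow> sum_list (map n L) = mi_abs n"
  unfolding mi_abs_def mi_on_def
  by (subst sum_list_distinct_conv_sum_set) (auto intro: sum.mono_neutral_left)

text \<open>Splits off the exponent of \<open>i\<close>. Its range, up to
  \<open>K - mi_abs n\<close>, is exactly the order to which the coefficient belonging to
  \<open>n\<close> is expanded in direction \<open>i\<close>.\<close>

lemma sum_mi_on_Cons:
  assumes i: "i \<notin> set L"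
  shows "(\<Sum>n\<in>mi_on (i # L) K. g n) = (\<Sum>n\<in>mi_on L K. \<Sum>k<Suc (K - mi_abs n). g (n(i := k)))"
proof -
  let ?S = "SIGMA n:mi_on L K. {..<Suc (K - mi_abs n)}"
  have zero: "n i = 0" if "n \<in> mi_on L K" for n using that i by (simp add: mi_on_def)
  have "(\<Sum>n\<in>mi_on L K. \<Sum>k<Suc (K - mi_abs n). g (n(i := k))) = (\<Sum>(n, k)\<in>?S. g (n(i := k)))"
    by (rule sum.Sigma) (auto simp: finite_mi_on)
  also have "\<dots> = (\<Sum>n\<in>mi_on (i # L) K. g n)"
  proof (rule sum.reindex_bij_witness[where j = "\<lambda>(n, k). n(i := k)" and i = "\<lambda>n. (n(i := 0), n i)"])
    fix p assume "p \<in> ?S"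
    then obtain n k where p: "p = (n, k)" "n \<in> mi_on L K" "k \<le> K - mi_abs n" by auto
    show "(case p of (n, k) \<Rightarrow> n(i := k)) \<in> mi_on (i # L) K"
      using p zero[OF p(2)] i by (auto simp: mi_on_def mi_abs_upd)
    show "((case p of (n, k) \<Rightarrow> n(i := k))(i := 0), (case p of (n, k) \<Rightarrow> n(i := k)) i) = p"
      using p zero[OF p(2)] by (auto simp: fun_eq_iff)
  next
    fix n assume n: "n \<in> mi_on (i # L) K"
    have "mi_abs n = n i + mi_abs (n(i := 0))" using mi_abs_upd[of "n(i := 0)" i "n i"] by simp
    then show "(n(i := 0), n i) \<in> ?S" using n i by (auto simp: mi_on_def)
  qed auto
  finally show ?thesis ..
qed

text \<open>The coordinates are expanded in the order in which \<open>mi_deriv\<close> differentiates, so that no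
  symmetry of mixed partial derivatives is needed.\<close>

lemma Taylor_coordinates:
  fixes f :: "real ^ 'd::finite \<Rightarrow> complex"
  assumes r: "r > 0" and f: "Ck_on (Suc K) f (cube r 0)" and L: "distinct L"
  shows "\<exists>C\<ge>0. \<forall>b z \<tau>. (\<forall>j. \<bar>b $ j\<bar> + \<bar>z $ j\<bar> \<le> r / 4) \<longrightarrow> (\<forall>j. \<bar>z $ j\<bar> \<le> \<tau>) \<longrightarrow>
    cmod (f (b + restrict_coords L z) - (\<Sum>n\<in>mi_on L K. of_real (mi_power z n / mi_fact n) * list_deriv L n f b))
      \<le> C * \<tau> ^ Suc K"
  using L
proof (induction L)
  case Nil
  have "mi_on ([] :: 'd list) K = {\<lambda>_. 0 :: nat}" by (auto simp: mi_on_def mi_abs_def)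
  moreover have "restrict_coords [] z = 0" for z :: "real ^ 'd"
    by (simp add: restrict_coords_def vec_eq_iff)
  ultimately show ?case
    by (intro exI[of _ 0]) (simp add: mi_power_def mi_fact_def)
next
  case (Cons i L)
  then have i: "i \<notin> set L" and L: "distinct L" by auto
  obtain C where C: "C \<ge> 0" and IH: "\<And>(b :: real ^ 'd) z \<tau>. (\<forall>j. \<bar>b $ j\<bar> + \<bar>z $ j\<bar> \<le> r / 4) \<Longrightarrow> (\<forall>j. \<bar>z $ j\<bar> \<le> \<tau>) \<Longrightarrow>
    cmod (f (b + restrict_coords L z) - (\<Sum>n\<in>mi_on L K. of_real (mi_power z n / mi_fact n) * list_deriv L n f b))
      \<le> C * \<tau> ^ Suc K"
    using Cons.IH[OF L] by blast
  \<comment> \<open>A compact cube inside the open \<open>cube r 0\<close>, on which the highest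
    derivatives are bounded; all segments used below stay in it.\<close>
  define Q where "Q = {x :: real ^ 'd. \<forall>j. \<bar>x $ j\<bar> \<le> r / 4}"
  have Q: "compact Q"
  proof -
    have "\<bar>y\<bar> \<le> r / 4 \<longleftrightarrow> - (r / 4) \<le> y \<and> y \<le> r / 4" for y by linarith
    then have "Q = cbox (\<chi> j. - (r / 4)) (\<chi> j. r / 4)"
      by (simp only: Q_def mem_box_cart set_eq_iff mem_Collect_eq vec_lambda_beta simp_thms)
    then show ?thesis by simp
  qed
  have QU: "Q \<subseteq> cube r 0"
  proof
    fix x assume "x \<in> Q"
    then have "\<bar>x $ j\<bar> \<le> r / 4" for j by (simp add: Q_def)
    moreover have "r / 4 < r / 2" using r by simp
    ultimately have "\<bar>x $ j\<bar> < r / 2" for j by (rule le_less_trans)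
    then show "x \<in> cube r 0" by (simp add: cube_def)
  qed
  have smooth: "Ck_on (Suc K - mi_abs n) (list_deriv L n f) (cube r 0)" if n: "n \<in> mi_on L K" for n
  proof (rule Ck_on_list_deriv)
    have "mi_abs n \<le> K" using n by (simp add: mi_on_def)
    then have "sum_list (map n L) + (Suc K - mi_abs n) = Suc K"
      using mi_abs_list[OF L n] by simp
    then show "Ck_on (sum_list (map n L) + (Suc K - mi_abs n)) f (cube r 0)" using f by (simp only:)
  qed
  have "\<exists>M\<ge>0. \<forall>x\<in>Q. cmod ((partial i ^^ (Suc K - mi_abs n)) (list_deriv L n f) x) \<le> M" if n: "n \<in> mi_on L K" for n
  proof -
    have "Ck_on 0 ((partial i ^^ (Suc K - mi_abs n)) (list_deriv L n f)) (cube r 0)"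
      by (rule Ck_on_funpow_partial) (use smooth[OF n] in \<open>simp del: Ck_on.simps\<close>)
    then have "continuous_on Q ((partial i ^^ (Suc K - mi_abs n)) (list_deriv L n f))"
      using QU by (auto intro: continuous_on_subset)
    then have "bounded ((partial i ^^ (Suc K - mi_abs n)) (list_deriv L n f) ` Q)"
      using Q by (intro compact_imp_bounded compact_continuous_image)
    then show ?thesis by (auto simp: bounded_pos intro: less_imp_le)
  qed
  then obtain M where M: "\<And>n. n \<in> mi_on L K \<Longrightarrow> M n \<ge> 0"
    "\<And>n x. n \<in> mi_on L K \<Longrightarrow> x \<in> Q \<Longrightarrow> cmod ((partial i ^^ (Suc K - mi_abs n)) (list_deriv L n f) x) \<le> M n"
    by metis
  define C' where "C' = C + (\<Sum>n\<in>mi_on L K. M n)"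
  have "cmod (f (b + restrict_coords (i # L) z)
      - (\<Sum>n\<in>mi_on (i # L) K. of_real (mi_power z n / mi_fact n) * list_deriv (i # L) n f b)) \<le> C' * \<tau> ^ Suc K"
    if bz: "\<forall>j. \<bar>b $ j\<bar> + \<bar>z $ j\<bar> \<le> r / 4" and z\<tau>: "\<forall>j. \<bar>z $ j\<bar> \<le> \<tau>" for b z :: "real ^ 'd" and \<tau>
  proof -
    have \<tau>: "0 \<le> \<tau>" using z\<tau> abs_ge_zero order_trans by blast
    define t where "t = z $ i"
    \<comment> \<open>The displacement in direction \<open>i\<close> moves into the base point. The
      induction hypothesis expands at \<open>b'\<close> in the other coordinates, and its
      coefficients are then expanded from \<open>b\<close> along direction \<open>i\<close>. The sum
      bounded by \<open>r / 4\<close> does not grow under this move.\<close>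
    define b' where "b' = b + t *\<^sub>R axis i 1"
    define z' where "z' = (\<chi> j. if j = i then 0 else z $ j)"
    have b'z': "\<forall>j. \<bar>b' $ j\<bar> + \<bar>z' $ j\<bar> \<le> r / 4"
    proof
      fix j
      show "\<bar>b' $ j\<bar> + \<bar>z' $ j\<bar> \<le> r / 4"
        using bz[rule_format, of j] abs_triangle_ineq[of "b $ i" "z $ i"]
        by (auto simp: b'_def z'_def t_def axis_def)
    qed
    have z'\<tau>: "\<forall>j. \<bar>z' $ j\<bar> \<le> \<tau>" using z\<tau> \<tau> by (simp add: z'_def)
    have point: "b' + restrict_coords L z' = b + restrict_coords (i # L) z"
      using i by (auto simp: b'_def z'_def restrict_coords_def vec_eq_iff t_def axis_def)
    have pow: "mi_power z' n = mi_power z n" if "n \<in> mi_on L K" for n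
      unfolding mi_power_def
      by (rule prod.cong) (use that i in \<open>auto simp: z'_def mi_on_def\<close>)
    let ?T = "\<lambda>n. (\<Sum>k<Suc (K - mi_abs n). of_real (t ^ k / fact k) * (partial i ^^ k) (list_deriv L n f) b)"
    have sum_eq: "(\<Sum>n\<in>mi_on (i # L) K. of_real (mi_power z n / mi_fact n) * list_deriv (i # L) n f b)
        = (\<Sum>n\<in>mi_on L K. of_real (mi_power z n / mi_fact n) * ?T n)"
      unfolding sum_mi_on_Cons[OF i] sum_distrib_left
    proof (intro sum.cong refl)
      fix n k assume n: "n \<in> mi_on L K"
      have n0: "n i = 0" using n i by (simp add: mi_on_def)
      have "list_deriv L (n(i := k)) f = list_deriv L n f" using i by (intro list_deriv_cong) auto
      then show "of_real (mi_power z (n(i := k)) / mi_fact (n(i := k))) * list_deriv (i # L) (n(i := k)) f b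
        = of_real (mi_power z n / mi_fact n) * (of_real (t ^ k / fact k) * (partial i ^^ k) (list_deriv L n f) b)"
        by (simp add: mi_power_upd[of n i, OF n0] mi_fact_upd[of n i, OF n0] t_def mult_ac)
    qed
    have step: "cmod (list_deriv L n f b' - ?T n) \<le> M n * \<tau> ^ (Suc K - mi_abs n)" if n: "n \<in> mi_on L K" for n
    proof -
      have nK: "mi_abs n \<le> K" using n by (simp add: mi_on_def)
      then have eq: "Suc K - mi_abs n = Suc (K - mi_abs n)" by simp
      have seg: "b + (s * t) *\<^sub>R axis i 1 \<in> Q" if s: "0 \<le> s" "s \<le> 1" for s
      proof -
        have "\<bar>(b + (s * t) *\<^sub>R axis i 1) $ j\<bar> \<le> r / 4" for j
        proof (cases "j = i")
          case True
          have "\<bar>b $ i + s * t\<bar> \<le> \<bar>b $ i\<bar> + \<bar>s * t\<bar>" by (rule abs_triangle_ineq)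
          also have "\<bar>s * t\<bar> \<le> \<bar>z $ i\<bar>" using s by (simp add: abs_mult t_def mult_left_le_one_le)
          finally show ?thesis using bz[rule_format, of i] True by (simp add: axis_def)
        next
          case False
          then show ?thesis using bz[rule_format, of j] by (simp add: axis_def)
        qed
        then show ?thesis by (simp add: Q_def)
      qed
      have "cmod (list_deriv L n f (b + t *\<^sub>R axis i 1)
        - (\<Sum>j<Suc K - mi_abs n. of_real (t ^ j / fact j) * (partial i ^^ j) (list_deriv L n f) b))
        \<le> M n * \<bar>t\<bar> ^ (Suc K - mi_abs n)"
        by (rule Taylor_coordinate[OF smooth[OF n]]) (use seg QU M(2)[OF n] in auto)
      also have "\<dots> \<le> M n * \<tau> ^ (Suc K - mi_abs n)"
        using M(1)[OF n] z\<tau> by (intro mult_left_mono power_mono) (auto simp: t_def)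
      finally show ?thesis by (simp only: b'_def eq)
    qed
    let ?S = "\<Sum>n\<in>mi_on L K. of_real (mi_power z n / mi_fact n) * list_deriv L n f b'"
    have first: "cmod (f (b + restrict_coords (i # L) z) - ?S) \<le> C * \<tau> ^ Suc K"
      using IH[OF b'z' z'\<tau>] unfolding point by (simp add: pow)
    have "?S - (\<Sum>n\<in>mi_on L K. of_real (mi_power z n / mi_fact n) * ?T n)
        = (\<Sum>n\<in>mi_on L K. of_real (mi_power z n / mi_fact n) * (list_deriv L n f b' - ?T n))"
      by (simp only: sum_subtractf[symmetric] right_diff_distrib)
    also have "cmod \<dots> \<le> (\<Sum>n\<in>mi_on L K. M n * \<tau> ^ Suc K)"
    proof (rule sum_norm_le)
      fix n assume n: "n \<in> mi_on L K"
      have nK: "mi_abs n \<le> K" using n by (simp add: mi_on_def)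
      have "\<bar>mi_power z n / mi_fact n\<bar> = \<bar>mi_power z n\<bar> / mi_fact n" using mi_fact_pos[of n] by simp
      also have "\<dots> \<le> \<bar>mi_power z n\<bar> / 1" using mi_fact_ge_1[of n] by (intro divide_left_mono) auto
      also have "\<dots> \<le> \<tau> ^ mi_abs n" using abs_mi_power_le[of z \<tau> n] z\<tau> by simp
      finally have "\<bar>mi_power z n / mi_fact n\<bar> \<le> \<tau> ^ mi_abs n" .
      then have "cmod (of_real (mi_power z n / mi_fact n) * (list_deriv L n f b' - ?T n))
        \<le> \<tau> ^ mi_abs n * (M n * \<tau> ^ (Suc K - mi_abs n))"
        unfolding norm_mult norm_of_real using step[OF n] \<tau> by (intro mult_mono) auto
      also have "\<dots> = M n * \<tau> ^ Suc K"
        using nK by (simp add: mult.left_commute power_add[symmetric])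
      finally show "cmod (of_real (mi_power z n / mi_fact n) * (list_deriv L n f b' - ?T n)) \<le> M n * \<tau> ^ Suc K" .
    qed
    also have "\<dots> = (\<Sum>n\<in>mi_on L K. M n) * \<tau> ^ Suc K" by (rule sum_distrib_right[symmetric])
    finally have second: "cmod (?S - (\<Sum>n\<in>mi_on L K. of_real (mi_power z n / mi_fact n) * ?T n))
      \<le> (\<Sum>n\<in>mi_on L K. M n) * \<tau> ^ Suc K" .
    have "cmod (f (b + restrict_coords (i # L) z) - (\<Sum>n\<in>mi_on L K. of_real (mi_power z n / mi_fact n) * ?T n))
      \<le> C * \<tau> ^ Suc K + (\<Sum>n\<in>mi_on L K. M n) * \<tau> ^ Suc K"
      by (rule norm_diff_triangle_le[OF first second])
    also have "\<dots> = C' * \<tau> ^ Suc K" by (simp only: C'_def distrib_right)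
    finally show ?thesis unfolding sum_eq .
  qed
  moreover have "C' \<ge> 0" using C M(1) by (auto simp: C'_def intro!: add_nonneg_nonneg sum_nonneg)
  ultimately show ?case by blast
qed

theorem Taylor_mi_deriv:
  fixes f :: "real ^ 'd::finite \<Rightarrow> complex"
  assumes "r > 0" "Ck_on (Suc K) f (cube r 0)"
  obtains C where "C \<ge> 0" "\<And>z \<tau>. \<tau> \<le> r / 4 \<Longrightarrow> (\<And>j. \<bar>z $ j\<bar> \<le> \<tau>) \<Longrightarrow>
    cmod (f z - (\<Sum>n\<in>mi_upto K. of_real (mi_power z n / mi_fact n) * mi_deriv n f 0)) \<le> C * \<tau> ^ Suc K"
proof -
  obtain C where C: "C \<ge> 0" and T: "\<And>(b :: real ^ 'd) z \<tau>. (\<forall>j. \<bar>b $ j\<bar> + \<bar>z $ j\<bar> \<le> r / 4) \<Longrightarrow> (\<forall>j. \<bar>z $ j\<bar> \<le> \<tau>) \<Longrightarrow>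
    cmod (f (b + restrict_coords coord_enum z)
      - (\<Sum>n\<in>mi_on coord_enum K. of_real (mi_power z n / mi_fact n) * list_deriv coord_enum n f b)) \<le> C * \<tau> ^ Suc K"
    using Taylor_coordinates[OF assms coord_enum(1)] by blast
  have on: "mi_on (coord_enum :: 'd list) K = mi_upto K"
    by (simp add: mi_on_def mi_upto_def coord_enum(2))
  have restr: "restrict_coords coord_enum z = z" for z :: "real ^ 'd"
    by (simp add: restrict_coords_def coord_enum(2))
  have deriv: "list_deriv coord_enum n f = mi_deriv n f" for n
    by (simp add: list_deriv_def mi_deriv_def)
  show thesis
  proof (rule that[OF C])
    fix z :: "real ^ 'd" and \<tau> assume \<tau>: "\<tau> \<le> r / 4" "\<And>j. \<bar>z $ j\<bar> \<le> \<tau>"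
    have c1: "\<forall>j. \<bar>(0 :: real ^ 'd) $ j\<bar> + \<bar>z $ j\<bar> \<le> r / 4" using order.trans[OF \<tau>(2,1)] by simp
    have c2: "\<forall>j. \<bar>z $ j\<bar> \<le> \<tau>" using \<tau>(2) by blast
    show "cmod (f z - (\<Sum>n\<in>mi_upto K. of_real (mi_power z n / mi_fact n) * mi_deriv n f 0)) \<le> C * \<tau> ^ Suc K"
      using T[OF c1 c2] unfolding on restr deriv add_0_left .
  qed
qed

section \<open>Orthogonal polynomials and trial functions\<close>

text \<open>The interval is open so that products over the coordinates give the indicator of
  \<open>cube 1 0\<close>.\<close>

definition unit_ind :: "real \<Rightarrow> complex" where
  "unit_ind t = indicator {-1/2<..<1/2} t"

lemma unit_ind_measurable [measurable]: "unit_ind \<in> borel_measurable borel"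
  unfolding unit_ind_def[abs_def] by measurable

lemma integrable_unit_ind:
  assumes [measurable]: "f \<in> borel_measurable borel" and f: "\<And>t. \<bar>t\<bar> < 1 / 2 \<Longrightarrow> cmod (f t) \<le> M"
  shows "integrable lborel (\<lambda>t. unit_ind t * f t)"
proof (rule integrable_bounded_support[where M = "max M 0" and R = "1 / 2"])
  show "norm (unit_ind t * f t) \<le> max M 0" for t
    using f[of t] by (cases "\<bar>t\<bar> < 1 / 2") (auto simp: unit_ind_def indicator_def norm_mult)
  show "unit_ind t * f t = 0" if "norm t > 1 / 2" for t
    using that by (auto simp: unit_ind_def indicator_def)
qed measurable

lemma integrable_unit_monomial: "integrable lborel (\<lambda>t. unit_ind t * of_real t ^ k)"
  by (rule integrable_unit_ind[where M = 1])
    (auto simp: norm_power intro!: power_le_one)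

text \<open>The \<open>l\<close> conditions on \<open>l + 1\<close> coefficients have a nonzero
  solution. If its \<open>l\<close>-th moment vanished as well, the polynomial would be orthogonal
  to itself, hence zero almost everywhere on the interval, although it has finitely many roots. So
  it can be rescaled.\<close>

lemma orthogonal_polynomial_exists:
  "\<exists>c. (\<forall>j<l. (LINT t|lborel. unit_ind t * (\<Sum>i\<le>l. c i * of_real t ^ i) * of_real t ^ j) = 0) \<and>
    (LINT t|lborel. unit_ind t * (\<Sum>i\<le>l. c i * of_real t ^ i) * of_real t ^ l) = 1"
proof -
  define \<mu> where "\<mu> k = (LINT t|lborel. unit_ind t * of_real t ^ k)" for k
  have moment: "(LINT t|lborel. unit_ind t * (\<Sum>i\<le>l. c i * of_real t ^ i) * of_real t ^ j) = (\<Sum>i\<le>l. c i * \<mu> (i + j))"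
    for c j
  proof -
    have "(LINT t|lborel. unit_ind t * (\<Sum>i\<le>l. c i * of_real t ^ i) * of_real t ^ j)
        = (LINT t|lborel. (\<Sum>i\<le>l. c i * (unit_ind t * of_real t ^ (i + j))))"
      by (simp add: sum_distrib_left sum_distrib_right power_add mult_ac)
    also have "\<dots> = (\<Sum>i\<le>l. c i * \<mu> (i + j))"
      unfolding \<mu>_def
      by (subst Bochner_Integration.integral_sum) (auto intro: integrable_unit_monomial)
    finally show ?thesis .
  qed
  obtain c where c: "\<exists>i<Suc l. c i \<noteq> 0" "\<And>j. j < l \<Longrightarrow> (\<Sum>i<Suc l. c i * \<mu> (i + j)) = 0"
    using underdetermined_system[of l "Suc l" "\<lambda>j i. \<mu> (i + j)"] by auto
  define p where "p t = (\<Sum>i\<le>l. c i * of_real t ^ i)" for t :: real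
  define \<kappa> where "\<kappa> = (\<Sum>i\<le>l. c i * \<mu> (i + l))"
  have low: "(\<Sum>i\<le>l. c i * \<mu> (i + j)) = 0" if "j < l" for j
    using c(2)[OF that] by (simp add: lessThan_Suc_atMost)
  have p_meas [measurable]: "p \<in> borel_measurable borel"
    unfolding p_def by measurable
  have "\<kappa> \<noteq> 0"
  proof
    assume "\<kappa> = 0"
    then have all0: "(\<Sum>i\<le>l. c i * \<mu> (i + j)) = 0" if "j \<le> l" for j
      using low that by (cases "j = l") (auto simp: \<kappa>_def)
    have "cnj (p t) = (\<Sum>j\<le>l. cnj (c j) * of_real t ^ j)" for t by (simp add: p_def)
    then have "unit_ind t * p t * cnj (p t) = (\<Sum>j\<le>l. cnj (c j) * (unit_ind t * p t * of_real t ^ j))" for t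
      by (simp add: sum_distrib_left mult_ac)
    then have "(LINT t|lborel. unit_ind t * p t * cnj (p t))
        = (LINT t|lborel. (\<Sum>j\<le>l. cnj (c j) * (unit_ind t * p t * of_real t ^ j)))"
      by (simp only:)
    also have "\<dots> = (\<Sum>j\<le>l. cnj (c j) * (LINT t|lborel. unit_ind t * p t * of_real t ^ j))"
    proof (subst Bochner_Integration.integral_sum)
      fix j
      have "cmod (p t * of_real t ^ j) \<le> (\<Sum>i\<le>l. cmod (c i)) * 1" if "\<bar>t\<bar> < 1 / 2" for t
        unfolding norm_mult
      proof (intro mult_mono)
        show "cmod (p t) \<le> (\<Sum>i\<le>l. cmod (c i))"
          unfolding p_def
          by (rule sum_norm_le) (use that in \<open>auto simp: norm_mult norm_power intro!: mult_left_le power_le_one\<close>)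
        show "cmod (of_real t ^ j) \<le> 1" using that by (auto simp: norm_power intro!: power_le_one)
      qed (auto intro: sum_nonneg)
      then have "integrable lborel (\<lambda>t. unit_ind t * (p t * of_real t ^ j))"
        by (intro integrable_unit_ind) auto
      then show "integrable lborel (\<lambda>t. cnj (c j) * (unit_ind t * p t * of_real t ^ j))"
        by (simp add: mult.assoc)
    qed simp
    also have "\<dots> = 0"
      unfolding p_def moment by (simp add: all0)
    finally have int0: "(LINT t|lborel. unit_ind t * p t * cnj (p t)) = 0" .
    define g where "g t = indicator {-1/2<..<1/2} t * (cmod (p t))\<^sup>2" for t :: real
    have g: "unit_ind t * p t * cnj (p t) = of_real (g t)" for t
      using complex_norm_square[of "p t"] by (simp add: unit_ind_def g_def indicator_def mult.assoc)
    have gint: "integrable lborel g"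
    proof -
      have "cmod (p t * cnj (p t)) \<le> (\<Sum>i\<le>l. cmod (c i))\<^sup>2" if "\<bar>t\<bar> < 1 / 2" for t
      proof -
        have "cmod (p t) \<le> (\<Sum>i\<le>l. cmod (c i))"
          unfolding p_def
          by (rule sum_norm_le) (use that in \<open>auto simp: norm_mult norm_power intro!: mult_left_le power_le_one\<close>)
        from power_mono[OF this, of 2] show ?thesis by (simp add: norm_mult power2_eq_square)
      qed
      then have "integrable lborel (\<lambda>t. unit_ind t * (p t * cnj (p t)))"
        by (intro integrable_unit_ind) auto
      then have "integrable lborel (\<lambda>t. complex_of_real (g t))" by (simp add: g[symmetric] mult.assoc)
      from integrable_Re[OF this] show ?thesis by simp
    qed
    have "(LINT t|lborel. g t) = 0"
      using int0 unfolding g by (simp add: integral_complex_of_real)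
    then have g0: "AE t in lborel. g t = 0"
      by (subst (asm) integral_nonneg_eq_0_iff_AE[OF gint]) (auto simp: g_def)
    have fin: "finite {t::real. p t = 0}"
    proof -
      have "finite {z::complex. (\<Sum>i\<le>l. c i * z ^ i) = 0}"
        using c(1) by (subst polyfun_finite_roots) (auto simp: less_Suc_eq_le)
      then have "finite (complex_of_real -` {z::complex. (\<Sum>i\<le>l. c i * z ^ i) = 0})"
        by (rule finite_vimageI) (simp add: inj_def)
      then show ?thesis by (simp add: p_def vimage_def)
    qed
    have "AE t in lborel. t \<notin> {t::real. p t = 0}"
      using fin by (intro AE_not_in finite_imp_null_set_lborel)
    with g0 have "AE t in lborel. t \<notin> {-1/2<..<1/2::real}"
      by eventually_elim (auto simp: g_def indicator_def split: if_splits)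
    then have "emeasure lborel {-1/2<..<1/2::real} = 0"
      by (subst (asm) AE_iff_measurable[of "{-1/2<..<1/2}"]) auto
    then show False by simp
  qed
  have "(\<Sum>i\<le>l. c i / \<kappa> * \<mu> (i + j)) = (\<Sum>i\<le>l. c i * \<mu> (i + j)) / \<kappa>" for j
    by (simp add: sum_divide_distrib)
  then show ?thesis
    using low \<open>\<kappa> \<noteq> 0\<close> unfolding moment by (intro exI[of _ "\<lambda>i. c i / \<kappa>"]) (simp add: \<kappa>_def)
qed

definition orth_coeff :: "nat \<Rightarrow> nat \<Rightarrow> complex" where
  "orth_coeff l = (SOME c. (\<forall>j<l. (LINT t|lborel. unit_ind t * (\<Sum>i\<le>l. c i * of_real t ^ i) * of_real t ^ j) = 0) \<and>
    (LINT t|lborel. unit_ind t * (\<Sum>i\<le>l. c i * of_real t ^ i) * of_real t ^ l) = 1)"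

text \<open>The Legendre polynomial of the interval from -1/2 to 1/2, cut off there and normalized
  by its \<open>l\<close>-th moment instead of its norm.\<close>

definition orth_poly :: "nat \<Rightarrow> real \<Rightarrow> complex" where
  "orth_poly l t = unit_ind t * (\<Sum>i\<le>l. orth_coeff l i * of_real t ^ i)"

definition orth_moment :: "nat \<Rightarrow> nat \<Rightarrow> complex" where
  "orth_moment l j = (LINT t|lborel. orth_poly l t * of_real t ^ j)"

lemma orth_moment:
  "j < l \<Longrightarrow> orth_moment l j = 0" "orth_moment l l = 1"
  using someI_ex[OF orthogonal_polynomial_exists[of l]]
  unfolding orth_moment_def orth_poly_def orth_coeff_def by auto

lemma orth_poly_measurable [measurable]: "orth_poly l \<in> borel_measurable borel"
  unfolding orth_poly_def[abs_def] by measurable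

lemma orth_poly_zero: "\<bar>t\<bar> \<ge> 1 / 2 \<Longrightarrow> orth_poly l t = 0"
  by (auto simp: orth_poly_def unit_ind_def indicator_def)

lemma orth_poly_bound: "cmod (orth_poly l t) \<le> (\<Sum>i\<le>l. cmod (orth_coeff l i))"
proof (cases "\<bar>t\<bar> < 1 / 2")
  case True
  have "cmod (\<Sum>i\<le>l. orth_coeff l i * of_real t ^ i) \<le> (\<Sum>i\<le>l. cmod (orth_coeff l i))"
    by (rule sum_norm_le) (use True in \<open>auto simp: norm_mult norm_power intro!: mult_left_le power_le_one\<close>)
  then show ?thesis by (auto simp: orth_poly_def unit_ind_def indicator_def norm_mult intro: sum_nonneg)
qed (simp add: orth_poly_zero sum_nonneg)

lemma orth_poly_mult_integrable:
  assumes [measurable]: "f \<in> borel_measurable borel" and f: "\<And>t. \<bar>t\<bar> < 1 / 2 \<Longrightarrow> cmod (f t) \<le> M"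
  shows "integrable lborel (\<lambda>t. orth_poly l t * f t)"
proof (rule integrable_bounded_support[where M = "(\<Sum>i\<le>l. cmod (orth_coeff l i)) * max M 0" and R = "1 / 2"])
  show "norm (orth_poly l t * f t) \<le> (\<Sum>i\<le>l. cmod (orth_coeff l i)) * max M 0" for t
  proof (cases "\<bar>t\<bar> < 1 / 2")
    case True
    then show ?thesis
      unfolding norm_mult using f[OF True] by (intro mult_mono orth_poly_bound) (auto intro: sum_nonneg)
  qed (auto simp: orth_poly_zero intro!: mult_nonneg_nonneg sum_nonneg)
qed (auto simp: orth_poly_zero)

lemma orth_poly_monomial_integrable: "integrable lborel (\<lambda>t. orth_poly l t * of_real t ^ k)"
  by (rule orth_poly_mult_integrable[where M = 1]) (auto simp: norm_power intro!: power_le_one)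

definition orth_shift :: "nat \<Rightarrow> nat \<Rightarrow> real \<Rightarrow> complex" where
  "orth_shift m p x = (LINT y|lborel. of_real (x - y) ^ p * orth_poly m y)"

text \<open>The contribution of one coordinate of one Taylor monomial of the kernel
  \<open>a (x - y)\<close>, tested between two orthogonal polynomials.\<close>

definition double_moment :: "nat \<Rightarrow> nat \<Rightarrow> nat \<Rightarrow> complex" where
  "double_moment m n p = (LINT x|lborel. orth_shift m p x * cnj (orth_poly n x))"

lemma orth_shift_eq:
  "orth_shift m p x = (\<Sum>j\<le>p. of_nat (p choose j) * (-1) ^ (p - j) * orth_moment m (p - j) * of_real x ^ j)"
proof -
  have "of_real (x - y) ^ p * orth_poly m y
      = (\<Sum>j\<le>p. of_nat (p choose j) * (-1) ^ (p - j) * of_real x ^ j * (orth_poly m y * of_real y ^ (p - j)))" for y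
  proof -
    have "(complex_of_real (x - y)) ^ p = (complex_of_real x + - complex_of_real y) ^ p" by simp
    also have "\<dots> = (\<Sum>j\<le>p. of_nat (p choose j) * of_real x ^ j * (- of_real y) ^ (p - j))"
      by (rule binomial_ring)
    finally show ?thesis
      by (simp add: sum_distrib_left sum_distrib_right power_minus[of "complex_of_real y"] mult_ac)
  qed
  then have "orth_shift m p x = (LINT y|lborel. (\<Sum>j\<le>p. of_nat (p choose j) * (-1) ^ (p - j) * of_real x ^ j * (orth_poly m y * of_real y ^ (p - j))))"
    by (simp add: orth_shift_def)
  also have "\<dots> = (\<Sum>j\<le>p. of_nat (p choose j) * (-1) ^ (p - j) * of_real x ^ j * orth_moment m (p - j))"
    unfolding orth_moment_def
    by (subst Bochner_Integration.integral_sum) (auto intro!: integrable_mult_right orth_poly_monomial_integrable)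
  finally show ?thesis by (simp add: mult_ac)
qed

lemma double_moment_eq:
  "double_moment m n p = (\<Sum>j\<le>p. of_nat (p choose j) * (-1) ^ (p - j) * orth_moment m (p - j) * cnj (orth_moment n j))"
proof -
  have cnjm: "cnj (orth_moment n j) = (LINT x|lborel. cnj (orth_poly n x * of_real x ^ j))" for j
    unfolding orth_moment_def by (rule Bochner_Integration.integral_cnj[symmetric])
  have "orth_shift m p x * cnj (orth_poly n x)
    = (\<Sum>j\<le>p. of_nat (p choose j) * (-1) ^ (p - j) * orth_moment m (p - j) * cnj (orth_poly n x * of_real x ^ j))" for x
    unfolding orth_shift_eq by (simp add: sum_distrib_left sum_distrib_right mult_ac)
  then have "double_moment m n p = (LINT x|lborel. (\<Sum>j\<le>p. of_nat (p choose j) * (-1) ^ (p - j) * orth_moment m (p - j) * cnj (orth_poly n x * of_real x ^ j)))"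
    by (simp add: double_moment_def)
  also have "\<dots> = (\<Sum>j\<le>p. of_nat (p choose j) * (-1) ^ (p - j) * orth_moment m (p - j) * cnj (orth_moment n j))"
    unfolding cnjm
    by (subst Bochner_Integration.integral_sum)
      (auto intro!: integrable_mult_right integrable_cnj orth_poly_monomial_integrable simp del: complex_cnj_mult)
  finally show ?thesis .
qed

text \<open>In the binomial expansion the two exponents add up to \<open>p < m + n\<close>, so one
  of the two moments is below its degree and vanishes.\<close>

lemma double_moment_zero:
  assumes "p < m + n"
  shows "double_moment m n p = 0"
  unfolding double_moment_eq
proof (intro sum.neutral ballI)
  fix j assume "j \<in> {..p}"
  then consider "p - j < m" | "j < n" using assms by fastforce
  then show "of_nat (p choose j) * (- 1) ^ (p - j) * orth_moment m (p - j) * cnj (orth_moment n j) = 0"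
    by cases (simp_all add: orth_moment)
qed

text \<open>Only the binomial term \<open>j = n\<close> survives. The factorial
  \<open>fact (n + m)\<close> will cancel the one in the Taylor coefficient; the remaining ones are
  compensated by the normalization of the trial functions.\<close>

lemma double_moment_diag:
  "double_moment m n (n + m) = (-1) ^ m * fact (n + m) / (fact m * fact n)"
proof -
  have "double_moment m n (n + m) = (\<Sum>j\<in>{n}. of_nat ((n + m) choose j) * (-1) ^ (n + m - j) * orth_moment m (n + m - j) * cnj (orth_moment n j))"
    unfolding double_moment_eq
  proof (rule sum.mono_neutral_right)
    show "\<forall>j\<in>{..n + m} - {n}. of_nat ((n + m) choose j) * (-1) ^ (n + m - j) * orth_moment m (n + m - j) * cnj (orth_moment n j) = 0"
    proof
      fix j assume "j \<in> {..n + m} - {n}"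
      then consider "n + m - j < m" | "j < n" by fastforce
      then show "of_nat ((n + m) choose j) * (-1) ^ (n + m - j) * orth_moment m (n + m - j) * cnj (orth_moment n j) = 0"
        by cases (simp_all add: orth_moment)
    qed
  qed auto
  also have "\<dots> = (-1) ^ m * of_nat ((n + m) choose n)" by (simp add: orth_moment)
  also have "of_nat ((n + m) choose n) = (fact (n + m) / (fact m * fact n) :: complex)"
    using binomial_fact[of n "n + m", where 'a = complex] by (simp add: mult.commute)
  finally show ?thesis by simp
qed

section \<open>Products of orthogonal polynomials in several variables\<close>

definition orth_mi :: "('d::finite \<Rightarrow> nat) \<Rightarrow> real ^ 'd \<Rightarrow> complex" where
  "orth_mi n x = (\<Prod>i\<in>UNIV. orth_poly (n i) (x $ i))"

lemma orth_mi_measurable [measurable]: "orth_mi n \<in> borel_measurable borel"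
  unfolding orth_mi_def[abs_def] by measurable

lemma orth_mi_zero: "x \<notin> cube 1 0 \<Longrightarrow> orth_mi n x = 0"
  unfolding orth_mi_def cube_def by (auto simp: not_less intro!: prod_zero bexI orth_poly_zero)

definition orth_bound :: "('d::finite \<Rightarrow> nat) \<Rightarrow> real" where
  "orth_bound n = (\<Prod>i\<in>UNIV. \<Sum>j\<le>n i. cmod (orth_coeff (n i) j))"

lemma orth_mi_bound: "cmod (orth_mi n x) \<le> orth_bound n"
  unfolding orth_mi_def orth_bound_def prod_norm[symmetric] by (intro prod_mono) (auto intro: orth_poly_bound)

lemma orth_mi_integrable: "integrable lborel (orth_mi n)"
  unfolding orth_mi_def[abs_def]
  using orth_poly_monomial_integrable[of _ 0] by (intro integrable_lborel_prod) simp

lemma cube_norm_less: "x \<in> cube 1 0 \<Longrightarrow> norm (x :: real ^ 'd::finite) \<le> real CARD('d)"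
proof -
  assume "x \<in> cube 1 0"
  then have "\<bar>x $ i\<bar> < 1 / 2" for i by (simp add: cube_def)
  then have "\<bar>x $ i\<bar> \<le> 1" for i by (rule less_imp_le[OF less_trans]) simp
  then have "(\<Sum>i\<in>UNIV. \<bar>x $ i\<bar>) \<le> (\<Sum>i\<in>(UNIV :: 'd set). 1)" by (intro sum_mono)
  then show ?thesis using norm_le_l1_cart[of x] by simp
qed

definition orth_shift_mi :: "('d::finite \<Rightarrow> nat) \<Rightarrow> ('d \<Rightarrow> nat) \<Rightarrow> real ^ 'd \<Rightarrow> complex" where
  "orth_shift_mi m p X = (LINT Y|lborel. of_real (mi_power (X - Y) p) * orth_mi m Y)"

lemma
  shows orth_shift_mi_integrable: "integrable lborel (\<lambda>Y. of_real (mi_power (X - Y) p) * orth_mi m Y)"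
    and orth_shift_mi_eq: "orth_shift_mi m p X = (\<Prod>i\<in>UNIV. orth_shift (m i) (p i) (X $ i))"
proof -
  have eq: "of_real (mi_power (X - Y) p) * orth_mi m Y = (\<Prod>i\<in>UNIV. of_real (X $ i - Y $ i) ^ p i * orth_poly (m i) (Y $ i))" for Y
    by (simp add: mi_power_def orth_mi_def prod.distrib)
  have int: "integrable lborel (\<lambda>y. of_real (X $ i - y) ^ p i * orth_poly (m i) y)" for i
  proof -
    have "integrable lborel (\<lambda>y. orth_poly (m i) y * of_real (X $ i - y) ^ p i)"
    proof (rule orth_poly_mult_integrable)
      show "cmod (of_real (X $ i - t) ^ p i) \<le> (\<bar>X $ i\<bar> + 1) ^ p i" if "\<bar>t\<bar> < 1 / 2" for t
        using that unfolding norm_power norm_of_real by (intro power_mono) auto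
    qed measurable
    then show ?thesis by (simp add: mult.commute)
  qed
  show "integrable lborel (\<lambda>Y. of_real (mi_power (X - Y) p) * orth_mi m Y)"
    unfolding eq by (rule integrable_lborel_prod[OF int])
  show "orth_shift_mi m p X = (\<Prod>i\<in>UNIV. orth_shift (m i) (p i) (X $ i))"
    unfolding orth_shift_mi_def orth_shift_def eq by (rule LINT_lborel_prod[OF int])
qed

lemma
  shows orth_mi_double_moment_integrable: "integrable lborel (\<lambda>X. orth_shift_mi m p X * cnj (orth_mi n X))"
    and orth_mi_double_moment:
      "(LINT X|lborel. orth_shift_mi m p X * cnj (orth_mi n X)) = (\<Prod>i\<in>UNIV. double_moment (m i) (n i) (p i))"
proof -
  have eq: "orth_shift_mi m p X * cnj (orth_mi n X)
      = (\<Prod>i\<in>UNIV. orth_shift (m i) (p i) (X $ i) * cnj (orth_poly (n i) (X $ i)))" for X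
    unfolding orth_shift_mi_eq by (simp add: orth_mi_def prod.distrib)
  have int: "integrable lborel (\<lambda>x. orth_shift (m i) (p i) x * cnj (orth_poly (n i) x))" for i
  proof -
    have "orth_shift (m i) (p i) x * cnj (orth_poly (n i) x)
      = (\<Sum>j\<le>p i. of_nat (p i choose j) * (-1) ^ (p i - j) * orth_moment (m i) (p i - j) * cnj (orth_poly (n i) x * of_real x ^ j))" for x
      unfolding orth_shift_eq by (simp add: sum_distrib_left sum_distrib_right mult_ac)
    then show ?thesis
      by (simp only:) (intro Bochner_Integration.integrable_sum integrable_mult_right integrable_cnj orth_poly_monomial_integrable)
  qed
  show "integrable lborel (\<lambda>X. orth_shift_mi m p X * cnj (orth_mi n X))"
    unfolding eq by (rule integrable_lborel_prod[OF int])
  show "(LINT X|lborel. orth_shift_mi m p X * cnj (orth_mi n X)) = (\<Prod>i\<in>UNIV. double_moment (m i) (n i) (p i))"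
    unfolding eq double_moment_def by (rule LINT_lborel_prod[OF int])
qed

text \<open>\<open>orth_poly l\<close> has vanishing moments below \<open>l\<close> and moment \<open>1\<close> at \<open>l\<close>. The factor \<open>\<delta>\<^bsup>N - \<bar>m\<bar>\<^esup>\<close>
  gives all leading moments the same order \<open>\<delta>\<^bsup>N + d\<^esup>\<close>.\<close>

definition trial_factor :: "nat \<Rightarrow> real \<Rightarrow> ('d::finite \<Rightarrow> nat) \<Rightarrow> real" where
  "trial_factor N \<delta> m = \<delta> ^ (N - mi_abs m) * ((-1) ^ mi_abs m * mi_fact m)"

definition trial :: "nat \<Rightarrow> real ^ 'd::finite \<Rightarrow> real \<Rightarrow> ('d \<Rightarrow> nat) \<Rightarrow> real ^ 'd \<Rightarrow> complex" where
  "trial N x0 \<delta> m x = of_real (trial_factor N \<delta> m) * orth_mi m ((1 / \<delta>) *\<^sub>R (x - x0))"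

lemma trial_measurable [measurable]: "trial N x0 \<delta> m \<in> borel_measurable borel"
  unfolding trial_def[abs_def] by measurable

lemma trial_affine: "\<delta> > 0 \<Longrightarrow> trial N x0 \<delta> m (x0 + \<delta> *\<^sub>R X) = of_real (trial_factor N \<delta> m) * orth_mi m X"
  by (simp add: trial_def)

lemma trial_L2:
  assumes \<delta>: "\<delta> > 0"
  shows "trial N (x0 :: real ^ 'd::finite) \<delta> m \<in> L2"
proof (rule L2_bounded_support)
  show "cmod (trial N x0 \<delta> m x) \<le> \<bar>trial_factor N \<delta> m\<bar> * orth_bound m" for x
    unfolding trial_def norm_mult by (intro mult_mono orth_mi_bound) auto
  show "trial N x0 \<delta> m x = 0" if x: "norm x > norm x0 + \<delta> * real CARD('d)" for x
  proof -
    have "norm x \<le> norm x0 + norm (x - x0)" by (rule norm_triangle_sub)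
    then have "\<delta> * real CARD('d) < norm (x - x0)" using x by simp
    then have "real CARD('d) < norm (x - x0) / \<delta>" using \<delta> by (simp add: field_simps)
    then have "real CARD('d) < norm ((1 / \<delta>) *\<^sub>R (x - x0))" using \<delta> unfolding norm_scaleR by simp
    then have "(1 / \<delta>) *\<^sub>R (x - x0) \<notin> cube 1 0" using cube_norm_less not_less by blast
    then show ?thesis by (simp add: trial_def orth_mi_zero)
  qed
qed measurable

text \<open>Each of the two integrations is rescaled and yields a factor
  \<open>\<delta> ^ CARD('d)\<close>; the centre \<open>x0\<close> drops out because the kernel
  depends on differences only.\<close>

lemma conv_trial:
  fixes a :: "real ^ 'd::finite \<Rightarrow> complex"
  assumes a [measurable]: "a \<in> borel_measurable borel" and \<delta>: "\<delta> > 0"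
  shows "l2ip (conv a (trial N x0 \<delta> m)) (trial N x0 \<delta> n)
    = of_real (\<delta> ^ (2 * CARD('d)) * trial_factor N \<delta> m * trial_factor N \<delta> n)
      * (LINT X|lborel. (LINT Y|lborel. a (\<delta> *\<^sub>R (X - Y)) * orth_mi m Y) * cnj (orth_mi n X))"
proof -
  have inner: "conv a (trial N x0 \<delta> m) (x0 + \<delta> *\<^sub>R X)
      = of_real (\<delta> ^ CARD('d) * trial_factor N \<delta> m) * (LINT Y|lborel. a (\<delta> *\<^sub>R (X - Y)) * orth_mi m Y)" for X
  proof -
    have "conv a (trial N x0 \<delta> m) (x0 + \<delta> *\<^sub>R X)
        = of_real (\<delta> ^ CARD('d)) * (LINT Y|lborel. a (x0 + \<delta> *\<^sub>R X - (x0 + \<delta> *\<^sub>R Y)) * trial N x0 \<delta> m (x0 + \<delta> *\<^sub>R Y))"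
      unfolding conv_def by (subst LINT_lborel_affine[OF _ \<delta>, where t = x0]) simp_all
    also have "(\<lambda>Y. a (x0 + \<delta> *\<^sub>R X - (x0 + \<delta> *\<^sub>R Y)) * trial N x0 \<delta> m (x0 + \<delta> *\<^sub>R Y))
        = (\<lambda>Y. of_real (trial_factor N \<delta> m) * (a (\<delta> *\<^sub>R (X - Y)) * orth_mi m Y))"
      by (simp add: fun_eq_iff trial_affine[OF \<delta>] scaleR_diff_right)
    finally show ?thesis by simp
  qed
  have "l2ip (conv a (trial N x0 \<delta> m)) (trial N x0 \<delta> n)
      = of_real (\<delta> ^ CARD('d)) * (LINT X|lborel. conv a (trial N x0 \<delta> m) (x0 + \<delta> *\<^sub>R X) * cnj (trial N x0 \<delta> n (x0 + \<delta> *\<^sub>R X)))"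
    unfolding l2ip_def by (subst LINT_lborel_affine[OF _ \<delta>, where t = x0]) simp_all
  also have "(\<lambda>X. conv a (trial N x0 \<delta> m) (x0 + \<delta> *\<^sub>R X) * cnj (trial N x0 \<delta> n (x0 + \<delta> *\<^sub>R X)))
    = (\<lambda>X. of_real (\<delta> ^ CARD('d) * trial_factor N \<delta> m * trial_factor N \<delta> n)
        * ((LINT Y|lborel. a (\<delta> *\<^sub>R (X - Y)) * orth_mi m Y) * cnj (orth_mi n X)))"
    by (simp add: fun_eq_iff inner trial_affine[OF \<delta>])
  finally have eq: "l2ip (conv a (trial N x0 \<delta> m)) (trial N x0 \<delta> n) = of_real (\<delta> ^ CARD('d))
      * (of_real (\<delta> ^ CARD('d) * trial_factor N \<delta> m * trial_factor N \<delta> n)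
        * (LINT X|lborel. (LINT Y|lborel. a (\<delta> *\<^sub>R (X - Y)) * orth_mi m Y) * cnj (orth_mi n X)))"
    by (simp only: Bochner_Integration.integral_mult_right_zero)
  show ?thesis
    unfolding eq mult_2 power_add of_real_mult by (simp only: mult_ac)
qed

lemma mi_abs_add: "mi_abs (n + m) = mi_abs n + mi_abs m"
  by (simp add: mi_abs_def sum.distrib)

lemma mi_power_scale: "mi_power (\<delta> *\<^sub>R z) p = \<delta> ^ mi_abs p * mi_power z (p :: 'd::finite \<Rightarrow> nat)"
  by (simp add: mi_power_def mi_abs_def power_mult_distrib prod.distrib power_sum)

lemma mi_power_add: "mi_power z (k + l) = mi_power z k * mi_power z (l :: 'd::finite \<Rightarrow> nat)"
  by (simp add: mi_power_def power_add prod.distrib)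

text \<open>A nonzero product forces \<open>n + m \<le> p\<close> in every coordinate. So every
  Taylor monomial other than \<open>p = n + m\<close> either contributes nothing or is of higher
  order in \<open>\<delta>\<close>.\<close>

lemma double_moment_mi_zero:
  assumes "(\<Prod>i\<in>UNIV. double_moment (m i) (n i) (p i)) \<noteq> 0" "p \<noteq> n + m"
  shows "mi_abs n + mi_abs m < mi_abs (p :: 'd::finite \<Rightarrow> nat)"
proof -
  have le: "(n + m) i \<le> p i" for i
  proof (rule ccontr)
    assume "\<not> (n + m) i \<le> p i"
    then have "double_moment (m i) (n i) (p i) = 0" by (intro double_moment_zero) simp
    then show False using assms(1) by (metis finite_class.finite_UNIV iso_tuple_UNIV_I prod_zero)
  qed
  obtain i where "p i \<noteq> (n + m) i" using assms(2) by (auto simp: fun_eq_iff)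
  then have "(n + m) i < p i" using le[of i] by simp
  then have "mi_abs (n + m) < mi_abs p"
    unfolding mi_abs_def using le by (intro sum_strict_mono_ex1) auto
  then show ?thesis by (simp add: mi_abs_add)
qed

lemma double_moment_mi_diag:
  "(\<Prod>i\<in>UNIV. double_moment (m i) (n i) ((n + m) i)) = of_real ((-1) ^ mi_abs m * mi_fact (n + m) / (mi_fact m * mi_fact n))"
  by (simp add: double_moment_diag prod_dividef prod.distrib mi_fact_def mi_abs_def power_sum)

text \<open>For \<open>X\<close> and \<open>Y\<close> in the unit cube the coordinates of
  \<open>X - Y\<close> are at most 1, so the Taylor estimate applies to
  \<open>\<delta> *\<^sub>R (X - Y)\<close>; the polynomial part factors into double
  moments.\<close>

lemma scaled_kernel_expansion:
  fixes a :: "real ^ 'd::finite \<Rightarrow> complex"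
  assumes [measurable]: "a \<in> borel_measurable borel" and \<delta>: "\<delta> > 0"
    and T: "\<And>z. (\<And>j. \<bar>z $ j\<bar> \<le> \<delta>) \<Longrightarrow>
      cmod (a z - (\<Sum>p\<in>mi_upto K. of_real (mi_power z p / mi_fact p) * mi_deriv p a 0)) \<le> E"
  shows "cmod ((LINT X|lborel. (LINT Y|lborel. a (\<delta> *\<^sub>R (X - Y)) * orth_mi m Y) * cnj (orth_mi n X))
      - (\<Sum>p\<in>mi_upto K. of_real (\<delta> ^ mi_abs p / mi_fact p) * mi_deriv p a 0 * (\<Prod>i\<in>UNIV. double_moment (m i) (n i) (p i))))
    \<le> E * norm1 (orth_mi m) * norm1 (orth_mi n)"
proof -
  define c where "c p = of_real (\<delta> ^ mi_abs p / mi_fact p) * mi_deriv p a 0" for p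
  define F where "F X = (LINT Y|lborel. a (\<delta> *\<^sub>R (X - Y)) * orth_mi m Y) * cnj (orth_mi n X)" for X
  define F' where "F' X = (\<Sum>p\<in>mi_upto K. c p * (orth_shift_mi m p X * cnj (orth_mi n X)))" for X
  have F'_int: "integrable lborel F'"
    unfolding F'_def
    by (intro Bochner_Integration.integrable_sum integrable_mult_right orth_mi_double_moment_integrable)
  have F_meas: "F \<in> borel_measurable borel" unfolding F_def by measurable
  have close: "cmod (F X - F' X) \<le> E * norm1 (orth_mi m) * cmod (orth_mi n X)" for X
  proof (cases "X \<in> cube 1 0")
    case False
    then show ?thesis by (simp add: F_def F'_def orth_mi_zero)
  next
    case X: True
    define I where "I Y = (\<Sum>p\<in>mi_upto K. c p * (of_real (mi_power (X - Y) p) * orth_mi m Y))" for Y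
    have I_int: "integrable lborel I"
      unfolding I_def by (intro Bochner_Integration.integrable_sum integrable_mult_right orth_shift_mi_integrable)
    have I_LINT: "(LINT Y|lborel. I Y) = (\<Sum>p\<in>mi_upto K. c p * orth_shift_mi m p X)"
      unfolding I_def orth_shift_mi_def
      by (subst Bochner_Integration.integral_sum) (auto intro!: integrable_mult_right orth_shift_mi_integrable)
    have ptwise: "cmod (a (\<delta> *\<^sub>R (X - Y)) * orth_mi m Y - I Y) \<le> E * cmod (orth_mi m Y)" for Y
    proof (cases "Y \<in> cube 1 0")
      case False
      then show ?thesis by (simp add: I_def orth_mi_zero)
    next
      case Y: True
      have "\<bar>(\<delta> *\<^sub>R (X - Y)) $ j\<bar> \<le> \<delta>" for j
      proof -
        have "\<bar>X $ j\<bar> < 1 / 2" "\<bar>Y $ j\<bar> < 1 / 2" using X Y by (simp_all add: cube_def)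
        then have "\<bar>X $ j - Y $ j\<bar> \<le> 1" by linarith
        then have "\<delta> * \<bar>X $ j - Y $ j\<bar> \<le> \<delta> * 1" using \<delta> by (intro mult_left_mono) auto
        then show ?thesis using \<delta> by (simp add: abs_mult)
      qed
      from T[OF this]
      have "cmod (a (\<delta> *\<^sub>R (X - Y)) - (\<Sum>p\<in>mi_upto K. c p * of_real (mi_power (X - Y) p))) \<le> E"
        by (simp add: mi_power_scale c_def mult_ac)
      moreover have "a (\<delta> *\<^sub>R (X - Y)) * orth_mi m Y - I Y
        = (a (\<delta> *\<^sub>R (X - Y)) - (\<Sum>p\<in>mi_upto K. c p * of_real (mi_power (X - Y) p))) * orth_mi m Y"
        by (simp add: I_def left_diff_distrib sum_distrib_right mult.assoc)
      ultimately show ?thesis by (simp add: norm_mult mult_right_mono)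
    qed
    \<comment> \<open>Integrability of the kernel times \<open>orth_mi m\<close> is read off from
      its closeness to the polynomial part \<open>I\<close>.\<close>
    have d_int: "integrable lborel (\<lambda>Y. a (\<delta> *\<^sub>R (X - Y)) * orth_mi m Y - I Y)"
    proof (rule Bochner_Integration.integrable_bound)
      show "integrable lborel (\<lambda>Y. E * cmod (orth_mi m Y))"
        by (intro integrable_mult_right integrable_norm orth_mi_integrable)
      show "AE Y in lborel. norm (a (\<delta> *\<^sub>R (X - Y)) * orth_mi m Y - I Y) \<le> norm (E * cmod (orth_mi m Y))"
        using order.trans[OF ptwise abs_ge_self] by simp
      show "(\<lambda>Y. a (\<delta> *\<^sub>R (X - Y)) * orth_mi m Y - I Y) \<in> borel_measurable lborel"
        using borel_measurable_integrable[OF I_int] by simp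
    qed
    have "(LINT Y|lborel. a (\<delta> *\<^sub>R (X - Y)) * orth_mi m Y) = (LINT Y|lborel. (a (\<delta> *\<^sub>R (X - Y)) * orth_mi m Y - I Y) + I Y)"
      by simp
    also have "\<dots> = (LINT Y|lborel. a (\<delta> *\<^sub>R (X - Y)) * orth_mi m Y - I Y) + (LINT Y|lborel. I Y)"
      by (rule Bochner_Integration.integral_add[OF d_int I_int])
    finally have "F X - F' X = (LINT Y|lborel. a (\<delta> *\<^sub>R (X - Y)) * orth_mi m Y - I Y) * cnj (orth_mi n X)"
      unfolding F_def F'_def I_LINT by (simp add: distrib_right sum_distrib_right mult.assoc)
    moreover have "cmod (LINT Y|lborel. a (\<delta> *\<^sub>R (X - Y)) * orth_mi m Y - I Y) \<le> (LINT Y|lborel. E * cmod (orth_mi m Y))"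
      using borel_measurable_integrable[OF d_int] ptwise
      by (intro LINT_norm_le integrable_mult_right integrable_norm orth_mi_integrable) auto
    ultimately show ?thesis by (simp add: norm_mult norm1_def mult_right_mono)
  qed
  have bound_int: "integrable lborel (\<lambda>X. E * norm1 (orth_mi m) * cmod (orth_mi n X))"
    by (intro integrable_mult_right integrable_norm orth_mi_integrable)
  have d_int: "integrable lborel (\<lambda>X. F X - F' X)"
  proof (rule Bochner_Integration.integrable_bound[OF bound_int])
    show "AE X in lborel. norm (F X - F' X) \<le> norm (E * norm1 (orth_mi m) * cmod (orth_mi n X))"
      using order.trans[OF close abs_ge_self] by simp
    show "(\<lambda>X. F X - F' X) \<in> borel_measurable lborel"
      using F_meas borel_measurable_integrable[OF F'_int] by simp
  qed
  have "(LINT X|lborel. F X) = (LINT X|lborel. (F X - F' X) + F' X)" by simp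
  also have "\<dots> = (LINT X|lborel. F X - F' X) + (LINT X|lborel. F' X)"
    by (rule Bochner_Integration.integral_add[OF d_int F'_int])
  also have "(LINT X|lborel. F' X) = (\<Sum>p\<in>mi_upto K. c p * (\<Prod>i\<in>UNIV. double_moment (m i) (n i) (p i)))"
    unfolding F'_def
    by (subst Bochner_Integration.integral_sum)
      (auto intro!: integrable_mult_right orth_mi_double_moment_integrable simp: orth_mi_double_moment)
  finally have "(LINT X|lborel. F X) - (\<Sum>p\<in>mi_upto K. c p * (\<Prod>i\<in>UNIV. double_moment (m i) (n i) (p i)))
      = (LINT X|lborel. F X - F' X)" by simp
  moreover have "cmod (LINT X|lborel. F X - F' X) \<le> (LINT X|lborel. E * norm1 (orth_mi m) * cmod (orth_mi n X))"
    using borel_measurable_integrable[OF d_int] close by (intro LINT_norm_le bound_int) auto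
  ultimately show ?thesis by (simp add: F_def c_def norm1_def)
qed

text \<open>With \<open>e\<close> the sum of the two orders, all Taylor terms except
  \<open>p = n + m\<close> vanish or are of order above \<open>e\<close>. The remainder has order
  \<open>2 * N + 1\<close>, which exceeds \<open>e\<close> because \<open>e \<le> 2 * N\<close>;
  this is what the smoothness of order \<open>2 * N + 1\<close> is for.\<close>

theorem conv_trial_asymptotics:
  fixes a :: "real ^ 'd::finite \<Rightarrow> complex"
  assumes [measurable]: "a \<in> borel_measurable borel" and r: "r > 0" and smooth: "Ck_on (2 * N + 1) a (cube r 0)"
    and m: "m \<in> mi_upto N" and n: "n \<in> mi_upto N"
  shows "((\<lambda>\<delta>. l2ip (conv a (trial N x0 \<delta> m)) (trial N x0 \<delta> n) / of_real (\<delta> ^ (2 * N + 2 * CARD('d))))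
    \<longlongrightarrow> (-1) ^ mi_abs n * mi_deriv (n + m) a 0) (at_right 0)"
proof -
  obtain C where C: "C \<ge> 0" and T: "\<And>z \<tau>. \<tau> \<le> r / 4 \<Longrightarrow> (\<And>j. \<bar>z $ j\<bar> \<le> \<tau>) \<Longrightarrow>
    cmod (a z - (\<Sum>p\<in>mi_upto (2 * N). of_real (mi_power z p / mi_fact p) * mi_deriv p a 0)) \<le> C * \<tau> ^ Suc (2 * N)"
    using Taylor_mi_deriv[OF r smooth[unfolded Suc_eq_plus1[symmetric]]] by blast
  define e where "e = mi_abs n + mi_abs m"
  have mN: "mi_abs m \<le> N" and nN: "mi_abs n \<le> N" using m n by (simp_all add: mi_upto_def)
  then have eN: "e \<le> 2 * N" by (simp add: e_def)
  define W where "W p = (\<Prod>i\<in>UNIV. double_moment (m i) (n i) (p i))" for p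
  define s where "s = (-1) ^ mi_abs m * mi_fact m * ((-1) ^ mi_abs n * mi_fact n)"
  define G where "G \<delta> = (LINT X|lborel. (LINT Y|lborel. a (\<delta> *\<^sub>R (X - Y)) * orth_mi m Y) * cnj (orth_mi n X))" for \<delta>
  define P where "P \<delta> = (\<Sum>p\<in>mi_upto (2 * N). of_real (\<delta> ^ mi_abs p / mi_fact p) * mi_deriv p a 0 * W p)" for \<delta> :: real
  have small: "\<forall>\<^sub>F \<delta> in at_right 0. 0 < \<delta> \<and> \<delta> < min 1 (r / 4)"
    using r by (intro eventually_conj eventually_at_right_less eventually_at_rightI[of 0 "min 1 (r / 4)"]) auto
  have quot: "l2ip (conv a (trial N x0 \<delta> m)) (trial N x0 \<delta> n) / of_real (\<delta> ^ (2 * N + 2 * CARD('d)))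
      = of_real s * (P \<delta> / of_real (\<delta> ^ e) + (G \<delta> - P \<delta>) / of_real (\<delta> ^ e))" if \<delta>: "\<delta> > 0" for \<delta>
  proof -
    \<comment> \<open>The powers in the trial factors complement \<open>\<delta> ^ e\<close> to the
      common power \<open>2 * N\<close>, whatever \<open>m\<close> and \<open>n\<close> are.\<close>
    have "\<delta> ^ (N - mi_abs m) * \<delta> ^ (N - mi_abs n) * \<delta> ^ e = \<delta> ^ (2 * N)"
      using mN nN by (simp add: e_def power_add[symmetric] mult_2)
    then have "\<delta> ^ (2 * CARD('d)) * trial_factor N \<delta> m * trial_factor N \<delta> n * \<delta> ^ e = s * \<delta> ^ (2 * N + 2 * CARD('d))"
      by (simp add: trial_factor_def s_def power_add mult_ac)
    then have "\<delta> ^ (2 * CARD('d)) * trial_factor N \<delta> m * trial_factor N \<delta> n / \<delta> ^ (2 * N + 2 * CARD('d)) = s / \<delta> ^ e"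
      using \<delta> by (simp add: divide_eq_eq eq_divide_eq)
    then have "complex_of_real (\<delta> ^ (2 * CARD('d)) * trial_factor N \<delta> m * trial_factor N \<delta> n) / of_real (\<delta> ^ (2 * N + 2 * CARD('d)))
        = of_real s / of_real (\<delta> ^ e)"
      by (simp only: of_real_divide[symmetric])
    then show ?thesis
      unfolding conv_trial[OF assms(1) \<delta>] G_def[symmetric]
      by (simp add: add_divide_distrib[symmetric] del: of_real_mult of_real_power)
        (simp add: times_divide_eq_left[symmetric] del: of_real_mult of_real_power times_divide_eq_left)
  qed
  have lim_P: "((\<lambda>\<delta>. P \<delta> / of_real (\<delta> ^ e)) \<longlongrightarrow>
      (\<Sum>p\<in>mi_upto (2 * N). if p = n + m then of_real (1 / mi_fact p) * mi_deriv p a 0 * W p else 0)) (at_right 0)"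
  proof -
    have "((\<lambda>\<delta>. \<Sum>p\<in>mi_upto (2 * N). of_real (\<delta> ^ mi_abs p / \<delta> ^ e) * (of_real (1 / mi_fact p) * mi_deriv p a 0 * W p)) \<longlongrightarrow>
      (\<Sum>p\<in>mi_upto (2 * N). if p = n + m then of_real (1 / mi_fact p) * mi_deriv p a 0 * W p else 0)) (at_right 0)"
    proof (rule tendsto_sum)
      fix p :: "'d \<Rightarrow> nat"
      let ?k = "of_real (1 / mi_fact p) * mi_deriv p a 0 * W p"
      consider "W p = 0" | "p = n + m" | "W p \<noteq> 0" "p \<noteq> n + m" by blast
      then show "((\<lambda>\<delta>. of_real (\<delta> ^ mi_abs p / \<delta> ^ e) * ?k) \<longlongrightarrow> (if p = n + m then ?k else 0)) (at_right 0)"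
      proof cases
        case 1
        then have k0: "?k = 0" by simp
        show ?thesis unfolding k0 by simp
      next
        case 2
        have pe: "mi_abs p = e" by (simp add: 2 mi_abs_add e_def)
        have "\<forall>\<^sub>F \<delta> in at_right 0. of_real (\<delta> ^ mi_abs p / \<delta> ^ e) * ?k = ?k"
          using small by eventually_elim (simp add: pe)
        then show ?thesis unfolding if_P[OF 2] by (rule tendsto_eventually)
      next
        case 3
        have ep: "e < mi_abs p" using double_moment_mi_zero[of m n p] 3 by (simp add: W_def e_def)
        have ev: "\<forall>\<^sub>F \<delta> in at_right 0. of_real (\<delta> ^ (mi_abs p - e)) * ?k = of_real (\<delta> ^ mi_abs p / \<delta> ^ e) * ?k"
          using small by eventually_elim (use ep in \<open>simp add: power_diff\<close>)
        have "((\<lambda>\<delta>. of_real (\<delta> ^ (mi_abs p - e)) * ?k) \<longlongrightarrow> of_real (0 ^ (mi_abs p - e)) * ?k) (at_right 0)"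
          by (intro tendsto_intros)
        moreover have "of_real (0 ^ (mi_abs p - e)) * ?k = 0" using ep by (simp add: zero_power)
        ultimately have "((\<lambda>\<delta>. of_real (\<delta> ^ (mi_abs p - e)) * ?k) \<longlongrightarrow> 0) (at_right 0)" by (simp only:)
        from Lim_transform_eventually[OF this ev] show ?thesis using 3(2) by (simp only: if_False)
      qed
    qed
    moreover have "P \<delta> / of_real (\<delta> ^ e)
      = (\<Sum>p\<in>mi_upto (2 * N). of_real (\<delta> ^ mi_abs p / \<delta> ^ e) * (of_real (1 / mi_fact p) * mi_deriv p a 0 * W p))" for \<delta>
      by (simp add: P_def sum_divide_distrib mult_ac)
    ultimately show ?thesis by (simp only:)
  qed
  have lim_err: "((\<lambda>\<delta>. (G \<delta> - P \<delta>) / of_real (\<delta> ^ e)) \<longlongrightarrow> 0) (at_right 0)"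
  proof (rule Lim_null_comparison)
    define B where "B = C * norm1 (orth_mi m) * norm1 (orth_mi n)"
    have B: "B \<ge> 0" using C by (simp add: B_def norm1_nonneg)
    show "\<forall>\<^sub>F \<delta> in at_right 0. norm ((G \<delta> - P \<delta>) / of_real (\<delta> ^ e)) \<le> B * \<delta>"
      using small
    proof eventually_elim
      case (elim \<delta>)
      then have \<delta>: "0 < \<delta>" "\<delta> \<le> 1" "\<delta> \<le> r / 4" by auto
      have "cmod (G \<delta> - P \<delta>) \<le> C * \<delta> ^ Suc (2 * N) * norm1 (orth_mi m) * norm1 (orth_mi n)"
        unfolding G_def P_def W_def by (rule scaled_kernel_expansion[OF assms(1) \<delta>(1)]) (rule T[OF \<delta>(3)])
      also have "\<dots> = B * \<delta> * \<delta> ^ (2 * N)" by (simp add: B_def mult_ac)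
      also have "\<dots> \<le> B * \<delta> * \<delta> ^ e"
        using eN \<delta> B by (intro mult_left_mono power_decreasing) auto
      finally show ?case using \<delta>(1) by (simp add: norm_divide divide_le_eq norm_power)
    qed
    show "((\<lambda>\<delta>. B * \<delta>) \<longlongrightarrow> 0) (at_right 0)" by (auto intro!: tendsto_eq_intros)
  qed
  have "n + m \<in> mi_upto (2 * N)" using mN nN by (simp add: mi_upto_def mi_abs_add)
  then have sum: "(\<Sum>p\<in>mi_upto (2 * N). if p = n + m then of_real (1 / mi_fact p) * mi_deriv p a 0 * W p else 0)
      = of_real (1 / mi_fact (n + m)) * mi_deriv (n + m) a 0 * W (n + m)"
    by (simp add: sum.delta[OF finite_mi_upto])
  \<comment> \<open>Signs and factorials in the trial factors cancel those of the double moments,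
    except for the sign that \<open>form_a\<close> carries.\<close>
  have coeff: "s * (1 / mi_fact (n + m) * ((-1) ^ mi_abs m * mi_fact (n + m) / (mi_fact m * mi_fact n))) = (-1) ^ mi_abs n"
    using mi_fact_pos[of m] mi_fact_pos[of n] mi_fact_pos[of "n + m"]
    by (simp add: s_def field_simps power_mult_distrib[symmetric])
  have "((\<lambda>\<delta>. of_real s * (P \<delta> / of_real (\<delta> ^ e) + (G \<delta> - P \<delta>) / of_real (\<delta> ^ e))) \<longlongrightarrow>
      of_real s * (of_real (1 / mi_fact (n + m)) * mi_deriv (n + m) a 0 * W (n + m) + 0)) (at_right 0)"
    using lim_P lim_err unfolding sum by (intro tendsto_intros)
  also have "of_real s * (of_real (1 / mi_fact (n + m)) * mi_deriv (n + m) a 0 * W (n + m) + 0)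
    = of_real (s * (1 / mi_fact (n + m) * ((-1) ^ mi_abs m * mi_fact (n + m) / (mi_fact m * mi_fact n)))) * mi_deriv (n + m) a 0"
    unfolding W_def double_moment_mi_diag by (simp only: of_real_mult) (simp only: mult_ac add_0_right)
  also have "\<dots> = (-1) ^ mi_abs n * mi_deriv (n + m) a 0" unfolding coeff by simp
  finally have lim: "((\<lambda>\<delta>. of_real s * (P \<delta> / of_real (\<delta> ^ e) + (G \<delta> - P \<delta>) / of_real (\<delta> ^ e))) \<longlongrightarrow>
      (-1) ^ mi_abs n * mi_deriv (n + m) a 0) (at_right 0)" .
  have "\<forall>\<^sub>F \<delta> in at_right 0. of_real s * (P \<delta> / of_real (\<delta> ^ e) + (G \<delta> - P \<delta>) / of_real (\<delta> ^ e))
      = l2ip (conv a (trial N x0 \<delta> m)) (trial N x0 \<delta> n) / of_real (\<delta> ^ (2 * N + 2 * CARD('d)))"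
    using small by eventually_elim (rule quot[symmetric], simp)
  from Lim_transform_eventually[OF lim this] show ?thesis .
qed

section \<open>Contribution of the potential\<close>

lemma cube_measurable [measurable]: "cube r (x0 :: real ^ 'd::finite) \<in> sets borel"
  unfolding cube_def by measurable

definition orth_mi_coeff :: "('d::finite \<Rightarrow> nat) \<Rightarrow> ('d \<Rightarrow> nat) \<Rightarrow> complex" where
  "orth_mi_coeff m k = (\<Prod>i\<in>UNIV. orth_coeff (m i) (k i))"

text \<open>Multiplying out the coordinate factors produces monomials, the only functions against
  which the flatness hypothesis says anything about \<open>V\<close>.\<close>

lemma orth_mi_expand:
  "orth_mi m X = indicator (cube 1 0) X * (\<Sum>k\<in>PiE UNIV (\<lambda>i. {..m i}). orth_mi_coeff m k * of_real (mi_power X k))"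
proof -
  have "orth_mi m X = (\<Prod>i\<in>UNIV. unit_ind (X $ i)) * (\<Prod>i\<in>UNIV. \<Sum>j\<le>m i. orth_coeff (m i) j * of_real (X $ i) ^ j)"
    by (simp add: orth_mi_def orth_poly_def prod.distrib)
  also have "(\<Prod>i\<in>UNIV. \<Sum>j\<le>m i. orth_coeff (m i) j * of_real (X $ i) ^ j)
      = (\<Sum>k\<in>PiE UNIV (\<lambda>i. {..m i}). \<Prod>i\<in>UNIV. orth_coeff (m i) (k i) * of_real (X $ i) ^ k i)"
    by (rule prod_sum_PiE) auto
  also have "(\<Prod>i\<in>UNIV. unit_ind (X $ i)) = indicator (cube 1 0) X"
  proof (cases "X \<in> cube 1 0")
    case True
    then have b: "\<bar>X $ i\<bar> < 1 / 2" for i by (simp add: cube_def)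
    have "- 1 / 2 < X $ i" "X $ i < 1 / 2" for i using b[of i] by linarith+
    then have "unit_ind (X $ i) = 1" for i by (simp add: unit_ind_def)
    then show ?thesis using True by simp
  next
    case False
    then obtain i where "\<bar>X $ i\<bar> \<ge> 1 / 2" by (auto simp: cube_def not_less)
    then have "unit_ind (X $ i) = 0" by (auto simp: unit_ind_def indicator_def)
    then have "(\<Prod>i\<in>UNIV. unit_ind (X $ i)) = 0" by (intro prod_zero) auto
    then show ?thesis using False by simp
  qed
  finally show ?thesis by (simp add: orth_mi_coeff_def mi_power_def prod.distrib)
qed

lemma h_V_ge:
  assumes "n \<in> mi_upto (2 * N)"
  shows "cmod (LINT x:cube 1 0|lborel. (V (x0 + \<delta> *\<^sub>R x) - V x0) * of_real (mi_power x n)) \<le> h_V V x0 N \<delta>"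
  unfolding h_V_def by (rule Max_ge) (use assms finite_mi_upto in auto)

text \<open>The product of the two expansions contains only monomials of order at most
  \<open>2 * N\<close>, and \<open>h_V\<close> bounds each of their integrals.\<close>

lemma potential_orth_mi_le:
  fixes V :: "real ^ 'd::finite \<Rightarrow> complex"
  assumes V [measurable]: "V \<in> borel_measurable borel" and M: "\<And>x. cmod (V x) \<le> M"
    and m: "m \<in> mi_upto N" and n: "n \<in> mi_upto N"
  shows "cmod (LINT X|lborel. (V (x0 + \<delta> *\<^sub>R X) - V x0) * orth_mi m X * cnj (orth_mi n X))
    \<le> (\<Sum>k\<in>PiE UNIV (\<lambda>i. {..m i}). \<Sum>l\<in>PiE UNIV (\<lambda>i. {..n i}). cmod (orth_mi_coeff m k * cnj (orth_mi_coeff n l))) * h_V V x0 N \<delta>"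
proof -
  let ?A = "PiE UNIV (\<lambda>i. {..m i})" and ?B = "PiE UNIV (\<lambda>i. {..n i})"
  define f where "f k X = indicator (cube 1 0) X *\<^sub>R ((V (x0 + \<delta> *\<^sub>R X) - V x0) * of_real (mi_power X k))" for k and X :: "real ^ 'd"
  have f_meas: "f k \<in> borel_measurable borel" for k
    unfolding f_def mi_power_def by measurable
  have f_int: "integrable lborel (f k)" for k
  proof (rule integrable_bounded_support[OF f_meas, where M = "2 * M" and R = "real CARD('d)"])
    show "norm (f k X) \<le> 2 * M" for X
    proof (cases "X \<in> cube 1 0")
      case True
      then have "\<bar>X $ i\<bar> < 1 / 2" for i by (simp add: cube_def)
      then have "\<bar>X $ i\<bar> \<le> 1" for i by (rule less_imp_le[OF less_trans]) simp
      then have 1: "\<bar>mi_power X k\<bar> \<le> 1" using abs_mi_power_le[of X 1 k] by simp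
      have "cmod (V (x0 + \<delta> *\<^sub>R X) - V x0) \<le> 2 * M"
        using norm_triangle_ineq4[of "V (x0 + \<delta> *\<^sub>R X)" "V x0"] M[of "x0 + \<delta> *\<^sub>R X"] M[of x0] by linarith
      then have "cmod (V (x0 + \<delta> *\<^sub>R X) - V x0) * \<bar>mi_power X k\<bar> \<le> 2 * M * 1"
        using 1 order.trans[OF norm_ge_zero M[of x0]] by (intro mult_mono) auto
      then show ?thesis using True by (simp add: f_def norm_mult)
    next
      case False
      then show ?thesis using order.trans[OF norm_ge_zero M[of x0]] by (simp add: f_def)
    qed
    show "f k X = 0" if "norm X > real CARD('d)" for X
      using cube_norm_less[of X] that by (auto simp: f_def indicator_def)
  qed
  have eq: "(V (x0 + \<delta> *\<^sub>R X) - V x0) * orth_mi m X * cnj (orth_mi n X)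
      = (\<Sum>k\<in>?A. \<Sum>l\<in>?B. orth_mi_coeff m k * cnj (orth_mi_coeff n l) * f (k + l) X)" for X
  proof (cases "X \<in> cube 1 0")
    case True
    then show ?thesis
      unfolding orth_mi_expand f_def
      by (simp add: sum_product sum_distrib_left mi_power_add mult_ac)
  next
    case False
    then show ?thesis by (simp add: f_def orth_mi_zero)
  qed
  have kl: "k + l \<in> mi_upto (2 * N)" if "k \<in> ?A" "l \<in> ?B" for k l
  proof -
    have "mi_abs k \<le> mi_abs m" "mi_abs l \<le> mi_abs n"
      using that unfolding mi_abs_def by (auto intro!: sum_mono simp: PiE_iff)
    then show ?thesis using m n by (simp add: mi_upto_def mi_abs_add)
  qed
  have f_h: "cmod (LINT X|lborel. f (k + l) X) \<le> h_V V x0 N \<delta>" if "k \<in> ?A" "l \<in> ?B" for k l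
    using h_V_ge[OF kl[OF that], of V x0 \<delta>] unfolding f_def set_lebesgue_integral_def .
  have "(LINT X|lborel. (V (x0 + \<delta> *\<^sub>R X) - V x0) * orth_mi m X * cnj (orth_mi n X))
      = (\<Sum>k\<in>?A. \<Sum>l\<in>?B. orth_mi_coeff m k * cnj (orth_mi_coeff n l) * (LINT X|lborel. f (k + l) X))"
    unfolding eq
    by (simp add: Bochner_Integration.integral_sum f_int integrable_mult_right Bochner_Integration.integrable_sum)
  also have "cmod \<dots> \<le> (\<Sum>k\<in>?A. \<Sum>l\<in>?B. cmod (orth_mi_coeff m k * cnj (orth_mi_coeff n l)) * h_V V x0 N \<delta>)"
  proof (intro sum_norm_le)
    fix k l assume kl: "k \<in> ?A" "l \<in> ?B"
    show "cmod (orth_mi_coeff m k * cnj (orth_mi_coeff n l) * (LINT X|lborel. f (k + l) X))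
      \<le> cmod (orth_mi_coeff m k * cnj (orth_mi_coeff n l)) * h_V V x0 N \<delta>"
      unfolding norm_mult[of _ "LINT X|lborel. f (k + l) X"] using f_h[OF kl] by (rule mult_left_mono) simp
  qed
  finally show ?thesis by (simp only: sum_distrib_right)
qed

text \<open>The single change of variables yields \<open>\<delta> ^ CARD('d)\<close>, which raises
  the hypothesis on \<open>h_V\<close> to the power \<open>2 * N + 2 * CARD('d)\<close> of the
  convolution part. The trial factors only need to be bounded.\<close>

theorem potential_trial_asymptotics:
  fixes V :: "real ^ 'd::finite \<Rightarrow> complex"
  assumes V [measurable]: "V \<in> borel_measurable borel" and M: "\<And>x. cmod (V x) \<le> M"
    and flat: "((\<lambda>\<delta>. h_V V x0 N \<delta> / \<delta> ^ (2 * N + CARD('d))) \<longlongrightarrow> 0) (at_right 0)"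
    and m: "m \<in> mi_upto N" and n: "n \<in> mi_upto N"
  shows "((\<lambda>\<delta>. l2ip (\<lambda>x. (V x - V x0) * trial N x0 \<delta> m x) (trial N x0 \<delta> n) / of_real (\<delta> ^ (2 * N + 2 * CARD('d))))
    \<longlongrightarrow> 0) (at_right 0)"
proof -
  define S where "S = (\<Sum>k\<in>PiE UNIV (\<lambda>i. {..m i}). \<Sum>l\<in>PiE UNIV (\<lambda>i. {..n i}). cmod (orth_mi_coeff m k * cnj (orth_mi_coeff n l)))"
  have S0: "S \<ge> 0" unfolding S_def by (intro sum_nonneg) auto
  have mN: "mi_abs m \<le> N" and nN: "mi_abs n \<le> N" using m n by (simp_all add: mi_upto_def)
  have small: "\<forall>\<^sub>F \<delta> in at_right 0. 0 < \<delta> \<and> \<delta> < (1::real)"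
    by (intro eventually_conj eventually_at_right_less eventually_at_rightI[of 0 1]) auto
  show ?thesis
  proof (rule Lim_null_comparison)
    show "\<forall>\<^sub>F \<delta> in at_right 0. norm (l2ip (\<lambda>x. (V x - V x0) * trial N x0 \<delta> m x) (trial N x0 \<delta> n) / of_real (\<delta> ^ (2 * N + 2 * CARD('d))))
        \<le> mi_fact m * mi_fact n * S * (h_V V x0 N \<delta> / \<delta> ^ (2 * N + CARD('d)))"
      using small
    proof eventually_elim
      case (elim \<delta>)
      then have \<delta>: "\<delta> > 0" "\<delta> \<le> 1" by auto
      define J where "J = (LINT X|lborel. (V (x0 + \<delta> *\<^sub>R X) - V x0) * orth_mi m X * cnj (orth_mi n X))"
      have J: "cmod J \<le> S * h_V V x0 N \<delta>"
        unfolding J_def S_def by (rule potential_orth_mi_le[OF V M m n])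
      have "l2ip (\<lambda>x. (V x - V x0) * trial N x0 \<delta> m x) (trial N x0 \<delta> n)
          = of_real (\<delta> ^ CARD('d)) * (LINT X|lborel. (V (x0 + \<delta> *\<^sub>R X) - V x0) * trial N x0 \<delta> m (x0 + \<delta> *\<^sub>R X) * cnj (trial N x0 \<delta> n (x0 + \<delta> *\<^sub>R X)))"
        unfolding l2ip_def by (subst LINT_lborel_affine[OF _ \<delta>(1), where t = x0]) simp_all
      also have "(\<lambda>X. (V (x0 + \<delta> *\<^sub>R X) - V x0) * trial N x0 \<delta> m (x0 + \<delta> *\<^sub>R X) * cnj (trial N x0 \<delta> n (x0 + \<delta> *\<^sub>R X)))
          = (\<lambda>X. of_real (trial_factor N \<delta> m * trial_factor N \<delta> n) * ((V (x0 + \<delta> *\<^sub>R X) - V x0) * orth_mi m X * cnj (orth_mi n X)))"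
        by (simp add: fun_eq_iff trial_affine[OF \<delta>(1)])
      finally have ip: "l2ip (\<lambda>x. (V x - V x0) * trial N x0 \<delta> m x) (trial N x0 \<delta> n)
          = of_real (\<delta> ^ CARD('d)) * (of_real (trial_factor N \<delta> m * trial_factor N \<delta> n) * J)"
        by (simp only: Bochner_Integration.integral_mult_right_zero J_def)
      have tf: "\<bar>trial_factor N \<delta> k\<bar> \<le> mi_fact k" for k :: "'d \<Rightarrow> nat"
        using \<delta> mi_fact_pos[of k]
        by (simp add: trial_factor_def abs_mult power_abs mult_left_le_one_le power_le_one)
      have "cmod (l2ip (\<lambda>x. (V x - V x0) * trial N x0 \<delta> m x) (trial N x0 \<delta> n))
          = \<delta> ^ CARD('d) * (\<bar>trial_factor N \<delta> m\<bar> * \<bar>trial_factor N \<delta> n\<bar> * cmod J)"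
        unfolding ip norm_mult norm_of_real abs_mult using \<delta> by simp
      also have "\<dots> \<le> \<delta> ^ CARD('d) * (mi_fact m * mi_fact n * (S * h_V V x0 N \<delta>))"
        using tf J \<delta> mi_fact_pos[of m] mi_fact_pos[of n]
        by (intro mult_left_mono mult_mono) (auto intro: less_imp_le)
      finally have "cmod (l2ip (\<lambda>x. (V x - V x0) * trial N x0 \<delta> m x) (trial N x0 \<delta> n)) / \<delta> ^ (2 * N + 2 * CARD('d))
        \<le> \<delta> ^ CARD('d) * (mi_fact m * mi_fact n * (S * h_V V x0 N \<delta>)) / \<delta> ^ (2 * N + 2 * CARD('d))"
        using \<delta> by (intro divide_right_mono) auto
      also have "\<delta> ^ CARD('d) * (mi_fact m * mi_fact n * (S * h_V V x0 N \<delta>)) / \<delta> ^ (2 * N + 2 * CARD('d))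
        = mi_fact m * mi_fact n * S * (h_V V x0 N \<delta> / \<delta> ^ (2 * N + CARD('d)))"
        using \<delta> by (simp add: power_add mult_2)
      finally show ?case
        unfolding norm_divide norm_of_real abs_of_pos[OF zero_less_power[OF \<delta>(1)]] .
    qed
    have "((\<lambda>\<delta>. mi_fact m * mi_fact n * S * (h_V V x0 N \<delta> / \<delta> ^ (2 * N + CARD('d)))) \<longlongrightarrow> mi_fact m * mi_fact n * S * 0) (at_right 0)"
      by (intro tendsto_mult tendsto_const flat)
    then show "((\<lambda>\<delta>. mi_fact m * mi_fact n * S * (h_V V x0 N \<delta> / \<delta> ^ (2 * N + CARD('d)))) \<longlongrightarrow> 0) (at_right 0)"
      by simp
  qed
qed

section \<open>Eigenvalues of the operator\<close>

context semi_inner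
begin

text \<open>Boundedness makes \<open>B\<close> respect equality modulo null vectors; without this,
  compositions would not inherit weak linearity.\<close>

lemma bounded_op_cong_null:
  assumes B: "bounded_op B" and "u \<in> H" "v \<in> H" "nrm (u - v) = 0" "w \<in> H"
  shows "ip (B u) w = ip (B v) w"
proof (rule nrm_zero_ip)
  obtain C where C: "C > 0" "\<And>u. u \<in> H \<Longrightarrow> nrm (B u) \<le> C * nrm u"
    using bounded_op_bound[OF B] by blast
  have "nrm (B (u - v)) \<le> C * nrm (u - v)" using assms by (intro C diff_H)
  then show "nrm (B u - B v) = 0"
    using assms nrm_nonneg[of "B (u - v)"] by (simp add: nrm_bounded_op_diff bounded_opD(1))
qed (use assms bounded_opD(1)[OF B] in auto)

lemma bounded_op_compose:
  assumes A: "bounded_op A" and B: "bounded_op B"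
  shows "bounded_op (\<lambda>u. B (A u))"
  unfolding bounded_op_def
proof (intro conjI ballI allI)
  note [simp] = bounded_opD(1)[OF A] bounded_opD(1)[OF B]
  fix u v w assume u: "u \<in> H" and v: "v \<in> H" and w: "w \<in> H"
  have "ip (B (A (u + v))) w = ip (B (A u + A v)) w"
    by (rule bounded_op_cong_null[OF B])
      (use u v w in \<open>auto intro!: ip_eq_nrm_zero simp: bounded_opD(2)[OF A] ip_add\<close>)
  then show "ip (B (A (u + v))) w = ip (B (A u)) w + ip (B (A v)) w"
    using u v w by (simp add: bounded_opD(2)[OF B])
next
  note [simp] = bounded_opD(1)[OF A] bounded_opD(1)[OF B]
  fix c u w assume u: "u \<in> H" and w: "w \<in> H"
  have "ip (B (A (c \<odot> u))) w = ip (B (c \<odot> A u)) w"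
    by (rule bounded_op_cong_null[OF B])
      (use u w in \<open>auto intro!: ip_eq_nrm_zero simp: bounded_opD(3)[OF A] ip_scale\<close>)
  then show "ip (B (A (c \<odot> u))) w = c * ip (B (A u)) w"
    using u w by (simp add: bounded_opD(3)[OF B])
next
  obtain C where C: "C > 0" "\<And>u. u \<in> H \<Longrightarrow> nrm (A u) \<le> C * nrm u"
    using bounded_op_bound[OF A] by blast
  obtain D where D: "D > 0" "\<And>u. u \<in> H \<Longrightarrow> nrm (B u) \<le> D * nrm u"
    using bounded_op_bound[OF B] by blast
  show "\<exists>C. \<forall>u\<in>H. nrm (B (A u)) \<le> C * nrm u"
  proof (intro exI[of _ "D * C"] ballI)
    fix u assume u: "u \<in> H"
    have "nrm (B (A u)) \<le> D * nrm (A u)" by (rule D) (use u bounded_opD(1)[OF A] in simp)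
    also have "\<dots> \<le> D * (C * nrm u)" using C(2)[OF u] D(1) by simp
    finally show "nrm (B (A u)) \<le> D * C * nrm u" by simp
  qed
qed (use bounded_opD(1)[OF A] bounded_opD(1)[OF B] in auto)

lemma bounded_op_plus:
  assumes A: "bounded_op A" and B: "bounded_op B"
  shows "bounded_op (\<lambda>u. A u + B u)"
  unfolding bounded_op_def
proof (intro conjI ballI allI)
  note [simp] = bounded_opD(1)[OF A] bounded_opD(1)[OF B]
  fix u v w assume "u \<in> H" "v \<in> H" "w \<in> H"
  then show "ip (A (u + v) + B (u + v)) w = ip (A u + B u) w + ip (A v + B v) w"
    by (simp add: ip_add bounded_opD(2)[OF A] bounded_opD(2)[OF B])
next
  note [simp] = bounded_opD(1)[OF A] bounded_opD(1)[OF B]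
  fix c u w assume "u \<in> H" "w \<in> H"
  then show "ip (A (c \<odot> u) + B (c \<odot> u)) w = c * ip (A u + B u) w"
    by (simp add: ip_add bounded_opD(3)[OF A] bounded_opD(3)[OF B] distrib_left)
next
  obtain C where C: "C > 0" "\<And>u. u \<in> H \<Longrightarrow> nrm (A u) \<le> C * nrm u"
    using bounded_op_bound[OF A] by blast
  obtain D where D: "D > 0" "\<And>u. u \<in> H \<Longrightarrow> nrm (B u) \<le> D * nrm u"
    using bounded_op_bound[OF B] by blast
  show "\<exists>C. \<forall>u\<in>H. nrm (A u + B u) \<le> C * nrm u"
  proof (intro exI[of _ "C + D"] ballI)
    fix u assume u: "u \<in> H"
    show "nrm (A u + B u) \<le> (C + D) * nrm u"
      using nrm_add[of "A u" "B u"] C(2)[OF u] D(2)[OF u] u bounded_opD(1)[OF A] bounded_opD(1)[OF B]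
      by (simp add: distrib_right)
  qed
qed (use bounded_opD(1)[OF A] bounded_opD(1)[OF B] in auto)

lemma bounded_op_scale: 
  assumes A: "bounded_op A"
  shows "bounded_op (\<lambda>u. c \<odot> A u)"
  unfolding bounded_op_def
proof (intro conjI ballI allI)
  note [simp] = bounded_opD(1)[OF A]
  fix u v w assume "u \<in> H" "v \<in> H" "w \<in> H"
  then show "ip (c \<odot> A (u + v)) w = ip (c \<odot> A u) w + ip (c \<odot> A v) w"
    by (simp add: ip_scale bounded_opD(2)[OF A] distrib_left)
next
  note [simp] = bounded_opD(1)[OF A]
  fix d u w assume "u \<in> H" "w \<in> H"
  then show "ip (c \<odot> A (d \<odot> u)) w = d * ip (c \<odot> A u) w"
    by (simp add: ip_scale bounded_opD(3)[OF A])
next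
  obtain C where C: "C > 0" "\<And>u. u \<in> H \<Longrightarrow> nrm (A u) \<le> C * nrm u"
    using bounded_op_bound[OF A] by blast
  show "\<exists>C. \<forall>u\<in>H. nrm (c \<odot> A u) \<le> C * nrm u"
  proof (intro exI[of _ "cmod c * C"] ballI)
    fix u assume u: "u \<in> H"
    show "nrm (c \<odot> A u) \<le> cmod c * C * nrm u"
      using mult_left_mono[OF C(2)[OF u] norm_ge_zero[of c]] u
      by (simp add: nrm_scale bounded_opD(1)[OF A] mult.assoc)
  qed
qed (use bounded_opD(1)[OF A] in auto)

lemma bounded_op_minus:
  assumes A: "bounded_op A" and B: "bounded_op B"
  shows "bounded_op (\<lambda>u. A u - B u)"
  using bounded_op_plus[OF A bounded_op_scale[OF B, of "-1"]] by simp

lemma compact_op_zero: "compact_op (\<lambda>u. 0)"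
  by (rule compact_opI) (auto intro!: exI[of _ id] simp: strict_mono_def nrm_def)

lemma bounded_op_zero: "bounded_op (\<lambda>u. 0)"
  by (auto simp: bounded_op_def nrm_def intro!: exI[of _ 0])

end

section \<open>Counting eigenvalues with multiplicity\<close>

lemma sum_fun_apply: "(\<Sum>i\<in>I. f i) x = (\<Sum>i\<in>I. f i x)"
  by (induction I rule: infinite_finite_induct) auto

lemma sum_enat: "(\<Sum>i\<in>I. enat (f i)) = enat (\<Sum>i\<in>I. f i)"
  by (induction I rule: infinite_finite_induct) (auto simp: zero_enat_def)

lemma orthonormal_ae_independent:
  assumes e: "\<And>i. i < m \<Longrightarrow> e i \<in> L2"
    and orth: "\<And>i j. i < m \<Longrightarrow> j < m \<Longrightarrow> l2ip (e i) (e j) = (if i = j then 1 else 0)"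
  shows "ae_independent m e"
  unfolding ae_independent_def
proof (intro allI impI)
  fix c j assume ae: "AE x in lborel. (\<Sum>i<m. c i * e i x) = 0" and j: "j < m"
  let ?s = "\<Sum>i<m. (\<lambda>x. c i * e i x)"
  have s: "?s \<in> L2" using e by (intro l2.sum_H l2.scale_H) auto
  have "l2ip ?s (e j) = l2ip 0 (e j)"
    by (rule l2ip_cong_AE) (use s e j ae in \<open>auto simp: sum_fun_apply\<close>)
  then have "0 = l2ip ?s (e j)" using e j by simp
  also have "\<dots> = (\<Sum>i<m. l2ip (\<lambda>x. c i * e i x) (e j))"
    using e j by (intro l2.ip_sum) auto
  also have "\<dots> = (\<Sum>i<m. if i = j then c j else 0)"
    using e j orth by (intro sum.cong) (auto simp: l2.ip_scale)
  finally show "c j = 0" using j by simp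
qed

text \<open>The vectors are grouped by eigenvalue: each fibre of \<open>t\<close> is an independent
  family in its eigenspace, and the sizes of the fibres add up to \<open>k\<close>.\<close>

lemma eig_count_ge_orthonormal:
  fixes T :: "('a::euclidean_space \<Rightarrow> complex) \<Rightarrow> 'a \<Rightarrow> complex"
  assumes e: "\<And>i. i < k \<Longrightarrow> e i \<in> L2"
    and orth: "\<And>i j. i < k \<Longrightarrow> j < k \<Longrightarrow> l2ip (e i) (e j) = (if i = j then 1 else 0)"
    and eig: "\<And>i. i < k \<Longrightarrow> AE x in lborel. T (e i) x = of_real (t i) * e i x"
    and I: "\<And>i. i < k \<Longrightarrow> t i \<in> I"
  shows "enat k \<le> eig_count T I"
proof -
  let ?F = "t ` {..<k}"
  let ?J = "\<lambda>y. {i \<in> {..<k}. t i = y}"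
  have mult: "enat (card (?J y)) \<le> eig_mult T (of_real y)" for y
  proof -
    obtain h where h: "bij_betw h {..<card (?J y)} (?J y)"
      using ex_bij_betw_nat_finite[of "?J y"] by (auto simp: atLeast0LessThan)
    have hJ: "h i < k" "t (h i) = y" if "i < card (?J y)" for i
      using bij_betwE[OF h] that by auto
    have inj: "h i = h j \<longleftrightarrow> i = j" if "i < card (?J y)" "j < card (?J y)" for i j
      using h that by (auto simp: bij_betw_def inj_on_def)
    have es: "e (h i) \<in> eigenspace T (of_real y)" if "i < card (?J y)" for i
      using e[OF hJ(1)[OF that]] eig[OF hJ(1)[OF that]] by (simp add: eigenspace_def hJ(2)[OF that])
    have ind: "ae_independent (card (?J y)) (\<lambda>i. e (h i))"
      by (rule orthonormal_ae_independent) (use hJ e orth inj in auto)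
    show ?thesis
      unfolding eig_mult_def
    proof (rule SUP_upper, intro CollectI exI conjI allI impI)
      show "ae_independent (card (?J y)) (\<lambda>i. e (h i))" by (rule ind)
    qed (rule es)
  qed
  have "k = (\<Sum>i<k. 1)" by simp
  also have "\<dots> = (\<Sum>y\<in>?F. \<Sum>i\<in>?J y. 1)" by (rule sum.image_gen) simp
  also have "\<dots> = (\<Sum>y\<in>?F. card (?J y))" by simp
  finally have "enat k = (\<Sum>y\<in>?F. enat (card (?J y)))" by (simp only: sum_enat)
  also have "\<dots> \<le> (\<Sum>y\<in>?F. eig_mult T (of_real y))" by (intro sum_mono mult)
  also have "\<dots> \<le> eig_count T I"
    unfolding eig_count_def by (rule SUP_upper) (use I in auto)
  finally show ?thesis .
qed

text \<open>The form is minus the squared norm of \<open>c\<close> plus an error of at most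
  \<open>\<epsilon>\<close> times the squared sum of the moduli, and this squared sum is at most
  \<open>k\<close> times the squared norm.\<close>

lemma perturbed_negative_form:
  fixes t :: "nat \<Rightarrow> nat \<Rightarrow> complex"
  assumes t: "\<And>i j. i < k \<Longrightarrow> j < k \<Longrightarrow> cmod (t i j + (if i = j then 1 else 0)) \<le> \<epsilon>"
    and \<epsilon>: "\<epsilon> * real k < 1" "0 \<le> \<epsilon>" and c: "\<exists>i<k. c i \<noteq> 0"
  shows "Re (\<Sum>i<k. \<Sum>j<k. c i * cnj (c j) * t i j) < 0"
proof -
  define s where "s = (\<Sum>i<k. (cmod (c i))\<^sup>2)"
  obtain i0 where i0: "i0 < k" "c i0 \<noteq> 0" using c by auto
  have "(cmod (c i0))\<^sup>2 \<le> s" unfolding s_def by (rule member_le_sum) (use i0 in auto)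
  then have s: "s > 0" using i0 by (smt (verit) norm_eq_zero zero_less_power2)
  define d where "d i j = t i j + (if i = j then 1 else 0)" for i j
  have "(\<Sum>i<k. \<Sum>j<k. c i * cnj (c j) * t i j)
      = (\<Sum>i<k. \<Sum>j<k. c i * cnj (c j) * d i j - (if i = j then c i * cnj (c i) else 0))"
    by (intro sum.cong refl) (auto simp: d_def algebra_simps)
  also have "\<dots> = (\<Sum>i<k. \<Sum>j<k. c i * cnj (c j) * d i j) - (\<Sum>i<k. c i * cnj (c i))"
    by (simp add: sum_subtractf)
  also have "(\<Sum>i<k. c i * cnj (c i)) = of_real s"
    by (simp add: s_def complex_norm_square del: of_real_power)
  finally have "Re (\<Sum>i<k. \<Sum>j<k. c i * cnj (c j) * t i j) = Re (\<Sum>i<k. \<Sum>j<k. c i * cnj (c j) * d i j) - s"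
    by simp
  also have "Re (\<Sum>i<k. \<Sum>j<k. c i * cnj (c j) * d i j) \<le> cmod (\<Sum>i<k. \<Sum>j<k. c i * cnj (c j) * d i j)"
    by (rule complex_Re_le_cmod)
  also have "\<dots> \<le> (\<Sum>i<k. \<Sum>j<k. cmod (c i) * cmod (c j) * \<epsilon>)"
  proof (intro sum_norm_le)
    fix i j assume "i \<in> {..<k}" "j \<in> {..<k}"
    then have "cmod (d i j) \<le> \<epsilon>" unfolding d_def by (intro t) auto
    then show "cmod (c i * cnj (c j) * d i j) \<le> cmod (c i) * cmod (c j) * \<epsilon>"
      by (simp add: norm_mult mult_left_mono)
  qed
  also have "\<dots> = \<epsilon> * (\<Sum>i<k. cmod (c i))\<^sup>2"
    by (simp add: power2_eq_square sum_product sum_distrib_left mult_ac)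
  also have "\<dots> \<le> \<epsilon> * (real k * s)"
    using sum_squared_le_sum_of_squares[of "\<lambda>i. cmod (c i)" "{..<k}"] \<epsilon>(2)
    by (intro mult_left_mono) (auto simp: s_def mult.commute)
  also have "\<dots> < s" using \<epsilon>(1) s by (simp add: mult.assoc[symmetric])
  finally show ?thesis by simp
qed

text \<open>The square root is not Lipschitz near \<open>t = -1\<close>, that is, near the minimum
  of \<open>V\<close>, but rationalizing bounds its deviation from the value at
  \<open>t = 0\<close>. So \<open>1 - w\<close> inherits the decay of \<open>V\<close>.\<close>

lemma sqrt_one_plus_le:
  fixes t :: real
  assumes "t \<ge> -1"
  shows "\<bar>1 - sqrt (1 + t)\<bar> \<le> \<bar>t\<bar>"
proof -
  have "(1 - sqrt (1 + t)) * (1 + sqrt (1 + t)) = - t"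
    using assms by (simp add: algebra_simps)
  then have "\<bar>1 - sqrt (1 + t)\<bar> * \<bar>1 + sqrt (1 + t)\<bar> = \<bar>t\<bar>" by (metis abs_minus_cancel abs_mult)
  moreover have "1 \<le> \<bar>1 + sqrt (1 + t)\<bar>" using assms by simp
  ultimately show ?thesis by (metis abs_ge_zero mult_left_mono mult.right_neutral)
qed

lemma potential_form_nonneg:
  fixes V :: "'a::euclidean_space \<Rightarrow> complex"
  assumes V: "\<And>x. V x \<in> \<real>" "\<And>x. \<mu> \<le> Re (V x)"
  shows "0 \<le> Re (l2ip (\<lambda>x. (V x - of_real \<mu>) * u x) u)"
proof -
  have "(V x - of_real \<mu>) * u x * cnj (u x) = of_real ((Re (V x) - \<mu>) * (cmod (u x))\<^sup>2)" for x
    using V(1)[of x] by (simp add: complex_norm_square mult.assoc of_real_Re del: of_real_power)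
  then have "l2ip (\<lambda>x. (V x - of_real \<mu>) * u x) u = of_real (LINT x|lborel. (Re (V x) - \<mu>) * (cmod (u x))\<^sup>2)"
    unfolding l2ip_def by (simp only: integral_complex_of_real)
  then show ?thesis using V(2) by (simp add: integral_nonneg_AE)
qed

text \<open>The compact part is \<open>A - w A w = g A + A g - g A g\<close> with \<open>g = 1 - w\<close>.\<close>

lemma compact_minorant:
  fixes a V :: "real ^ 'd::finite \<Rightarrow> complex"
  assumes a: "integrable lborel a" and herm: "hermitian_ae a"
    and V: "V \<in> borel_measurable borel" "\<And>x. V x \<in> \<real>" "\<And>x. cmod (V x) \<le> M" "\<And>x. \<mu> \<le> Re (V x)"
    and decay: "\<And>\<epsilon>. \<epsilon> > 0 \<Longrightarrow> \<exists>R. \<forall>x. norm x > R \<longrightarrow> cmod (V x) < \<epsilon>"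
    and \<mu>: "\<And>\<xi>. \<mu> \<le> Re (fourier a \<xi>)"
  obtains K where "l2.bounded_op K" "l2.compact_op K"
    "\<And>u. u \<in> L2 \<Longrightarrow> Re (l2ip (K u) u) \<le> Re (l2ip (conv a u) u) + Re (l2ip (\<lambda>x. (V x - of_real \<mu>) * u x) u)"
proof (cases "\<mu> < 0")
  \<comment> \<open>For \<open>\<mu> \<ge> 0\<close> both forms on the right are nonnegative, so the
    zero operator will do.\<close>
  case False
  have pot: "0 \<le> Re (l2ip (\<lambda>x. (V x - of_real \<mu>) * u x) u)" for u
    using V(2,4) by (rule potential_form_nonneg)
  have conv: "0 \<le> Re (l2ip (conv a u) u)" if "u \<in> L2" for u
    using conv_form_ge[OF a herm \<mu> that] False by (smt (verit) mult_nonneg_nonneg zero_le_power2)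
  show thesis
    by (rule that[OF l2.bounded_op_zero l2.compact_op_zero])
      (use pot conv in \<open>simp add: add_nonneg_nonneg l2ip_def\<close>)
next
  case True
  define w where "w x = sqrt (1 + Re (V x) / \<bar>\<mu>\<bar>)" for x
  define g where "g x = complex_of_real (1 - w x)" for x
  have ge: "Re (V x) / \<bar>\<mu>\<bar> \<ge> -1" for x using V(4)[of x] True by (simp add: field_simps)
  have g_le: "cmod (g x) \<le> cmod (V x) / \<bar>\<mu>\<bar>" for x
  proof -
    have "cmod (g x) \<le> \<bar>Re (V x) / \<bar>\<mu>\<bar>\<bar>"
      unfolding g_def norm_of_real w_def using ge by (rule sqrt_one_plus_le)
    also have "\<dots> \<le> cmod (V x) / \<bar>\<mu>\<bar>" by (simp add: divide_right_mono abs_Re_le_cmod)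
    finally show ?thesis .
  qed
  have g_bound: "cmod (g x) \<le> M / \<bar>\<mu>\<bar>" for x
    using g_le[of x] V(3)[of x] by (meson abs_ge_zero divide_right_mono order.trans)
  have [measurable]: "V \<in> borel_measurable borel" by (rule V(1))
  have g_meas: "g \<in> borel_measurable borel" unfolding g_def w_def by measurable
  have g_decay: "\<exists>R. \<forall>x. norm x > R \<longrightarrow> cmod (g x) \<le> \<epsilon>" if \<epsilon>: "\<epsilon> > 0" for \<epsilon>
  proof -
    have e\<mu>: "\<epsilon> * \<bar>\<mu>\<bar> > 0" using \<epsilon> True by (intro mult_pos_pos) auto
    obtain R where R: "\<And>x. norm x > R \<Longrightarrow> cmod (V x) < \<epsilon> * \<bar>\<mu>\<bar>"
      using decay[OF e\<mu>] by blast
    have "cmod (g x) \<le> \<epsilon>" if "norm x > R" for x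
    proof -
      have "\<bar>\<mu>\<bar> > 0" using True by simp
      from pos_divide_le_eq[OF this, THEN iffD2, OF less_imp_le[OF R[OF that]]]
      have "cmod (V x) / \<bar>\<mu>\<bar> \<le> \<epsilon>" .
      then show ?thesis using g_le[of x] by linarith
    qed
    then show ?thesis by blast
  qed
  let ?G = "\<lambda>u x. g x * u x" and ?A = "conv a"
  have A: "l2.bounded_op ?A" using a by (rule bounded_op_conv)
  have G: "l2.bounded_op ?G" using g_meas g_bound by (rule bounded_op_mult)
  have A_sym: "l2ip (?A u) v = l2ip u (?A v)" if "u \<in> L2" "v \<in> L2" for u v
    using a herm that by (rule conv_symmetric)
  have G_sym: "l2ip (?G u) v = l2ip u (?G v)" if "u \<in> L2" "v \<in> L2" for u v
    by (rule mult_symmetric) (simp add: g_def)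
  note AL = conv_in_L2(1)[OF a] and GL = mult_in_L2(1)[OF g_meas g_bound]
  let ?K = "\<lambda>u. ?G (?A u) + ?A (?G u) - ?G (?A (?G u))"
  show thesis
  proof (rule that)
    show "l2.bounded_op ?K"
      by (intro l2.bounded_op_minus l2.bounded_op_plus l2.bounded_op_compose[OF A G]
          l2.bounded_op_compose[OF G A] l2.bounded_op_compose[OF l2.bounded_op_compose[OF G A] G])
    have AG: "l2.compact_op (\<lambda>u. ?A (?G u))"
      using a g_meas g_bound g_decay by (rule compact_op_conv_mult)
    show "l2.compact_op ?K"
      by (rule l2.compact_op_commutator_perturbation[OF A A_sym G G_sym AG])
  next
    fix u :: "real ^ 'd \<Rightarrow> complex" assume u: "u \<in> L2"
    \<comment> \<open>\<open>z\<close> is \<open>w u\<close>. The potential contributes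
      \<open>-\<mu>\<close> times its squared norm, so the right-hand side minus the form of
      \<open>K\<close> is that of \<open>A - \<mu>\<close> at \<open>z\<close>, which
      \<open>conv_form_ge\<close> shows to be nonnegative.\<close>
    define z where "z = u - ?G u"
    have zL: "z \<in> L2" unfolding z_def using u GL[OF u] by (rule l2.diff_H)
    have zx: "z x = of_real (w x) * u x" for x by (simp add: z_def g_def algebra_simps)
    have w2: "(w x)\<^sup>2 = 1 + Re (V x) / \<bar>\<mu>\<bar>" for x using ge[of x] by (simp add: w_def)
    have "(V x - of_real \<mu>) * u x * cnj (u x) = of_real (- \<mu>) * (z x * cnj (z x))" for x
    proof -
      have "Re (V x) - \<mu> = - \<mu> * (w x)\<^sup>2" using True by (simp add: w2 field_simps)
      then have "V x - of_real \<mu> = of_real (- \<mu> * (w x)\<^sup>2)" using V(2)[of x] by (metis of_real_Re of_real_diff)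
      then show ?thesis by (simp add: zx power2_eq_square mult_ac)
    qed
    then have pot: "l2ip (\<lambda>x. (V x - of_real \<mu>) * u x) u = of_real (- \<mu>) * l2ip z z"
      unfolding l2ip_def by (simp only: Bochner_Integration.integral_mult_right_zero)
    have "l2ip (?K u) u = l2ip (?A u) (?G u) + l2ip (?A (?G u)) u - l2ip (?A (?G u)) (?G u)"
      using u AL GL by (simp add: l2.ip_diff l2.ip_add G_sym)
    moreover have "l2ip (?A z) z = l2ip (?A u) u - l2ip (?A (?G u)) u - (l2ip (?A u) (?G u) - l2ip (?A (?G u)) (?G u))"
    proof -
      have Gu: "?G u \<in> L2" using u by (rule GL)
      have null: "nrm2 (?A z - (?A u - ?A (?G u))) = 0"
        unfolding z_def by (rule l2.bounded_op_diff[OF A u Gu])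
      have "l2ip (?A z) z = l2ip (?A u - ?A (?G u)) z"
        by (rule l2.nrm_zero_ip[OF _ _ _ null]) (intro AL l2.diff_H zL u Gu)+
      also have "\<dots> = l2ip (?A u) z - l2ip (?A (?G u)) z"
        by (rule l2.ip_diff) (intro AL zL u Gu)+
      also have "l2ip (?A u) z = l2ip (?A u) u - l2ip (?A u) (?G u)"
        unfolding z_def by (rule l2.ip_diff_right) (intro AL u Gu)+
      also have "l2ip (?A (?G u)) z = l2ip (?A (?G u)) u - l2ip (?A (?G u)) (?G u)"
        unfolding z_def by (rule l2.ip_diff_right) (intro AL u Gu)+
      finally show ?thesis by simp
    qed
    moreover have "\<mu> * (nrm2 z)\<^sup>2 \<le> Re (l2ip (?A z) z)" by (rule conv_form_ge[OF a herm \<mu> zL])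
    ultimately show "Re (l2ip (?K u) u) \<le> Re (l2ip (conv a u) u) + Re (l2ip (\<lambda>x. (V x - of_real \<mu>) * u x) u)"
      unfolding pot by (simp add: nrm2_square l2ip_self)
  qed
qed

section \<open>Families of trial functions with negative form\<close>

text \<open>The sesquilinear form that polarizes \<open>form_a\<close>; Gram-Schmidt requires
  it.\<close>

definition deriv_form ::
    "(real ^ 'd::finite \<Rightarrow> complex) \<Rightarrow> nat \<Rightarrow> (('d \<Rightarrow> nat) \<Rightarrow> complex) \<Rightarrow> (('d \<Rightarrow> nat) \<Rightarrow> complex) \<Rightarrow> complex" where
  "deriv_form a N \<zeta> \<eta> = (\<Sum>n\<in>mi_upto N. \<Sum>m\<in>mi_upto N.
     (-1) ^ mi_abs n * mi_deriv (n + m) a 0 * \<zeta> m * cnj (\<eta> n))"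

lemma deriv_form_self: "deriv_form a N \<zeta> \<zeta> = form_a a N \<zeta>"
  by (simp add: deriv_form_def form_a_def)

definition trial_comb ::
    "nat \<Rightarrow> real ^ 'd::finite \<Rightarrow> (('d \<Rightarrow> nat) \<Rightarrow> complex) \<Rightarrow> real \<Rightarrow> real ^ 'd \<Rightarrow> complex" where
  "trial_comb N x0 \<zeta> \<delta> = (\<Sum>m\<in>mi_upto N. (\<lambda>x. \<zeta> m * trial N x0 \<delta> m x))"

lemma trial_comb_L2: "\<delta> > 0 \<Longrightarrow> trial_comb N x0 \<zeta> \<delta> \<in> L2"
  unfolding trial_comb_def by (intro l2.sum_H l2.scale_H trial_L2)

text \<open>By sesquilinearity only the finitely many pairs of trial functions matter, and their
  limits are the coefficients of \<open>deriv_form\<close>.\<close>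

lemma trial_comb_limit:
  fixes t :: "(real ^ 'd::finite \<Rightarrow> complex) \<Rightarrow> (real ^ 'd \<Rightarrow> complex) \<Rightarrow> complex"
  assumes t: "hermitian_form (\<lambda>(c::complex) f x. c * f x) L2 t"
    and lim: "\<And>m n. m \<in> mi_upto N \<Longrightarrow> n \<in> mi_upto N \<Longrightarrow>
      ((\<lambda>\<delta>. t (trial N x0 \<delta> m) (trial N x0 \<delta> n) / of_real (\<delta> ^ s)) \<longlongrightarrow> (-1) ^ mi_abs n * mi_deriv (n + m) a 0) (at_right 0)"
  shows "((\<lambda>\<delta>. t (trial_comb N x0 \<zeta> \<delta>) (trial_comb N x0 \<eta> \<delta>) / of_real (\<delta> ^ s)) \<longlongrightarrow> deriv_form a N \<zeta> \<eta>) (at_right 0)"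
proof -
  interpret t: hermitian_form "\<lambda>(c::complex) f x. c * f x" L2 t by (rule t)
  have expand: "t (trial_comb N x0 \<zeta> \<delta>) (trial_comb N x0 \<eta> \<delta>)
      = (\<Sum>m\<in>mi_upto N. \<Sum>n\<in>mi_upto N. \<zeta> m * cnj (\<eta> n) * t (trial N x0 \<delta> m) (trial N x0 \<delta> n))" if \<delta>: "\<delta> > 0" for \<delta>
  proof -
    have "t (trial_comb N x0 \<zeta> \<delta>) (trial_comb N x0 \<eta> \<delta>)
        = (\<Sum>m\<in>mi_upto N. t (\<lambda>x. \<zeta> m * trial N x0 \<delta> m x) (trial_comb N x0 \<eta> \<delta>))"
      unfolding trial_comb_def[of N x0 \<zeta>]
      by (rule t.ip_sum) (intro l2.scale_H trial_L2 trial_comb_L2 \<delta>)+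
    also have "\<dots> = (\<Sum>m\<in>mi_upto N. \<Sum>n\<in>mi_upto N. \<zeta> m * cnj (\<eta> n) * t (trial N x0 \<delta> m) (trial N x0 \<delta> n))"
    proof (rule sum.cong[OF refl])
      fix m
      have "t (\<lambda>x. \<zeta> m * trial N x0 \<delta> m x) (trial_comb N x0 \<eta> \<delta>) = \<zeta> m * t (trial N x0 \<delta> m) (trial_comb N x0 \<eta> \<delta>)"
        by (rule t.ip_scale) (intro trial_L2 trial_comb_L2 \<delta>)+
      also have "t (trial N x0 \<delta> m) (trial_comb N x0 \<eta> \<delta>) = (\<Sum>n\<in>mi_upto N. t (trial N x0 \<delta> m) (\<lambda>x. \<eta> n * trial N x0 \<delta> n x))"
        unfolding trial_comb_def by (rule t.ip_sum_right) (intro l2.scale_H trial_L2 \<delta>)+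
      also have "\<dots> = (\<Sum>n\<in>mi_upto N. cnj (\<eta> n) * t (trial N x0 \<delta> m) (trial N x0 \<delta> n))"
        by (intro sum.cong refl t.ip_scale_right trial_L2 \<delta>)
      finally show "t (\<lambda>x. \<zeta> m * trial N x0 \<delta> m x) (trial_comb N x0 \<eta> \<delta>)
          = (\<Sum>n\<in>mi_upto N. \<zeta> m * cnj (\<eta> n) * t (trial N x0 \<delta> m) (trial N x0 \<delta> n))"
        by (simp only: sum_distrib_left mult.assoc)
    qed
    finally show ?thesis .
  qed
  have "((\<lambda>\<delta>. \<Sum>m\<in>mi_upto N. \<Sum>n\<in>mi_upto N. \<zeta> m * cnj (\<eta> n) * (t (trial N x0 \<delta> m) (trial N x0 \<delta> n) / of_real (\<delta> ^ s)))
      \<longlongrightarrow> (\<Sum>m\<in>mi_upto N. \<Sum>n\<in>mi_upto N. \<zeta> m * cnj (\<eta> n) * ((-1) ^ mi_abs n * mi_deriv (n + m) a 0))) (at_right 0)"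
    by (intro tendsto_sum tendsto_mult tendsto_const lim)
  also have "(\<Sum>m\<in>mi_upto N. \<Sum>n\<in>mi_upto N. \<zeta> m * cnj (\<eta> n) * ((-1) ^ mi_abs n * mi_deriv (n + m) a 0)) = deriv_form a N \<zeta> \<eta>"
    unfolding deriv_form_def by (subst sum.swap) (simp only: mult_ac)
  finally have L: "((\<lambda>\<delta>. \<Sum>m\<in>mi_upto N. \<Sum>n\<in>mi_upto N. \<zeta> m * cnj (\<eta> n) * (t (trial N x0 \<delta> m) (trial N x0 \<delta> n) / of_real (\<delta> ^ s)))
      \<longlongrightarrow> deriv_form a N \<zeta> \<eta>) (at_right 0)" .
  have "\<forall>\<^sub>F \<delta> in at_right 0. (\<Sum>m\<in>mi_upto N. \<Sum>n\<in>mi_upto N. \<zeta> m * cnj (\<eta> n) * (t (trial N x0 \<delta> m) (trial N x0 \<delta> n) / of_real (\<delta> ^ s)))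
      = t (trial_comb N x0 \<zeta> \<delta>) (trial_comb N x0 \<eta> \<delta>) / of_real (\<delta> ^ s)"
    using eventually_at_right_less[of 0]
    by eventually_elim (simp only: expand sum_divide_distrib times_divide_eq_right)
  from Lim_transform_eventually[OF L this] show ?thesis .
qed

text \<open>The form of \<open>a\<close> inherits Hermitian symmetry from \<open>t\<close> by passing to the limit, so that it can
  be diagonalized on \<open>S\<close> by the Gram--Schmidt process.\<close>

lemma negative_trial_family:
  fixes t :: "(real ^ 'd::finite \<Rightarrow> complex) \<Rightarrow> (real ^ 'd \<Rightarrow> complex) \<Rightarrow> complex"
  assumes t: "hermitian_form (\<lambda>(c::complex) f x. c * f x) L2 t"
    and lim: "\<And>m n. m \<in> mi_upto N \<Longrightarrow> n \<in> mi_upto N \<Longrightarrow>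
      ((\<lambda>\<delta>. t (trial N x0 \<delta> m) (trial N x0 \<delta> n) / of_real (\<delta> ^ s)) \<longlongrightarrow> (-1) ^ mi_abs n * mi_deriv (n + m) a 0) (at_right 0)"
    and S: "cfun.subspace S" and neg: "\<forall>\<zeta>\<in>S. \<zeta> \<noteq> 0 \<longrightarrow> Re (form_a a N \<zeta>) < 0"
  obtains u where "\<And>i. i < cfun.dim S \<Longrightarrow> u i \<in> L2"
    "\<And>c. \<exists>i<cfun.dim S. c i \<noteq> 0 \<Longrightarrow>
      Re (t (\<Sum>i<cfun.dim S. (\<lambda>x. c i * u i x)) (\<Sum>i<cfun.dim S. (\<lambda>x. c i * u i x))) < 0"
proof (cases "cfun.dim S = 0")
  case True
  then show thesis using that[of "\<lambda>_. 0"] by simp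
next
  case False
  define k where "k = cfun.dim S"
  interpret t: hermitian_form "\<lambda>(c::complex) f x. c * f x" L2 t by (rule t)
  note L = trial_comb_limit[OF t lim]
  have sym: "deriv_form a N \<eta> \<zeta> = cnj (deriv_form a N \<zeta> \<eta>)" for \<zeta> \<eta>
  proof (rule tendsto_unique[OF trivial_limit_at_right_real L])
    have L': "((\<lambda>\<delta>. cnj (t (trial_comb N x0 \<zeta> \<delta>) (trial_comb N x0 \<eta> \<delta>) / of_real (\<delta> ^ s))) \<longlongrightarrow> cnj (deriv_form a N \<zeta> \<eta>)) (at_right 0)"
      by (intro tendsto_cnj L)
    have "\<forall>\<^sub>F \<delta> in at_right 0. cnj (t (trial_comb N x0 \<zeta> \<delta>) (trial_comb N x0 \<eta> \<delta>) / of_real (\<delta> ^ s))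
        = t (trial_comb N x0 \<eta> \<delta>) (trial_comb N x0 \<zeta> \<delta>) / of_real (\<delta> ^ s)"
      using eventually_at_right_less[of 0]
    proof eventually_elim
      case (elim \<delta>)
      have "t (trial_comb N x0 \<eta> \<delta>) (trial_comb N x0 \<zeta> \<delta>) = cnj (t (trial_comb N x0 \<zeta> \<delta>) (trial_comb N x0 \<eta> \<delta>))"
        by (rule t.ip_sym) (rule trial_comb_L2[OF elim])+
      then show ?case by simp
    qed
    from Lim_transform_eventually[OF L' this]
    show "((\<lambda>\<delta>. t (trial_comb N x0 \<eta> \<delta>) (trial_comb N x0 \<zeta> \<delta>) / of_real (\<delta> ^ s)) \<longlongrightarrow> cnj (deriv_form a N \<zeta> \<eta>)) (at_right 0)" .
  qed
  interpret F: semi_inner "\<lambda>(c::complex) f x. c * f x" S "\<lambda>\<zeta> \<eta>. - deriv_form a N \<zeta> \<eta>"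
  proof
    show "cfun.subspace S" by (rule S)
  next
    fix u v w :: "('d \<Rightarrow> nat) \<Rightarrow> complex"
    show "- deriv_form a N (u + v) w = - deriv_form a N u w + - deriv_form a N v w"
      by (simp add: deriv_form_def distrib_left distrib_right sum.distrib)
  next
    fix c and u w :: "('d \<Rightarrow> nat) \<Rightarrow> complex"
    show "- deriv_form a N (\<lambda>x. c * u x) w = c * - deriv_form a N u w"
      by (simp add: deriv_form_def sum_distrib_left mult_ac)
  next
    fix u v :: "('d \<Rightarrow> nat) \<Rightarrow> complex"
    show "- deriv_form a N v u = cnj (- deriv_form a N u v)" using sym[of v u] by simp
  next
    fix u assume "u \<in> S"
    then have "u = 0 \<or> Re (form_a a N u) < 0" using neg by blast
    then show "0 \<le> Re (- deriv_form a N u u)"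
      by (auto simp: deriv_form_self form_a_def)
  qed
  obtain Bs where Bs: "Bs \<subseteq> S" "cfun.independent Bs" "S \<subseteq> cfun.span Bs" "card Bs = cfun.dim S"
    using cfun.basis_exists by blast
  \<comment> \<open>An infinite basis would have cardinality 0, which has been excluded.\<close>
  have fin: "finite Bs" using Bs(4) False card.infinite by fastforce
  have pos: "0 < Re (- deriv_form a N v v)" if "v \<in> S" "v \<noteq> 0" for v
    using neg that by (simp add: deriv_form_self)
  obtain f where fS: "\<And>i. i < k \<Longrightarrow> f i \<in> S"
    and f: "\<And>i j. i < k \<Longrightarrow> j < k \<Longrightarrow> - deriv_form a N (f i) (f j) = (if i = j then 1 else 0)"
    using F.Gram_Schmidt_exists[OF pos fin Bs(2,1), of k] Bs(4) unfolding k_def by auto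
  \<comment> \<open>Entrywise closeness to minus the identity matrix preserves negativity on all
    combinations as soon as \<open>\<epsilon> * real k < 1\<close>.\<close>
  define \<epsilon> where "\<epsilon> = 1 / (real k + 1)"
  have \<epsilon>: "\<epsilon> > 0" "\<epsilon> * real k < 1" by (simp_all add: \<epsilon>_def field_simps)
  have "\<forall>\<^sub>F \<delta> in at_right 0. \<forall>(i, j)\<in>{..<k} \<times> {..<k}.
      cmod (t (trial_comb N x0 (f i) \<delta>) (trial_comb N x0 (f j) \<delta>) / of_real (\<delta> ^ s) + (if i = j then 1 else 0)) < \<epsilon>"
  proof (rule eventually_ball_finite)
    show "\<forall>p\<in>{..<k} \<times> {..<k}. \<forall>\<^sub>F \<delta> in at_right 0. case p of (i, j) \<Rightarrow>
      cmod (t (trial_comb N x0 (f i) \<delta>) (trial_comb N x0 (f j) \<delta>) / of_real (\<delta> ^ s) + (if i = j then 1 else 0)) < \<epsilon>"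
    proof
      fix p assume "p \<in> {..<k} \<times> {..<k}"
      then obtain i j where p: "p = (i, j)" "i < k" "j < k" by auto
      have "((\<lambda>\<delta>. t (trial_comb N x0 (f i) \<delta>) (trial_comb N x0 (f j) \<delta>) / of_real (\<delta> ^ s)) \<longlongrightarrow> - (if i = j then 1 else 0)) (at_right 0)"
        using L[of "f i" "f j"] unfolding arg_cong[OF f[OF p(2,3)], of uminus, unfolded minus_minus] .
      from tendstoD[OF this \<epsilon>(1)]
      show "\<forall>\<^sub>F \<delta> in at_right 0. case p of (i, j) \<Rightarrow>
        cmod (t (trial_comb N x0 (f i) \<delta>) (trial_comb N x0 (f j) \<delta>) / of_real (\<delta> ^ s) + (if i = j then 1 else 0)) < \<epsilon>"
        by (simp add: p(1) dist_norm)
    qed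
  qed simp
  then have "\<forall>\<^sub>F \<delta> in at_right 0. 0 < \<delta> \<and> (\<forall>(i, j)\<in>{..<k} \<times> {..<k}.
      cmod (t (trial_comb N x0 (f i) \<delta>) (trial_comb N x0 (f j) \<delta>) / of_real (\<delta> ^ s) + (if i = j then 1 else 0)) < \<epsilon>)"
    by (intro eventually_conj eventually_at_right_less)
  from eventually_happens'[OF trivial_limit_at_right_real this]
  obtain \<delta> where \<delta>: "0 < \<delta>" and close: "\<And>i j. i < k \<Longrightarrow> j < k \<Longrightarrow>
      cmod (t (trial_comb N x0 (f i) \<delta>) (trial_comb N x0 (f j) \<delta>) / of_real (\<delta> ^ s) + (if i = j then 1 else 0)) < \<epsilon>"
    by auto
  define u where "u i = trial_comb N x0 (f i) \<delta>" for i
  have uL: "u i \<in> L2" for i unfolding u_def using \<delta> by (rule trial_comb_L2)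
  have "Re (t (\<Sum>i<k. (\<lambda>x. c i * u i x)) (\<Sum>i<k. (\<lambda>x. c i * u i x))) < 0" if c: "\<exists>i<k. c i \<noteq> 0" for c
  proof -
    let ?v = "\<Sum>i<k. (\<lambda>x. c i * u i x)"
    have vL: "?v \<in> L2" by (intro l2.sum_H l2.scale_H uL)
    have "t ?v ?v = (\<Sum>i<k. t (\<lambda>x. c i * u i x) ?v)"
      by (rule t.ip_sum) (intro l2.scale_H uL vL)+
    also have "\<dots> = (\<Sum>i<k. \<Sum>j<k. c i * cnj (c j) * t (u i) (u j))"
    proof (rule sum.cong[OF refl])
      fix i
      have "t (\<lambda>x. c i * u i x) ?v = c i * t (u i) ?v" by (rule t.ip_scale) (intro uL vL)+
      also have "t (u i) ?v = (\<Sum>j<k. t (u i) (\<lambda>x. c j * u j x))"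
        by (rule t.ip_sum_right) (intro l2.scale_H uL)+
      also have "\<dots> = (\<Sum>j<k. cnj (c j) * t (u i) (u j))"
        by (intro sum.cong refl t.ip_scale_right uL)
      finally show "t (\<lambda>x. c i * u i x) ?v = (\<Sum>j<k. c i * cnj (c j) * t (u i) (u j))"
        by (simp only: sum_distrib_left mult.assoc)
    qed
    also have "\<dots> = of_real (\<delta> ^ s) * (\<Sum>i<k. \<Sum>j<k. c i * cnj (c j) * (t (u i) (u j) / of_real (\<delta> ^ s)))"
      using \<delta> by (simp add: sum_distrib_left)
    finally have "Re (t ?v ?v) = \<delta> ^ s * Re (\<Sum>i<k. \<Sum>j<k. c i * cnj (c j) * (t (u i) (u j) / of_real (\<delta> ^ s)))"
      by (simp only: Re_complex_of_real Im_complex_of_real complex_mult(1) times_complex.simps(1) mult_zero_left diff_zero)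
    moreover have "Re (\<Sum>i<k. \<Sum>j<k. c i * cnj (c j) * (t (u i) (u j) / of_real (\<delta> ^ s))) < 0"
    proof (rule perturbed_negative_form)
      show "cmod (t (u i) (u j) / of_real (\<delta> ^ s) + (if i = j then 1 else 0)) \<le> \<epsilon>" if "i < k" "j < k" for i j
        unfolding u_def using close[OF that] by (rule less_imp_le)
    qed (use \<epsilon> c in auto)
    ultimately show ?thesis using \<delta> by (simp add: mult_pos_neg)
  qed
  then show thesis using that[of u] uL unfolding k_def by blast
qed

theorem theorem2p4:
  fixes a V Vhat :: "real ^ 'd::finite \<Rightarrow> complex"
    and x0 :: "real ^ 'd"
    and N :: nat
    and r :: real
    and S :: "(('d \<Rightarrow> nat) \<Rightarrow> complex) set"
  assumes a_L1: "integrable lborel a"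
    and a_herm: "hermitian_ae a"
    and Vhat_L1: "integrable lborel Vhat"
    and Vhat_herm: "hermitian_ae Vhat"
    and V_eq: "V = fourier Vhat"
    and x0_min: "\<forall>x. Re (V x0) \<le> Re (V x)"
    and Vmin_le_amin: "inf_re V \<le> inf_re (fourier a)"
    and r_pos: "r > 0"
    and a_smooth: "Ck_on (2 * N + 1) a (cube r 0)"
    and V_flat: "((\<lambda>\<delta>. h_V V x0 N \<delta> / \<delta> ^ (2 * N + CARD('d))) \<longlongrightarrow> 0) (at_right 0)"
    and S_subspace: "cfun.subspace S" "S \<subseteq> coeff_space N"
    and S_negative: "\<forall>\<zeta>\<in>S. \<zeta> \<noteq> 0 \<longrightarrow> Re (form_a a N \<zeta>) < 0"
  shows "enat (cfun.dim S) \<le>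
    eig_count (conv_mult_op a V)
      {inf_re (fourier a) + inf_re V ..< min (inf_re (fourier a)) (inf_re V)}"
proof -
  define k where "k = cfun.dim S"
  define \<alpha> where "\<alpha> = inf_re (fourier a)"
  define \<mu> where "\<mu> = Re (V x0)"
  have a_meas: "a \<in> borel_measurable borel" using a_L1 by (rule integrable_lborel_measurable)
  have V_real: "V x \<in> \<real>" for x unfolding V_eq using Vhat_L1 Vhat_herm by (rule fourier_real)
  have V_meas [measurable]: "V \<in> borel_measurable borel"
    unfolding V_eq by (rule borel_measurable_continuous_onI[OF fourier_continuous[OF Vhat_L1]])
  have V_bound: "cmod (V x) \<le> norm1 Vhat" for x
    unfolding V_eq norm1_def by (rule norm_fourier_le)
  have V_decay: "\<exists>R. \<forall>x. norm x > R \<longrightarrow> cmod (V x) < \<epsilon>" if "\<epsilon> > 0" for \<epsilon>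
    unfolding V_eq using Riemann_Lebesgue[OF Vhat_L1 that] by blast
  have V_ge: "\<mu> \<le> Re (V x)" for x using x0_min by (simp add: \<mu>_def)
  have inf_V: "inf_re V = \<mu>"
    unfolding inf_re_def by (rule cInf_eq_minimum) (use V_ge in \<open>auto simp: \<mu>_def\<close>)
  have a_ge: "\<alpha> \<le> Re (fourier a \<xi>)" for \<xi>
    unfolding \<alpha>_def inf_re_def
  proof (rule cINF_lower)
    show "bdd_below (range (\<lambda>x. Re (fourier a x)))"
    proof (rule bdd_belowI2)
      fix x
      show "- norm1 a \<le> Re (fourier a x)"
        using norm_fourier_le[of a x] abs_Re_le_cmod[of "fourier a x"] unfolding norm1_def by linarith
    qed
  qed simp
  have \<mu>\<alpha>: "\<mu> \<le> \<alpha>" using Vmin_le_amin by (simp add: inf_V \<alpha>_def)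
  have \<mu>_ge: "\<mu> \<le> Re (fourier a \<xi>)" for \<xi> using \<mu>\<alpha> a_ge order.trans by blast
  have Vx0: "V x0 = of_real \<mu>" using V_real[of x0] by (simp add: \<mu>_def of_real_Re)
  define P where "P = (\<lambda>u x. (V x - of_real \<mu>) * u x)"
  \<comment> \<open>The operator shifted by \<open>\<mu>\<close>, so that eigenvalues below
    \<open>\<mu>\<close> become negative ones.\<close>
  define B where "B = (\<lambda>u. conv a u + P u)"
  have Vm_bound: "cmod (V x - of_real \<mu>) \<le> 2 * norm1 Vhat" for x
    using norm_triangle_ineq4[of "V x" "V x0"] V_bound[of x] V_bound[of x0] unfolding Vx0 by linarith
  have Vm_meas: "(\<lambda>x. V x - of_real \<mu>) \<in> borel_measurable borel" by measurable
  have A_bd: "l2.bounded_op (conv a)" using a_L1 by (rule bounded_op_conv)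
  have P_bd: "l2.bounded_op P" unfolding P_def using Vm_meas Vm_bound by (rule bounded_op_mult)
  have B_bd: "l2.bounded_op B" unfolding B_def using A_bd P_bd by (rule l2.bounded_op_plus)
  note AL = l2.bounded_opD(1)[OF A_bd] and PL = l2.bounded_opD(1)[OF P_bd] and BL = l2.bounded_opD(1)[OF B_bd]
  have P_sym: "l2ip (P u) v = l2ip u (P v)" for u v
    unfolding P_def by (rule mult_symmetric) (simp add: V_real)
  have B_ip: "l2ip (B u) v = l2ip (conv a u) v + l2ip (P u) v" if "u \<in> L2" "v \<in> L2" for u v
    unfolding B_def using that AL PL by (intro l2.ip_add) auto
  have B_sym: "l2ip (B u) v = l2ip u (B v)" if "u \<in> L2" "v \<in> L2" for u v
    using that AL PL conv_symmetric[OF a_L1 a_herm that] P_sym[of u v] unfolding B_def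
    by (simp only: l2.ip_add l2.ip_add_right)
  have P_nonneg: "0 \<le> Re (l2ip (P u) u)" for u
    unfolding P_def using V_real V_ge by (rule potential_form_nonneg)
  have B_form: "hermitian_form (\<lambda>(c::complex) f x. c * f x) L2 (\<lambda>u v. l2ip (B u) v)"
  proof
    show "cfun.subspace (L2 :: (real ^ 'd \<Rightarrow> complex) set)" by (rule L2_subspace)
    show "l2ip (B (u + v)) w = l2ip (B u) w + l2ip (B v) w" if "u \<in> L2" "v \<in> L2" "w \<in> L2" for u v w
      using B_bd that by (rule l2.bounded_opD(2))
    show "l2ip (B (\<lambda>x. c * u x)) w = c * l2ip (B u) w" if "u \<in> L2" "w \<in> L2" for c u w
      using B_bd that by (rule l2.bounded_opD(3))
    show "l2ip (B v) u = cnj (l2ip (B u) v)" if "u \<in> L2" "v \<in> L2" for u v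
      using B_sym[OF that(2,1)] l2.ip_sym[OF BL[OF that(1)] that(2)] by simp
  qed
  have lim: "((\<lambda>\<delta>. l2ip (B (trial N x0 \<delta> m)) (trial N x0 \<delta> n) / of_real (\<delta> ^ (2 * N + 2 * CARD('d))))
      \<longlongrightarrow> (-1) ^ mi_abs n * mi_deriv (n + m) a 0) (at_right 0)"
    if mn: "m \<in> mi_upto N" "n \<in> mi_upto N" for m n
  proof -
    let ?s = "\<lambda>\<delta>. complex_of_real (\<delta> ^ (2 * N + 2 * CARD('d)))"
    have "((\<lambda>\<delta>. l2ip (conv a (trial N x0 \<delta> m)) (trial N x0 \<delta> n) / ?s \<delta> + l2ip (P (trial N x0 \<delta> m)) (trial N x0 \<delta> n) / ?s \<delta>)
        \<longlongrightarrow> (-1) ^ mi_abs n * mi_deriv (n + m) a 0 + 0) (at_right 0)"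
      using conv_trial_asymptotics[OF a_meas r_pos a_smooth mn]
        potential_trial_asymptotics[OF V_meas V_bound V_flat mn] unfolding P_def Vx0
      by (rule tendsto_add)
    then have L: "((\<lambda>\<delta>. l2ip (conv a (trial N x0 \<delta> m)) (trial N x0 \<delta> n) / ?s \<delta> + l2ip (P (trial N x0 \<delta> m)) (trial N x0 \<delta> n) / ?s \<delta>)
        \<longlongrightarrow> (-1) ^ mi_abs n * mi_deriv (n + m) a 0) (at_right 0)" by (simp only: add_0_right)
    have "\<forall>\<^sub>F \<delta> in at_right 0. l2ip (conv a (trial N x0 \<delta> m)) (trial N x0 \<delta> n) / ?s \<delta> + l2ip (P (trial N x0 \<delta> m)) (trial N x0 \<delta> n) / ?s \<delta>
        = l2ip (B (trial N x0 \<delta> m)) (trial N x0 \<delta> n) / ?s \<delta>"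
      using eventually_at_right_less[of 0]
      by eventually_elim (simp only: B_ip[OF trial_L2 trial_L2] add_divide_distrib)
    from Lim_transform_eventually[OF L this] show ?thesis .
  qed
  obtain u where u: "\<And>i. i < k \<Longrightarrow> u i \<in> L2"
    and neg: "\<And>c. \<exists>i<k. c i \<noteq> 0 \<Longrightarrow>
      Re (l2ip (B (\<Sum>i<k. (\<lambda>x. c i * u i x))) (\<Sum>i<k. (\<lambda>x. c i * u i x))) < 0"
    using negative_trial_family[OF B_form lim S_subspace(1) S_negative] unfolding k_def by blast
  obtain K where K: "l2.bounded_op K" "l2.compact_op K"
    and KB: "\<And>u. u \<in> L2 \<Longrightarrow> Re (l2ip (K u) u) \<le> Re (l2ip (conv a u) u) + Re (l2ip (P u) u)"
    using compact_minorant[OF a_L1 a_herm V_meas V_real V_bound V_ge V_decay \<mu>_ge] unfolding P_def by blast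
  have BK: "Re (l2ip (K u) u) \<le> Re (l2ip (B u) u)" if "u \<in> L2" for u
    using KB[OF that] B_ip[OF that that] by simp
  obtain e l where e: "\<And>i. i < k \<Longrightarrow> e i \<in> L2" and l: "\<And>i. i < k \<Longrightarrow> l i < 0"
    and eig: "\<And>i. i < k \<Longrightarrow> nrm2 (B (e i) - (\<lambda>x. of_real (l i) * e i x)) = 0"
    and orth: "\<And>i j. i < k \<Longrightarrow> j < k \<Longrightarrow> l2ip (e i) (e j) = (if i = j then 1 else 0)"
    using l2.orthonormal_eigenvectors_of_negative_subspace[OF L2_complete B_bd B_sym K BK u neg] by blast
  have eig_AE: "AE x in lborel. conv_mult_op a V (e i) x = of_real (\<mu> + l i) * e i x" if i: "i < k" for i
  proof -
    have "B (e i) - (\<lambda>x. of_real (l i) * e i x) \<in> L2"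
      using BL[OF e[OF i]] l2.scale_H[OF e[OF i]] by (rule l2.diff_H)
    from nrm2_eq_0_iff[OF this] eig[OF i]
    have "AE x in lborel. (B (e i) - (\<lambda>x. of_real (l i) * e i x)) x = 0" by blast
    then show ?thesis
      by eventually_elim (simp add: B_def P_def conv_mult_op_def conv_def algebra_simps)
  qed
  \<comment> \<open>The eigenvalue is the value of the form at a unit vector: the convolution part
    is at least \<open>\<alpha>\<close> and the shifted potential is nonnegative.\<close>
  have l_ge: "\<alpha> \<le> l i" if i: "i < k" for i
  proof -
    have "l2ip (B (e i)) (e i) = l2ip (\<lambda>x. of_real (l i) * e i x) (e i)"
      by (rule l2.nrm_zero_ip[OF BL[OF e[OF i]] l2.scale_H[OF e[OF i]] e[OF i] eig[OF i]])
    also have "\<dots> = of_real (l i)" using l2.ip_scale[OF e[OF i] e[OF i]] orth[OF i i] by simp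
    finally have "l i = Re (l2ip (conv a (e i)) (e i)) + Re (l2ip (P (e i)) (e i))"
      using B_ip[OF e[OF i] e[OF i]] by (metis Re_complex_of_real plus_complex.simps(1))
    moreover have "\<alpha> * (nrm2 (e i))\<^sup>2 \<le> Re (l2ip (conv a (e i)) (e i))"
      by (rule conv_form_ge[OF a_L1 a_herm a_ge e[OF i]])
    moreover have "(nrm2 (e i))\<^sup>2 = 1" using l2.nrm_square[OF e[OF i]] orth[OF i i] by simp
    ultimately show ?thesis using P_nonneg[of "e i"] by simp
  qed
  \<comment> \<open>Undoing the shift moves \<open>l i\<close>, which lies between
    \<open>\<alpha>\<close> and 0, to \<open>\<mu> + l i\<close>; the right end
    \<open>min \<alpha> \<mu>\<close> equals \<open>\<mu>\<close> because
    \<open>\<mu> \<le> \<alpha>\<close>.\<close>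
  have "enat k \<le> eig_count (conv_mult_op a V) {\<alpha> + \<mu> ..< min \<alpha> \<mu>}"
  proof (rule eig_count_ge_orthonormal[OF e orth eig_AE])
    fix i assume "i < k"
    then show "\<mu> + l i \<in> {\<alpha> + \<mu> ..< min \<alpha> \<mu>}" using l[of i] l_ge[of i] \<mu>\<alpha> by simp
  qed
  then show ?thesis unfolding k_def \<alpha>_def inf_V .
qed

end
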